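(* Provably in $\mathsf{ACA}_0^\omega+\mathsf{FIN}$: for every Baire 1 function $f:[0,1]\to\mathbb{R}$ of bounded variation, the set of points of continuity of $f$ is dense in $[0,1]$.
   Context: Framework: Kohlenbach's higher-order Reverse Mathematics. $\mathsf{ACA}_0^\omega$ is the base theory $\mathsf{RCA}_0^\omega$ plus Kleene's $(\exists^2)$: $(\exists\varphi^2\le_21)(\forall f^1)[(\exists n)(f(n)=0)\leftrightarrow\varphi(f)=0]$. A set $X\subset\mathbb{R}$ (given by a characteristic function) is finite if there is $N$ such that among any distinct reals $x_0,\dots,x_N$ some $x_i\notin X$. $\mathsf{FIN}$: (1) $\bigcup_{n\le k}X_n$ is finite for any sequence of finite sets and $k$; (2) every finite set of reals is contained in the range of a finite sequence of reals; (3) for $Y^2,k^0$ with $(\forall n\le k)(\exists f\in2^{\mathbb{N}})(Y(f,n)=0)$ there are $f_0,\dots,f_k$ with $Y(f_n,n)=0$ for $n\le k$. Baire 1: pointwise limit of a sequence of continuous functions. Bounded variation: some $k_0$ bounds $\sum_{i<n}|f(x_i)-f(x_{i+1})|$ over all partitions $0=x_0<\dots<x_n=1$. *)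

theory Defs
  imports Main
begin

section \<open>The language of all finite types\<close>

datatype ty = T0 | Fun ty ty  (infixr "\<rightarrow>" 65)

text \<open>Type 0 is the type of natural numbers, and \<open>T1 \<rightarrow> T0\<close> is type 2.\<close>

abbreviation T1 :: ty where "T1 \<equiv> T0 \<rightarrow> T0"

text \<open>
  Variables are named by an index and a type.  Besides the variables \<open>Var\<close>, which are the ones that
  can be bound, there are free parameters \<open>Par\<close>; they serve as eigenvariables in derivations and as
  terms that may be substituted without any danger of capture.

  \<open>Kc\<close> and \<open>Sc\<close> are the combinators usually written \<open>\<Pi>\<close> and \<open>\<Sigma>\<close>, and \<open>Rc\<close> is the recursor for
  primitive recursion of type 0.
\<close>

datatype trm =
    Var nat ty
  | Par nat ty
  | Zero
  | One
  | Plus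
  | Times
  | Kc ty ty
  | Sc ty ty ty
  | Rc
  | App trm trm

primrec tyof :: "trm \<Rightarrow> ty option" where
  "tyof (Var x \<rho>) = Some \<rho>"
| "tyof (Par a \<rho>) = Some \<rho>"
| "tyof Zero = Some T0"
| "tyof One = Some T0"
| "tyof Plus = Some (T0 \<rightarrow> T0 \<rightarrow> T0)"
| "tyof Times = Some (T0 \<rightarrow> T0 \<rightarrow> T0)"
| "tyof (Kc \<rho> \<tau>) = Some (\<rho> \<rightarrow> \<tau> \<rightarrow> \<rho>)"
| "tyof (Sc \<rho> \<sigma> \<tau>) = Some ((\<rho> \<rightarrow> \<sigma> \<rightarrow> \<tau>) \<rightarrow> (\<rho> \<rightarrow> \<sigma>) \<rightarrow> \<rho> \<rightarrow> \<tau>)"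
| "tyof Rc = Some ((T0 \<rightarrow> T0 \<rightarrow> T0) \<rightarrow> T0 \<rightarrow> T0 \<rightarrow> T0)"
| "tyof (App s t) =
     (case tyof s of
        Some (\<rho> \<rightarrow> \<tau>) \<Rightarrow> (if tyof t = Some \<rho> then Some \<tau> else None)
      | _ \<Rightarrow> None)"

primrec vars :: "trm \<Rightarrow> (nat \<times> ty) set" where
  "vars (Var x \<rho>) = {(x, \<rho>)}"
| "vars (Par a \<rho>) = {}"
| "vars Zero = {}"
| "vars One = {}"
| "vars Plus = {}"
| "vars Times = {}"
| "vars (Kc \<rho> \<tau>) = {}"
| "vars (Sc \<rho> \<sigma> \<tau>) = {}"
| "vars Rc = {}"
| "vars (App s t) = vars s \<union> vars t"

primrec tpars :: "trm \<Rightarrow> (nat \<times> ty) set" where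
  "tpars (Var x \<rho>) = {}"
| "tpars (Par a \<rho>) = {(a, \<rho>)}"
| "tpars Zero = {}"
| "tpars One = {}"
| "tpars Plus = {}"
| "tpars Times = {}"
| "tpars (Kc \<rho> \<tau>) = {}"
| "tpars (Sc \<rho> \<sigma> \<tau>) = {}"
| "tpars Rc = {}"
| "tpars (App s t) = tpars s \<union> tpars t"

primrec tsubst :: "nat \<Rightarrow> ty \<Rightarrow> trm \<Rightarrow> trm \<Rightarrow> trm" where
  "tsubst x \<rho> u (Var y \<sigma>) = (if (y, \<sigma>) = (x, \<rho>) then u else Var y \<sigma>)"
| "tsubst x \<rho> u (Par a \<sigma>) = Par a \<sigma>"
| "tsubst x \<rho> u Zero = Zero"
| "tsubst x \<rho> u One = One"
| "tsubst x \<rho> u Plus = Plus"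
| "tsubst x \<rho> u Times = Times"
| "tsubst x \<rho> u (Kc \<sigma> \<tau>) = Kc \<sigma> \<tau>"
| "tsubst x \<rho> u (Sc \<sigma> \<sigma>' \<tau>) = Sc \<sigma> \<sigma>' \<tau>"
| "tsubst x \<rho> u Rc = Rc"
| "tsubst x \<rho> u (App s t) = App (tsubst x \<rho> u s) (tsubst x \<rho> u t)"

text \<open>Only equality and order at type 0 are primitive.\<close>

datatype fm =
    Fls
  | Eq trm trm
  | Less trm trm
  | Imp fm fm
  | Forall nat ty fm

abbreviation Neg :: "fm \<Rightarrow> fm" where "Neg \<phi> \<equiv> Imp \<phi> Fls"
abbreviation Conj :: "fm \<Rightarrow> fm \<Rightarrow> fm" where "Conj \<phi> \<psi> \<equiv> Neg (Imp \<phi> (Neg \<psi>))"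
abbreviation Exists :: "nat \<Rightarrow> ty \<Rightarrow> fm \<Rightarrow> fm" where "Exists x \<rho> \<phi> \<equiv> Neg (Forall x \<rho> (Neg \<phi>))"

primrec wff :: "fm \<Rightarrow> bool" where
  "wff Fls = True"
| "wff (Eq s t) = (tyof s = Some T0 \<and> tyof t = Some T0)"
| "wff (Less s t) = (tyof s = Some T0 \<and> tyof t = Some T0)"
| "wff (Imp \<phi> \<psi>) = (wff \<phi> \<and> wff \<psi>)"
| "wff (Forall x \<rho> \<phi>) = wff \<phi>"

primrec fv :: "fm \<Rightarrow> (nat \<times> ty) set" where
  "fv Fls = {}"
| "fv (Eq s t) = vars s \<union> vars t"
| "fv (Less s t) = vars s \<union> vars t"
| "fv (Imp \<phi> \<psi>) = fv \<phi> \<union> fv \<psi>"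
| "fv (Forall x \<rho> \<phi>) = fv \<phi> - {(x, \<rho>)}"

primrec pars :: "fm \<Rightarrow> (nat \<times> ty) set" where
  "pars Fls = {}"
| "pars (Eq s t) = tpars s \<union> tpars t"
| "pars (Less s t) = tpars s \<union> tpars t"
| "pars (Imp \<phi> \<psi>) = pars \<phi> \<union> pars \<psi>"
| "pars (Forall x \<rho> \<phi>) = pars \<phi>"

primrec quantifier_free :: "fm \<Rightarrow> bool" where
  "quantifier_free Fls = True"
| "quantifier_free (Eq s t) = True"
| "quantifier_free (Less s t) = True"
| "quantifier_free (Imp \<phi> \<psi>) = (quantifier_free \<phi> \<and> quantifier_free \<psi>)"
| "quantifier_free (Forall x \<rho> \<phi>) = False"

text \<open>
  Naive substitution.  It is only used where no capture is possible: for terms without variables,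
  and in quantifier-free formulas.
\<close>

primrec subst :: "nat \<Rightarrow> ty \<Rightarrow> trm \<Rightarrow> fm \<Rightarrow> fm" where
  "subst x \<rho> u Fls = Fls"
| "subst x \<rho> u (Eq s t) = Eq (tsubst x \<rho> u s) (tsubst x \<rho> u t)"
| "subst x \<rho> u (Less s t) = Less (tsubst x \<rho> u s) (tsubst x \<rho> u t)"
| "subst x \<rho> u (Imp \<phi> \<psi>) = Imp (subst x \<rho> u \<phi>) (subst x \<rho> u \<psi>)"
| "subst x \<rho> u (Forall y \<sigma> \<phi>) = Forall y \<sigma> (if (y, \<sigma>) = (x, \<rho>) then \<phi> else subst x \<rho> u \<phi>)"


section \<open>Derivability in classical many-sorted predicate logic\<close>

text \<open>
  Natural deduction.  The axiom sets used below contain no parameters, so the eigenvariable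
  condition of \<open>AllI\<close> is no restriction on them.
\<close>

inductive derives :: "fm set \<Rightarrow> fm \<Rightarrow> bool"  (infix "\<turnstile>" 40) where
  Assm: "\<phi> \<in> \<Gamma> \<Longrightarrow> \<Gamma> \<turnstile> \<phi>"
| ImpI: "wff \<phi> \<Longrightarrow> fv \<phi> = {} \<Longrightarrow> insert \<phi> \<Gamma> \<turnstile> \<psi> \<Longrightarrow> \<Gamma> \<turnstile> Imp \<phi> \<psi>"
| ImpE: "\<Gamma> \<turnstile> Imp \<phi> \<psi> \<Longrightarrow> \<Gamma> \<turnstile> \<phi> \<Longrightarrow> \<Gamma> \<turnstile> \<psi>"
| DNE: "\<Gamma> \<turnstile> Neg (Neg \<phi>) \<Longrightarrow> \<Gamma> \<turnstile> \<phi>"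
| AllI: "(a, \<rho>) \<notin> pars \<phi> \<Longrightarrow> \<forall>\<psi>\<in>\<Gamma>. (a, \<rho>) \<notin> pars \<psi> \<Longrightarrow>
         \<Gamma> \<turnstile> subst x \<rho> (Par a \<rho>) \<phi> \<Longrightarrow> \<Gamma> \<turnstile> Forall x \<rho> \<phi>"
| AllE: "\<Gamma> \<turnstile> Forall x \<rho> \<phi> \<Longrightarrow> tyof t = Some \<rho> \<Longrightarrow> vars t = {} \<Longrightarrow> \<Gamma> \<turnstile> subst x \<rho> t \<phi>"


section \<open>Notation for terms and formulas\<close>

text \<open>
  \<open>bracket x \<sigma> t\<close> is the usual combinator term for \<open>\<lambda>x\<^sup>\<sigma>. t\<close>.
\<close>

fun bracket :: "nat \<Rightarrow> ty \<Rightarrow> trm \<Rightarrow> trm" where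
  "bracket x \<sigma> (App s t) =
     (if (x, \<sigma>) \<in> vars (App s t)
      then App (App (Sc \<sigma> (the (tyof t)) (the (tyof (App s t)))) (bracket x \<sigma> s)) (bracket x \<sigma> t)
      else App (Kc (the (tyof (App s t))) \<sigma>) (App s t))"
| "bracket x \<sigma> t =
     (if t = Var x \<sigma> then App (App (Sc \<sigma> (\<sigma> \<rightarrow> \<sigma>) \<sigma>) (Kc \<sigma> (\<sigma> \<rightarrow> \<sigma>))) (Kc \<sigma> \<sigma>)
      else App (Kc (the (tyof t)) \<sigma>) t)"

text \<open>
  To write formulas without managing variable names, terms and formulas are presented as functions
  of the number \<open>d\<close> of enclosing binders, and the variable bound at depth \<open>d\<close> gets index \<open>d\<close>.
  Hence the variables in scope always have smaller indices than the ones introduced by a binder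
  further inside, and no definition below can capture a variable of its arguments.  A closed
  expression is read off at depth 0.
\<close>

type_synonym tm = "nat \<Rightarrow> trm"
type_synonym form = "nat \<Rightarrow> fm"

definition cst :: "trm \<Rightarrow> tm" where "cst c = (\<lambda>d. c)"

definition app :: "tm \<Rightarrow> tm \<Rightarrow> tm"  (infixl "\<cdot>" 90) where
  "s \<cdot> t = (\<lambda>d. App (s d) (t d))"

definition lam :: "ty \<Rightarrow> (tm \<Rightarrow> tm) \<Rightarrow> tm" where
  "lam \<rho> t = (\<lambda>d. bracket d \<rho> (t (cst (Var d \<rho>)) (Suc d)))"

definition fls_fm :: form where "fls_fm = (\<lambda>d. Fls)"

definition eq_fm :: "tm \<Rightarrow> tm \<Rightarrow> form"  (infix "\<^bold>=" 50) where
  "(s \<^bold>= t) = (\<lambda>d. Eq (s d) (t d))"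

definition less_fm :: "tm \<Rightarrow> tm \<Rightarrow> form"  (infix "\<^bold><" 50) where
  "(s \<^bold>< t) = (\<lambda>d. Less (s d) (t d))"

definition imp_fm :: "form \<Rightarrow> form \<Rightarrow> form"  (infixr "\<^bold>\<longrightarrow>" 25) where
  "(\<phi> \<^bold>\<longrightarrow> \<psi>) = (\<lambda>d. Imp (\<phi> d) (\<psi> d))"

definition all_fm :: "ty \<Rightarrow> (tm \<Rightarrow> form) \<Rightarrow> form" where
  "all_fm \<rho> \<phi> = (\<lambda>d. Forall d \<rho> (\<phi> (cst (Var d \<rho>)) (Suc d)))"

definition neg_fm :: "form \<Rightarrow> form"  ("\<^bold>\<not> _" [40] 40) where
  "(\<^bold>\<not> \<phi>) = (\<phi> \<^bold>\<longrightarrow> fls_fm)"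

definition conj_fm :: "form \<Rightarrow> form \<Rightarrow> form"  (infixr "\<^bold>\<and>" 35) where
  "(\<phi> \<^bold>\<and> \<psi>) = (\<^bold>\<not> (\<phi> \<^bold>\<longrightarrow> \<^bold>\<not> \<psi>))"

definition disj_fm :: "form \<Rightarrow> form \<Rightarrow> form"  (infixr "\<^bold>\<or>" 30) where
  "(\<phi> \<^bold>\<or> \<psi>) = (\<^bold>\<not> \<phi> \<^bold>\<longrightarrow> \<psi>)"

definition iff_fm :: "form \<Rightarrow> form \<Rightarrow> form"  (infixr "\<^bold>\<longleftrightarrow>" 25) where
  "(\<phi> \<^bold>\<longleftrightarrow> \<psi>) = ((\<phi> \<^bold>\<longrightarrow> \<psi>) \<^bold>\<and> (\<psi> \<^bold>\<longrightarrow> \<phi>))"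

definition ex_fm :: "ty \<Rightarrow> (tm \<Rightarrow> form) \<Rightarrow> form" where
  "ex_fm \<rho> \<phi> = (\<^bold>\<not> all_fm \<rho> (\<lambda>x. \<^bold>\<not> \<phi> x))"

definition le_fm :: "tm \<Rightarrow> tm \<Rightarrow> form"  (infix "\<^bold>\<le>" 50) where
  "(s \<^bold>\<le> t) = (s \<^bold>< t \<^bold>\<or> s \<^bold>= t)"

syntax
  "_lam" :: "pttrn \<Rightarrow> ty \<Rightarrow> tm \<Rightarrow> tm"  ("(3\<^bold>\<lambda>_\<^bold>:_./ _)" [0, 0, 10] 10)
  "_all" :: "pttrn \<Rightarrow> ty \<Rightarrow> form \<Rightarrow> form"  ("(3\<^bold>\<forall>_\<^bold>:_./ _)" [0, 0, 10] 10)
  "_ex" :: "pttrn \<Rightarrow> ty \<Rightarrow> form \<Rightarrow> form"  ("(3\<^bold>\<exists>_\<^bold>:_./ _)" [0, 0, 10] 10)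
translations
  "\<^bold>\<lambda>x\<^bold>:\<rho>. t" \<rightleftharpoons> "CONST lam \<rho> (\<lambda>x. t)"
  "\<^bold>\<forall>x\<^bold>:\<rho>. \<phi>" \<rightleftharpoons> "CONST all_fm \<rho> (\<lambda>x. \<phi>)"
  "\<^bold>\<exists>x\<^bold>:\<rho>. \<phi>" \<rightleftharpoons> "CONST ex_fm \<rho> (\<lambda>x. \<phi>)"

abbreviation zero_tm :: tm  ("\<^bold>0") where "\<^bold>0 \<equiv> cst Zero"
abbreviation one_tm :: tm  ("\<^bold>1") where "\<^bold>1 \<equiv> cst One"

definition plus_tm :: "tm \<Rightarrow> tm \<Rightarrow> tm"  (infixl "\<^bold>+" 65) where
  "(s \<^bold>+ t) = cst Plus \<cdot> s \<cdot> t"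

definition times_tm :: "tm \<Rightarrow> tm \<Rightarrow> tm"  (infixl "\<^bold>*" 70) where
  "(s \<^bold>* t) = cst Times \<cdot> s \<cdot> t"

text \<open>Equality at higher types is defined extensionally.\<close>

primrec eqT :: "ty \<Rightarrow> tm \<Rightarrow> tm \<Rightarrow> form" where
  "eqT T0 s t = (s \<^bold>= t)"
| "eqT (\<rho> \<rightarrow> \<tau>) s t = (\<^bold>\<forall>z\<^bold>:\<rho>. eqT \<tau> (s \<cdot> z) (t \<cdot> z))"


section \<open>The axioms of \<open>ACA\<^sub>0\<^sup>\<omega>\<close>\<close>

definition equality_axioms :: "form set" where
  "equality_axioms = {
     \<^bold>\<forall>x\<^bold>:T0. x \<^bold>= x,
     \<^bold>\<forall>x\<^bold>:T0. \<^bold>\<forall>y\<^bold>:T0. x \<^bold>= y \<^bold>\<longrightarrow> y \<^bold>= x,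
     \<^bold>\<forall>x\<^bold>:T0. \<^bold>\<forall>y\<^bold>:T0. \<^bold>\<forall>z\<^bold>:T0. x \<^bold>= y \<^bold>\<longrightarrow> y \<^bold>= z \<^bold>\<longrightarrow> x \<^bold>= z,
     \<^bold>\<forall>x\<^bold>:T0. \<^bold>\<forall>y\<^bold>:T0. \<^bold>\<forall>u\<^bold>:T0. \<^bold>\<forall>v\<^bold>:T0. x \<^bold>= u \<^bold>\<longrightarrow> y \<^bold>= v \<^bold>\<longrightarrow> x \<^bold>< y \<^bold>\<longrightarrow> u \<^bold>< v }"

text \<open>
  The basic arithmetical axioms in the formulation usual for second-order arithmetic; together with
  quantifier-free induction they give the discretely ordered semi-ring axioms.
\<close>

definition arithmetic_axioms :: "form set" where
  "arithmetic_axioms = {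
     \<^bold>\<forall>n\<^bold>:T0. \<^bold>\<not> n \<^bold>+ \<^bold>1 \<^bold>= \<^bold>0,
     \<^bold>\<forall>m\<^bold>:T0. \<^bold>\<forall>n\<^bold>:T0. m \<^bold>+ \<^bold>1 \<^bold>= n \<^bold>+ \<^bold>1 \<^bold>\<longrightarrow> m \<^bold>= n,
     \<^bold>\<forall>m\<^bold>:T0. m \<^bold>+ \<^bold>0 \<^bold>= m,
     \<^bold>\<forall>m\<^bold>:T0. \<^bold>\<forall>n\<^bold>:T0. m \<^bold>+ (n \<^bold>+ \<^bold>1) \<^bold>= (m \<^bold>+ n) \<^bold>+ \<^bold>1,
     \<^bold>\<forall>m\<^bold>:T0. m \<^bold>* \<^bold>0 \<^bold>= \<^bold>0,
     \<^bold>\<forall>m\<^bold>:T0. \<^bold>\<forall>n\<^bold>:T0. m \<^bold>* (n \<^bold>+ \<^bold>1) \<^bold>= (m \<^bold>* n) \<^bold>+ m,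
     \<^bold>\<forall>m\<^bold>:T0. \<^bold>\<not> m \<^bold>< \<^bold>0,
     \<^bold>\<forall>m\<^bold>:T0. \<^bold>\<forall>n\<^bold>:T0. m \<^bold>< n \<^bold>+ \<^bold>1 \<^bold>\<longleftrightarrow> (m \<^bold>< n \<^bold>\<or> m \<^bold>= n) }"

definition combinator_axioms :: "form set" where
  "combinator_axioms =
     {\<^bold>\<forall>x\<^bold>:\<rho>. \<^bold>\<forall>y\<^bold>:\<tau>. eqT \<rho> (cst (Kc \<rho> \<tau>) \<cdot> x \<cdot> y) x | \<rho> \<tau>. True} \<union>
     {\<^bold>\<forall>x\<^bold>:\<rho> \<rightarrow> \<sigma> \<rightarrow> \<tau>. \<^bold>\<forall>y\<^bold>:\<rho> \<rightarrow> \<sigma>. \<^bold>\<forall>z\<^bold>:\<rho>. eqT \<tau> (cst (Sc \<rho> \<sigma> \<tau>) \<cdot> x \<cdot> y \<cdot> z) (x \<cdot> z \<cdot> (y \<cdot> z))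
      | \<rho> \<sigma> \<tau>. True}"

definition recursor_axioms :: "form set" where
  "recursor_axioms = {
     \<^bold>\<forall>f\<^bold>:T0 \<rightarrow> T0 \<rightarrow> T0. \<^bold>\<forall>m\<^bold>:T0. cst Rc \<cdot> f \<cdot> m \<cdot> \<^bold>0 \<^bold>= m,
     \<^bold>\<forall>f\<^bold>:T0 \<rightarrow> T0 \<rightarrow> T0. \<^bold>\<forall>m\<^bold>:T0. \<^bold>\<forall>n\<^bold>:T0. cst Rc \<cdot> f \<cdot> m \<cdot> (n \<^bold>+ \<^bold>1) \<^bold>= f \<cdot> n \<cdot> (cst Rc \<cdot> f \<cdot> m \<cdot> n) }"

definition extensionality_axioms :: "form set" where
  "extensionality_axioms =
     {\<^bold>\<forall>x\<^bold>:\<rho>. \<^bold>\<forall>y\<^bold>:\<rho>. \<^bold>\<forall>\<phi>\<^bold>:\<rho> \<rightarrow> \<tau>. eqT \<rho> x y \<^bold>\<longrightarrow> eqT \<tau> (\<phi> \<cdot> x) (\<phi> \<cdot> y) | \<rho> \<tau>. True}"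

text \<open>
  The two axiom schemes range over quantifier-free formulas \<open>A\<close> with arbitrary further variables of
  any type; \<open>generalize vs\<close> supplies the universal closure.
\<close>

definition generalize :: "(nat \<times> ty) list \<Rightarrow> fm \<Rightarrow> fm" where
  "generalize vs \<phi> = foldr (\<lambda>(x, \<rho>). Forall x \<rho>) vs \<phi>"

definition induction_axioms :: "fm set" where
  "induction_axioms =
     {generalize vs
        (Imp (subst n T0 Zero A)
          (Imp (Forall n T0 (Imp A (subst n T0 (App (App Plus (Var n T0)) One) A)))
            (Forall n T0 A))) | vs n A.
      wff A \<and> quantifier_free A \<and> pars A = {} \<and> fv A \<subseteq> insert (n, T0) (set vs)}"

definition QF_AC_10_axioms :: "fm set" where
  "QF_AC_10_axioms =
     {generalize vs
        (Imp (Forall f T1 (Exists n T0 A))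
          (Exists F (T1 \<rightarrow> T0) (Forall f T1 (subst n T0 (App (Var F (T1 \<rightarrow> T0)) (Var f T1)) A)))) | vs f n F A.
      wff A \<and> quantifier_free A \<and> pars A = {} \<and> fv A \<subseteq> {(f, T1), (n, T0)} \<union> set vs \<and>
      (F, T1 \<rightarrow> T0) \<notin> fv A}"

definition at_depth_0 :: "form \<Rightarrow> fm" where "at_depth_0 \<phi> = \<phi> 0"

definition RCA0\<omega> :: "fm set" where
  "RCA0\<omega> =
     at_depth_0 ` (equality_axioms \<union> arithmetic_axioms \<union> combinator_axioms \<union> recursor_axioms \<union>
       extensionality_axioms) \<union>
     induction_axioms \<union> QF_AC_10_axioms"

definition exists2 :: form where
  "exists2 = (\<^bold>\<exists>\<phi>\<^bold>:T1 \<rightarrow> T0. (\<^bold>\<forall>f\<^bold>:T1. \<phi> \<cdot> f \<^bold>\<le> \<^bold>1) \<^bold>\<and>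
                (\<^bold>\<forall>f\<^bold>:T1. (\<^bold>\<exists>n\<^bold>:T0. f \<cdot> n \<^bold>= \<^bold>0) \<^bold>\<longleftrightarrow> \<phi> \<cdot> f \<^bold>= \<^bold>0))"

definition ACA0\<omega> :: "fm set" where
  "ACA0\<omega> = insert (at_depth_0 exists2) RCA0\<omega>"


section \<open>Rational numbers\<close>

definition primrec_tm :: "(tm \<Rightarrow> tm \<Rightarrow> tm) \<Rightarrow> tm \<Rightarrow> tm \<Rightarrow> tm" where
  "primrec_tm f m n = cst Rc \<cdot> (\<^bold>\<lambda>i\<^bold>:T0. \<^bold>\<lambda>r\<^bold>:T0. f i r) \<cdot> m \<cdot> n"

definition pred_tm :: "tm \<Rightarrow> tm" where
  "pred_tm n = primrec_tm (\<lambda>i r. i) \<^bold>0 n"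

definition monus_tm :: "tm \<Rightarrow> tm \<Rightarrow> tm"  (infixl "\<^bold>-" 65) where
  "(m \<^bold>- n) = primrec_tm (\<lambda>i r. pred_tm r) m n"

definition pow2 :: "tm \<Rightarrow> tm" where
  "pow2 n = primrec_tm (\<lambda>i r. r \<^bold>+ r) \<^bold>1 n"

text \<open>
  Cantor pairing: \<open>pair a b = (0 + \<dots> + (a + b)) + b\<close>.  \<open>diag z\<close> is the number \<open>a + b\<close> of the
  diagonal of \<open>z = pair a b\<close>; the summand in its recursion is 1 if \<open>tri (r + 1) \<le> i + 1\<close> and 0
  otherwise.
\<close>

definition tri :: "tm \<Rightarrow> tm" where
  "tri n = primrec_tm (\<lambda>i r. r \<^bold>+ (i \<^bold>+ \<^bold>1)) \<^bold>0 n"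

definition pair :: "tm \<Rightarrow> tm \<Rightarrow> tm" where
  "pair a b = cst ((\<^bold>\<lambda>a\<^bold>:T0. \<^bold>\<lambda>b\<^bold>:T0. tri (a \<^bold>+ b) \<^bold>+ b) 0) \<cdot> a \<cdot> b"

definition diag :: "tm \<Rightarrow> tm" where
  "diag z =
     cst ((\<^bold>\<lambda>z\<^bold>:T0. primrec_tm (\<lambda>i r. r \<^bold>+ (\<^bold>1 \<^bold>- (tri (r \<^bold>+ \<^bold>1) \<^bold>- (i \<^bold>+ \<^bold>1)))) \<^bold>0 z) 0) \<cdot> z"

definition second :: "tm \<Rightarrow> tm" where
  "second z = cst ((\<^bold>\<lambda>z\<^bold>:T0. z \<^bold>- tri (diag z)) 0) \<cdot> z"

definition first :: "tm \<Rightarrow> tm" where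
  "first z = cst ((\<^bold>\<lambda>z\<^bold>:T0. diag z \<^bold>- second z) 0) \<cdot> z"

text \<open>
  Every natural number codes a rational number: \<open>quot a b c\<close> codes \<open>(a - b) / (c + 1)\<close>.  Different
  codes may represent the same rational.
\<close>

definition quot :: "tm \<Rightarrow> tm \<Rightarrow> tm \<Rightarrow> tm" where
  "quot a b c = pair (pair a b) c"

definition qpos :: "tm \<Rightarrow> tm" where "qpos q = first (first q)"
definition qneg :: "tm \<Rightarrow> tm" where "qneg q = second (first q)"
definition qden :: "tm \<Rightarrow> tm" where "qden q = second q \<^bold>+ \<^bold>1"

definition qadd :: "tm \<Rightarrow> tm \<Rightarrow> tm"  (infixl "+\<^sub>Q" 65) where
  "p +\<^sub>Q q =
     cst ((\<^bold>\<lambda>p\<^bold>:T0. \<^bold>\<lambda>q\<^bold>:T0.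
       quot (qpos p \<^bold>* qden q \<^bold>+ qpos q \<^bold>* qden p) (qneg p \<^bold>* qden q \<^bold>+ qneg q \<^bold>* qden p)
            (pred_tm (qden p \<^bold>* qden q))) 0) \<cdot> p \<cdot> q"

definition quminus :: "tm \<Rightarrow> tm"  ("-\<^sub>Q _" [81] 80) where
  "-\<^sub>Q q = cst ((\<^bold>\<lambda>q\<^bold>:T0. quot (qneg q) (qpos q) (second q)) 0) \<cdot> q"

definition qabs :: "tm \<Rightarrow> tm" where
  "qabs q =
     cst ((\<^bold>\<lambda>q\<^bold>:T0. quot ((qpos q \<^bold>- qneg q) \<^bold>+ (qneg q \<^bold>- qpos q)) \<^bold>0 (second q)) 0) \<cdot> q"

definition qless :: "tm \<Rightarrow> tm \<Rightarrow> form"  (infix "<\<^sub>Q" 50) where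
  "(p <\<^sub>Q q) = (qpos p \<^bold>* qden q \<^bold>+ qneg q \<^bold>* qden p \<^bold>< qpos q \<^bold>* qden p \<^bold>+ qneg p \<^bold>* qden q)"

definition qle :: "tm \<Rightarrow> tm \<Rightarrow> form"  (infix "\<le>\<^sub>Q" 50) where
  "(p \<le>\<^sub>Q q) = (\<^bold>\<not> q <\<^sub>Q p)"

definition qnat :: "tm \<Rightarrow> tm" where
  "qnat n = quot n \<^bold>0 \<^bold>0"

text \<open>\<open>qeps n\<close> is \<open>2\<^bsup>-n\<^esup>\<close>.\<close>

definition qeps :: "tm \<Rightarrow> tm" where
  "qeps n = quot \<^bold>1 \<^bold>0 (pred_tm (pow2 n))"


section \<open>Real numbers\<close>

text \<open>
  A real is a function \<open>x\<close> of type 1 such that \<open>\<bar>x n - x (n + i)\<bar> < 2\<^bsup>-n\<^esup>\<close> as rationals.  Quantifiers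
  over reals are relativized to this condition.
\<close>

definition is_real :: "tm \<Rightarrow> form" where
  "is_real x = (\<^bold>\<forall>n\<^bold>:T0. \<^bold>\<forall>i\<^bold>:T0. qabs ((x \<cdot> n) +\<^sub>Q -\<^sub>Q (x \<cdot> (n \<^bold>+ i))) <\<^sub>Q qeps n)"

definition req :: "tm \<Rightarrow> tm \<Rightarrow> form"  (infix "=\<^sub>R" 50) where
  "(x =\<^sub>R y) = (\<^bold>\<forall>n\<^bold>:T0. qabs ((x \<cdot> n) +\<^sub>Q -\<^sub>Q (y \<cdot> n)) \<le>\<^sub>Q qeps n +\<^sub>Q qeps n)"

definition rless :: "tm \<Rightarrow> tm \<Rightarrow> form"  (infix "<\<^sub>R" 50) where
  "(x <\<^sub>R y) = (\<^bold>\<exists>n\<^bold>:T0. (x \<cdot> n) +\<^sub>Q (qeps n +\<^sub>Q qeps n) <\<^sub>Q y \<cdot> n)"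

definition rle :: "tm \<Rightarrow> tm \<Rightarrow> form"  (infix "\<le>\<^sub>R" 50) where
  "(x \<le>\<^sub>R y) = (\<^bold>\<not> y <\<^sub>R x)"

definition rconst :: "tm \<Rightarrow> tm" where
  "rconst q = (\<^bold>\<lambda>n\<^bold>:T0. q)"

definition rdist :: "tm \<Rightarrow> tm \<Rightarrow> tm" where
  "rdist x y = (\<^bold>\<lambda>n\<^bold>:T0. qabs ((x \<cdot> (n \<^bold>+ \<^bold>1)) +\<^sub>Q -\<^sub>Q (y \<cdot> (n \<^bold>+ \<^bold>1))))"

text \<open>
  The sum of the reals \<open>g 0, \<dots>, g (m - 1)\<close>, for \<open>g\<close> of type \<open>T0 \<rightarrow> T1\<close>.  Its \<open>n\<close>-th approximation
  adds the approximations with index \<open>n + m\<close>, so that the total error is at most \<open>m * 2\<^bsup>-(n+m)\<^esup>\<close>,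
  which is below \<open>2\<^bsup>-n\<^esup>\<close>.
\<close>

definition rsum :: "tm \<Rightarrow> tm \<Rightarrow> tm" where
  "rsum g m = (\<^bold>\<lambda>n\<^bold>:T0. primrec_tm (\<lambda>i r. r +\<^sub>Q (g \<cdot> i \<cdot> (n \<^bold>+ m))) (qnat \<^bold>0) m)"

definition unit_interval :: "tm \<Rightarrow> form" where
  "unit_interval x = (is_real x \<^bold>\<and> rconst (qnat \<^bold>0) \<le>\<^sub>R x \<^bold>\<and> x \<le>\<^sub>R rconst (qnat \<^bold>1))"

definition all_real :: "(tm \<Rightarrow> form) \<Rightarrow> form"  (binder "\<^bold>\<forall>\<^sub>R" 10) where
  "(\<^bold>\<forall>\<^sub>R x. \<phi> x) = (\<^bold>\<forall>x\<^bold>:T1. is_real x \<^bold>\<longrightarrow> \<phi> x)"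

definition all_unit :: "(tm \<Rightarrow> form) \<Rightarrow> form"  (binder "\<^bold>\<forall>\<^sub>I" 10) where
  "(\<^bold>\<forall>\<^sub>I x. \<phi> x) = (\<^bold>\<forall>x\<^bold>:T1. unit_interval x \<^bold>\<longrightarrow> \<phi> x)"

definition ex_unit :: "(tm \<Rightarrow> form) \<Rightarrow> form"  (binder "\<^bold>\<exists>\<^sub>I" 10) where
  "(\<^bold>\<exists>\<^sub>I x. \<phi> x) = (\<^bold>\<exists>x\<^bold>:T1. unit_interval x \<^bold>\<and> \<phi> x)"


section \<open>Finite sets of reals and the principle FIN\<close>

text \<open>A set of reals is a characteristic function of type \<open>T1 \<rightarrow> T0\<close> that respects \<open>=\<^sub>R\<close>.\<close>

definition real_set :: "tm \<Rightarrow> form" where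
  "real_set X = ((\<^bold>\<forall>\<^sub>R x. X \<cdot> x \<^bold>= \<^bold>0 \<^bold>\<or> X \<cdot> x \<^bold>= \<^bold>1) \<^bold>\<and>
                 (\<^bold>\<forall>\<^sub>R x. \<^bold>\<forall>\<^sub>R y. x =\<^sub>R y \<^bold>\<longrightarrow> X \<cdot> x \<^bold>= X \<cdot> y))"

definition mem :: "tm \<Rightarrow> tm \<Rightarrow> form"  (infix "\<^bold>\<in>" 50) where
  "(x \<^bold>\<in> X) = (X \<cdot> x \<^bold>= \<^bold>1)"

text \<open>
  Finiteness is formulated for a membership condition \<open>P\<close>, so that it can be applied to a union of
  sets as well.  A finite sequence \<open>x\<^sub>0, \<dots>, x\<^sub>M\<close> is an object of type \<open>T0 \<rightarrow> \<rho>\<close> together with the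
  bound \<open>M\<close>; the values beyond the bound play no role.
\<close>

definition finite_reals :: "(tm \<Rightarrow> form) \<Rightarrow> form" where
  "finite_reals P =
     (\<^bold>\<exists>M\<^bold>:T0. \<^bold>\<forall>x\<^bold>:T0 \<rightarrow> T1.
        (\<^bold>\<forall>i\<^bold>:T0. i \<^bold>\<le> M \<^bold>\<longrightarrow> is_real (x \<cdot> i)) \<^bold>\<and>
        (\<^bold>\<forall>i\<^bold>:T0. \<^bold>\<forall>j\<^bold>:T0. i \<^bold>\<le> M \<^bold>\<and> j \<^bold>\<le> M \<^bold>\<and> \<^bold>\<not> i \<^bold>= j \<^bold>\<longrightarrow> \<^bold>\<not> x \<cdot> i =\<^sub>R x \<cdot> j)
        \<^bold>\<longrightarrow> (\<^bold>\<exists>i\<^bold>:T0. i \<^bold>\<le> M \<^bold>\<and> \<^bold>\<not> P (x \<cdot> i)))"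

definition finite_union :: form where
  "finite_union =
     (\<^bold>\<forall>X\<^bold>:T0 \<rightarrow> T1 \<rightarrow> T0.
        (\<^bold>\<forall>n\<^bold>:T0. real_set (X \<cdot> n) \<^bold>\<and> finite_reals (\<lambda>x. x \<^bold>\<in> X \<cdot> n)) \<^bold>\<longrightarrow>
        (\<^bold>\<forall>k\<^bold>:T0. finite_reals (\<lambda>x. \<^bold>\<exists>n\<^bold>:T0. n \<^bold>\<le> k \<^bold>\<and> x \<^bold>\<in> X \<cdot> n)))"

definition finite_enumeration :: form where
  "finite_enumeration =
     (\<^bold>\<forall>X\<^bold>:T1 \<rightarrow> T0.
        real_set X \<^bold>\<and> finite_reals (\<lambda>x. x \<^bold>\<in> X) \<^bold>\<longrightarrow>
        (\<^bold>\<exists>k\<^bold>:T0. \<^bold>\<exists>x\<^bold>:T0 \<rightarrow> T1.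
           (\<^bold>\<forall>i\<^bold>:T0. i \<^bold>\<le> k \<^bold>\<longrightarrow> is_real (x \<cdot> i)) \<^bold>\<and>
           (\<^bold>\<forall>\<^sub>R y. y \<^bold>\<in> X \<^bold>\<longrightarrow> (\<^bold>\<exists>i\<^bold>:T0. i \<^bold>\<le> k \<^bold>\<and> y =\<^sub>R x \<cdot> i))))"

definition cantor :: "tm \<Rightarrow> form" where
  "cantor f = (\<^bold>\<forall>n\<^bold>:T0. f \<cdot> n \<^bold>\<le> \<^bold>1)"

definition finite_choice :: form where
  "finite_choice =
     (\<^bold>\<forall>Y\<^bold>:T1 \<rightarrow> T0 \<rightarrow> T0. \<^bold>\<forall>k\<^bold>:T0.
        (\<^bold>\<forall>n\<^bold>:T0. n \<^bold>\<le> k \<^bold>\<longrightarrow> (\<^bold>\<exists>f\<^bold>:T1. cantor f \<^bold>\<and> Y \<cdot> f \<cdot> n \<^bold>= \<^bold>0)) \<^bold>\<longrightarrow>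
        (\<^bold>\<exists>f\<^bold>:T0 \<rightarrow> T1. \<^bold>\<forall>n\<^bold>:T0. n \<^bold>\<le> k \<^bold>\<longrightarrow> cantor (f \<cdot> n) \<^bold>\<and> Y \<cdot> (f \<cdot> n) \<cdot> n \<^bold>= \<^bold>0))"

definition FIN :: "fm set" where
  "FIN = at_depth_0 ` {finite_union, finite_enumeration, finite_choice}"


section \<open>Functions on the unit interval\<close>

text \<open>A function from \<open>[0,1]\<close> to the reals is an object of type \<open>T1 \<rightarrow> T1\<close> that respects \<open>=\<^sub>R\<close>.\<close>

definition unit_function :: "tm \<Rightarrow> form" where
  "unit_function f = ((\<^bold>\<forall>\<^sub>I x. is_real (f \<cdot> x)) \<^bold>\<and>
                      (\<^bold>\<forall>\<^sub>I x. \<^bold>\<forall>\<^sub>I y. x =\<^sub>R y \<^bold>\<longrightarrow> f \<cdot> x =\<^sub>R f \<cdot> y))"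

definition continuous_at :: "tm \<Rightarrow> tm \<Rightarrow> form" where
  "continuous_at f x =
     (\<^bold>\<forall>k\<^bold>:T0. \<^bold>\<exists>m\<^bold>:T0. \<^bold>\<forall>\<^sub>I y. rdist x y <\<^sub>R rconst (qeps m) \<^bold>\<longrightarrow>
        rdist (f \<cdot> x) (f \<cdot> y) <\<^sub>R rconst (qeps k))"

definition baire1 :: "tm \<Rightarrow> form" where
  "baire1 f =
     (\<^bold>\<exists>g\<^bold>:T0 \<rightarrow> T1 \<rightarrow> T1.
        (\<^bold>\<forall>n\<^bold>:T0. unit_function (g \<cdot> n) \<^bold>\<and> (\<^bold>\<forall>\<^sub>I x. continuous_at (g \<cdot> n) x)) \<^bold>\<and>
        (\<^bold>\<forall>\<^sub>I x. \<^bold>\<forall>k\<^bold>:T0. \<^bold>\<exists>m\<^bold>:T0. \<^bold>\<forall>n\<^bold>:T0. m \<^bold>\<le> n \<^bold>\<longrightarrow>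
           rdist (g \<cdot> n \<cdot> x) (f \<cdot> x) <\<^sub>R rconst (qeps k)))"

definition bounded_variation :: "tm \<Rightarrow> form" where
  "bounded_variation f =
     (\<^bold>\<exists>b\<^bold>:T0. \<^bold>\<forall>n\<^bold>:T0. \<^bold>\<forall>x\<^bold>:T0 \<rightarrow> T1.
        (\<^bold>\<forall>i\<^bold>:T0. i \<^bold>\<le> n \<^bold>\<longrightarrow> is_real (x \<cdot> i)) \<^bold>\<and>
        x \<cdot> \<^bold>0 =\<^sub>R rconst (qnat \<^bold>0) \<^bold>\<and> x \<cdot> n =\<^sub>R rconst (qnat \<^bold>1) \<^bold>\<and>
        (\<^bold>\<forall>i\<^bold>:T0. i \<^bold>< n \<^bold>\<longrightarrow> x \<cdot> i <\<^sub>R x \<cdot> (i \<^bold>+ \<^bold>1)) \<^bold>\<longrightarrow>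
        rsum (\<^bold>\<lambda>i\<^bold>:T0. rdist (f \<cdot> (x \<cdot> i)) (f \<cdot> (x \<cdot> (i \<^bold>+ \<^bold>1)))) n \<le>\<^sub>R rconst (qnat b))"

definition dense_in_unit_interval :: "(tm \<Rightarrow> form) \<Rightarrow> form" where
  "dense_in_unit_interval P =
     (\<^bold>\<forall>\<^sub>I y. \<^bold>\<forall>k\<^bold>:T0. \<^bold>\<exists>\<^sub>I x. P x \<^bold>\<and> rdist y x <\<^sub>R rconst (qeps k))"

definition baire1_bv_continuity_dense :: form where
  "baire1_bv_continuity_dense =
     (\<^bold>\<forall>f\<^bold>:T1 \<rightarrow> T1. unit_function f \<^bold>\<and> baire1 f \<^bold>\<and> bounded_variation f \<^bold>\<longrightarrow>
        dense_in_unit_interval (\<lambda>x. continuous_at f x))"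

end

theory Submission
  imports Defs "HOL-Library.Countable" "HOL-Computational_Algebra.Fraction_Field"
begin

text \<open>
  By completeness it suffices to argue in an arbitrary extensional Henkin model.  Its numbers form a
  discretely ordered semiring, and rationals and approximations to reals are evaluated in the ordered
  field which that semiring generates.  In the model the theorem is a Baire category argument.  Let
  \<open>f\<close> be the pointwise limit of continuous \<open>g\<^sub>n\<close>.  Every ball contains a smaller one on which all
  but finitely many \<open>g\<^sub>n\<close> stay within \<open>2\<^bsup>-k\<^esup>\<close> of a fixed value: otherwise nested balls with
  \<open>\<bar>g\<^sub>n - g\<^sub>m\<bar>\<close> bounded away from 0, for every \<open>m\<close> and some \<open>n \<ge> m\<close>, would shrink to a point where
  \<open>g\<^sub>n\<close> does not converge.  Nesting such balls for \<open>k = 0, 1, \<dots>\<close> gives a point of continuity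
  of \<open>f\<close>.  By continuity all conditions on the balls can be tested at rational points, which makes them
  arithmetical; so \<open>\<exists>\<^sup>2\<close> decides them, and quantifier-free choice and recursion produce the
  sequences of balls.
\<close>

section \<open>Substitution and renaming\<close>

text \<open>The numbers of the model may be nonstandard. Induction and recursion of the metalogic
  therefore do not apply to them: each must be won inside the model, from an axiom instance whose
  matrix is quantifier-free. This obstacle shapes everything between completeness and the Baire
  argument. A number function counts as definable (\<open>dfn\<close>) when an object of type 1 has
  its values, and a predicate as decidable (\<open>decd\<close>) when such a function vanishes
  exactly where it holds; the later inductions and choices all concern predicates of this kind.
  Testing approximations instead of values blurs each inequality by a few multiples of a power of
  1/2, which is where the margins 16, 13 and 7 come from. A second difficulty is syntactic: a term
  made by bracket abstraction depends, as a string, on the depth at which it is read, and its value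
  is well defined only because the model is extensional.\<close>

instance ty :: countable by countable_datatype
instance trm :: countable by countable_datatype
text \<open>Lets the Henkin construction run through all formulas in stages indexed by natural
  numbers.\<close>

instance fm :: countable by countable_datatype

text \<open>Parameters may occur: these terms are the possible instances in \<open>AllE\<close> and
  become the elements of the term model.\<close>

definition closed_terms :: "ty \<Rightarrow> trm set" where
  "closed_terms \<rho> = {t. vars t = {} \<and> tyof t = Some \<rho>}"

definition sentence :: "fm \<Rightarrow> bool" where
  "sentence \<phi> \<longleftrightarrow> wff \<phi> \<and> fv \<phi> = {}"

lemma App_closed: "s \<in> closed_terms (\<rho> \<rightarrow> \<tau>) \<Longrightarrow> t \<in> closed_terms \<rho> \<Longrightarrow> App s t \<in> closed_terms \<tau>"
  by (auto simp: closed_terms_def)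

lemma Par_closed: "Par a \<rho> \<in> closed_terms \<rho>"
  by (simp add: closed_terms_def)

lemma tyof_AppE:
  assumes "tyof (App s t) = Some \<tau>"
  obtains \<rho> where "tyof s = Some (\<rho> \<rightarrow> \<tau>)" "tyof t = Some \<rho>"
  using assms by (auto split: option.splits ty.splits if_splits)

lemma finite_pars: "finite (pars \<phi>)"
proof -
  have "finite (tpars t)" for t by (induction t) auto
  then show ?thesis by (induction \<phi>) auto
qed

lemma finite_fv: "finite (fv \<phi>)"
proof -
  have "finite (vars t)" for t by (induction t) auto
  then show ?thesis by (induction \<phi>) auto
qed

lemma tyof_tsubst: "tyof u = Some \<rho> \<Longrightarrow> tyof (tsubst x \<rho> u t) = tyof t"
  by (induction t) (auto split: option.split ty.split)

lemma vars_tsubst: "vars u = {} \<Longrightarrow> vars (tsubst x \<rho> u t) = vars t - {(x, \<rho>)}"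
  by (induction t) auto

lemma tsubst_idle: "(x, \<rho>) \<notin> vars t \<Longrightarrow> tsubst x \<rho> u t = t"
  by (induction t) auto

lemma wff_subst: "tyof u = Some \<rho> \<Longrightarrow> wff \<phi> \<Longrightarrow> wff (subst x \<rho> u \<phi>)"
  by (induction \<phi>) (auto simp: tyof_tsubst)

lemma fv_subst: "vars u = {} \<Longrightarrow> fv (subst x \<rho> u \<phi>) = fv \<phi> - {(x, \<rho>)}"
  by (induction \<phi>) (auto simp: vars_tsubst)

lemma sentence_subst:
  "sentence (Forall x \<rho> \<phi>) \<Longrightarrow> t \<in> closed_terms \<rho> \<Longrightarrow> sentence (subst x \<rho> t \<phi>)"
  by (auto simp: sentence_def closed_terms_def fv_subst wff_subst)

section \<open>Renaming of parameters\<close>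

primrec rename_trm :: "(nat \<times> ty \<Rightarrow> nat) \<Rightarrow> trm \<Rightarrow> trm" where
  "rename_trm f (Var x \<rho>) = Var x \<rho>"
| "rename_trm f (Par a \<rho>) = Par (f (a, \<rho>)) \<rho>"
| "rename_trm f Zero = Zero"
| "rename_trm f One = One"
| "rename_trm f Plus = Plus"
| "rename_trm f Times = Times"
| "rename_trm f (Kc \<rho> \<tau>) = Kc \<rho> \<tau>"
| "rename_trm f (Sc \<rho> \<sigma> \<tau>) = Sc \<rho> \<sigma> \<tau>"
| "rename_trm f Rc = Rc"
| "rename_trm f (App s t) = App (rename_trm f s) (rename_trm f t)"

primrec rename :: "(nat \<times> ty \<Rightarrow> nat) \<Rightarrow> fm \<Rightarrow> fm" where
  "rename f Fls = Fls"
| "rename f (Eq s t) = Eq (rename_trm f s) (rename_trm f t)"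
| "rename f (Less s t) = Less (rename_trm f s) (rename_trm f t)"
| "rename f (Imp \<phi> \<psi>) = Imp (rename f \<phi>) (rename f \<psi>)"
| "rename f (Forall x \<rho> \<phi>) = Forall x \<rho> (rename f \<phi>)"

lemma vars_rename_trm [simp]: "vars (rename_trm f t) = vars t"
  by (induction t) auto

lemma tyof_rename_trm [simp]: "tyof (rename_trm f t) = tyof t"
  by (induction t) (auto split: option.split ty.split)

lemma wff_rename [simp]: "wff (rename f \<phi>) = wff \<phi>"
  by (induction \<phi>) auto

lemma fv_rename [simp]: "fv (rename f \<phi>) = fv \<phi>"
  by (induction \<phi>) auto

lemma rename_tsubst: "rename_trm f (tsubst x \<rho> u t) = tsubst x \<rho> (rename_trm f u) (rename_trm f t)"
  by (induction t) auto

lemma rename_subst: "rename f (subst x \<rho> u \<phi>) = subst x \<rho> (rename_trm f u) (rename f \<phi>)"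
  by (induction \<phi>) (auto simp: rename_tsubst)

lemma rename_trm_cong: "\<forall>p\<in>tpars t. f p = g p \<Longrightarrow> rename_trm f t = rename_trm g t"
  by (induction t) auto

lemma rename_cong: "\<forall>p\<in>pars \<phi>. f p = g p \<Longrightarrow> rename f \<phi> = rename g \<phi>"
proof (induction \<phi>)
  case (Eq s t)
  then show ?case by (auto intro!: rename_trm_cong)
next
  case (Less s t)
  then show ?case by (auto intro!: rename_trm_cong)
qed auto

text \<open>A renaming computes a new index from the old index and the type, so \<open>fst\<close>
  is the identity. Because it sees the type, it can move one parameter without touching those of the
  same index at other types.\<close>

lemma rename_fst: "rename fst \<phi> = \<phi>"
proof -
  have "rename_trm fst t = t" for t by (induction t) auto
  then show ?thesis by (induction \<phi>) auto
qed

text \<open>Infinitely many parameters of each type, and not merely one, so that the property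
  survives the addition of a formula, which contains only finitely many.\<close>

definition many_fresh :: "fm set \<Rightarrow> bool" where
  "many_fresh \<Gamma> \<longleftrightarrow> (\<forall>\<rho>. infinite {a. \<forall>\<phi>\<in>\<Gamma>. (a, \<rho>) \<notin> pars \<phi>})"

lemma many_fresh_insert:
  assumes "many_fresh \<Gamma>"
  shows "many_fresh (insert \<phi> \<Gamma>)"
  unfolding many_fresh_def
proof
  fix \<rho>
  have "finite {a. (a, \<rho>) \<in> pars \<phi>}"
    using finite_vimageI[OF finite_pars, of "\<lambda>a. (a, \<rho>)" \<phi>] by (simp add: vimage_def inj_on_def)
  then have "infinite ({a. \<forall>\<psi>\<in>\<Gamma>. (a, \<rho>) \<notin> pars \<psi>} - {a. (a, \<rho>) \<in> pars \<phi>})"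
    using assms by (auto simp: many_fresh_def)
  then show "infinite {a. \<forall>\<psi>\<in>insert \<phi> \<Gamma>. (a, \<rho>) \<notin> pars \<psi>}"
    by (rule contrapos_nn, elim rev_finite_subset) auto
qed

lemma fresh_parameter:
  assumes "many_fresh \<Gamma>"
  obtains a where "(a, \<rho>) \<notin> pars \<phi>" "\<forall>\<psi>\<in>\<Gamma>. (a, \<rho>) \<notin> pars \<psi>"
proof -
  have "infinite {a. \<forall>\<psi>\<in>insert \<phi> \<Gamma>. (a, \<rho>) \<notin> pars \<psi>}"
    using many_fresh_insert[OF assms] by (simp add: many_fresh_def)
  then obtain a where "\<forall>\<psi>\<in>insert \<phi> \<Gamma>. (a, \<rho>) \<notin> pars \<psi>"
    using not_finite_existsD by auto
  then show thesis using that by auto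
qed

text \<open>
  Weakening can clash with eigenvariables, so it is proved together with renaming of parameters.
\<close>

lemma derives_rename:
  assumes "\<Gamma> \<turnstile> \<phi>"
  shows "rename f ` \<Gamma> \<subseteq> \<Delta> \<Longrightarrow> many_fresh \<Delta> \<Longrightarrow> \<Delta> \<turnstile> rename f \<phi>"
  using assms
proof (induction arbitrary: f \<Delta> rule: derives.induct)
  case (Assm \<phi> \<Gamma>)
  then show ?case by (auto intro: derives.Assm)
next
  case (ImpI \<phi> \<Gamma> \<psi>)
  have "insert (rename f \<phi>) \<Delta> \<turnstile> rename f \<psi>"
    using ImpI.prems by (intro ImpI.IH many_fresh_insert) auto
  then show ?case using ImpI.hyps by (auto intro: derives.ImpI)
next
  case (ImpE \<Gamma> \<phi> \<psi>)
  then show ?case by (metis derives.ImpE rename.simps(4))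
next
  case (DNE \<Gamma> \<phi>)
  then have "\<Delta> \<turnstile> rename f (Neg (Neg \<phi>))" by blast
  then show ?case by (auto intro: derives.DNE)
next
  case (AllI a \<rho> \<phi> \<Gamma> x)
  obtain b where b: "(b, \<rho>) \<notin> pars (rename f \<phi>)" "\<forall>\<psi>\<in>\<Delta>. (b, \<rho>) \<notin> pars \<psi>"
    using fresh_parameter[OF AllI.prems(2)] .
  \<comment> \<open>Only the eigenvariable is redirected, to a parameter new to \<Delta>. On
    \<Gamma> and \<phi>, where it does not occur, the new renaming agrees with
    \<open>f\<close>.\<close>
  let ?g = "f((a, \<rho>) := b)"
  have eq: "rename ?g \<psi> = rename f \<psi>" if "(a, \<rho>) \<notin> pars \<psi>" for \<psi>
    using that by (intro rename_cong) auto
  have "rename ?g ` \<Gamma> = rename f ` \<Gamma>"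
    using AllI.hyps(2) by (intro image_cong refl eq) auto
  then have "\<Delta> \<turnstile> rename ?g (subst x \<rho> (Par a \<rho>) \<phi>)"
    using AllI.prems by (intro AllI.IH) (simp_all only:)
  then have "\<Delta> \<turnstile> subst x \<rho> (Par b \<rho>) (rename f \<phi>)"
    by (simp add: rename_subst eq[OF AllI.hyps(1)])
  then show ?case using b by (auto intro: derives.AllI)
next
  case (AllE \<Gamma> x \<rho> \<phi> t)
  then have "\<Delta> \<turnstile> Forall x \<rho> (rename f \<phi>)" by auto
  then show ?case using AllE.hyps by (auto simp: rename_subst intro!: derives.AllE)
qed

text \<open>The identity renaming turns the preceding lemma into weakening; the fresh parameters let
  eigenvariables get out of the way of the larger set.\<close>

lemma derives_weaken:
  assumes "\<Gamma> \<turnstile> \<phi>" "\<Gamma> \<subseteq> \<Delta>" "many_fresh \<Delta>"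
  shows "\<Delta> \<turnstile> \<phi>"
  using derives_rename[OF assms(1), of fst \<Delta>] assms(2,3) by (simp add: rename_fst)

lemma derives_weaken_insert:
  "\<Gamma> \<turnstile> \<phi> \<Longrightarrow> many_fresh \<Gamma> \<Longrightarrow> insert \<psi> \<Gamma> \<turnstile> \<phi>"
  by (rule derives_weaken) (auto intro: many_fresh_insert)

text \<open>\<open>Fls\<close> has no elimination rule of its own: the contradiction is weakened to
  the assumption \<open>Neg \<phi>\<close>, which \<open>ImpI\<close> discharges and
  \<open>DNE\<close> removes. \<open>ImpI\<close> is what asks for a sentence.\<close>

lemma ex_falso:
  assumes "\<Gamma> \<turnstile> Fls" "sentence \<phi>" "many_fresh \<Gamma>"
  shows "\<Gamma> \<turnstile> \<phi>"
  by (rule derives.DNE, rule derives.ImpI)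
    (use assms in \<open>auto simp: sentence_def intro: derives_weaken_insert\<close>)


section \<open>Maximal consistent Henkin sets\<close>

definition consistent :: "fm set \<Rightarrow> bool" where
  "consistent \<Gamma> \<longleftrightarrow> \<not> \<Gamma> \<turnstile> Fls"

text \<open>With \<open>Forall\<close> as the only quantifier, witnesses take the form of
  counterexamples: a negated instance at a parameter new to the theory.\<close>

definition henkin_witness :: "fm set \<Rightarrow> fm \<Rightarrow> fm \<Rightarrow> bool" where
  "henkin_witness \<Gamma> \<phi> \<psi> \<longleftrightarrow>
     (\<exists>x \<rho> \<chi> a. \<phi> = Forall x \<rho> \<chi> \<and> \<psi> = Neg (subst x \<rho> (Par a \<rho>) \<chi>) \<and>
       (a, \<rho>) \<notin> pars \<chi> \<and> (\<forall>\<psi>\<in>\<Gamma>. (a, \<rho>) \<notin> pars \<psi>))"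

text \<open>A rejected universal sentence is refuted by the theory, so this is the moment to supply
  its counterexample.\<close>

definition henkin_step :: "fm set \<Rightarrow> fm \<Rightarrow> fm set" where
  "henkin_step \<Gamma> \<phi> =
     (if \<not> sentence \<phi> then \<Gamma>
      else if consistent (insert \<phi> \<Gamma>) then insert \<phi> \<Gamma>
      else if \<exists>x \<rho> \<chi>. \<phi> = Forall x \<rho> \<chi> then insert (SOME \<psi>. henkin_witness \<Gamma> \<phi> \<psi>) \<Gamma>
      else \<Gamma>)"

primrec henkin_chain :: "fm set \<Rightarrow> nat \<Rightarrow> fm set" where
  "henkin_chain \<Gamma> 0 = \<Gamma>"
| "henkin_chain \<Gamma> (Suc n) = henkin_step (henkin_chain \<Gamma> n) (from_nat n)"

lemma henkin_witness_SOME: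
  assumes "many_fresh \<Gamma>" "\<phi> = Forall x \<rho> \<chi>"
  shows "henkin_witness \<Gamma> \<phi> (SOME \<psi>. henkin_witness \<Gamma> \<phi> \<psi>)"
proof (rule someI_ex)
  obtain a where "(a, \<rho>) \<notin> pars \<chi>" "\<forall>\<psi>\<in>\<Gamma>. (a, \<rho>) \<notin> pars \<psi>"
    using fresh_parameter[OF assms(1)] .
  then show "\<exists>\<psi>. henkin_witness \<Gamma> \<phi> \<psi>"
    unfolding henkin_witness_def using assms(2) by blast
qed

lemma refutes_inconsistent:
  "sentence \<phi> \<Longrightarrow> \<not> consistent (insert \<phi> \<Gamma>) \<Longrightarrow> \<Gamma> \<turnstile> Neg \<phi>"
  by (auto simp: sentence_def consistent_def intro: derives.ImpI)

lemma henkin_step: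
  assumes "many_fresh \<Gamma>" "consistent \<Gamma>"
  shows "\<Gamma> \<subseteq> henkin_step \<Gamma> \<phi> \<and> many_fresh (henkin_step \<Gamma> \<phi>) \<and> consistent (henkin_step \<Gamma> \<phi>)"
proof (cases "sentence \<phi> \<and> \<not> consistent (insert \<phi> \<Gamma>) \<and> (\<exists>x \<rho> \<chi>. \<phi> = Forall x \<rho> \<chi>)")
  case True
  then obtain x \<rho> \<chi> where \<phi>: "\<phi> = Forall x \<rho> \<chi>" by blast
  define \<psi> where "\<psi> = (SOME \<psi>. henkin_witness \<Gamma> \<phi> \<psi>)"
  have "henkin_witness \<Gamma> \<phi> \<psi>"
    unfolding \<psi>_def using assms(1) \<phi> by (rule henkin_witness_SOME)
  then obtain a where a: "\<psi> = Neg (subst x \<rho> (Par a \<rho>) \<chi>)" "(a, \<rho>) \<notin> pars \<chi>"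
      "\<forall>\<psi>\<in>\<Gamma>. (a, \<rho>) \<notin> pars \<psi>"
    by (auto simp: henkin_witness_def \<phi>)
  have neg: "\<Gamma> \<turnstile> Neg \<phi>" using True by (intro refutes_inconsistent) auto
  \<comment> \<open>If the counterexample were inconsistent, its instance would be derivable at a
    fresh parameter, and \<open>AllI\<close> would yield the sentence that is already
    refuted.\<close>
  have "consistent (insert \<psi> \<Gamma>)"
  proof (rule ccontr)
    assume "\<not> consistent (insert \<psi> \<Gamma>)"
    moreover have "sentence \<psi>"
      using sentence_subst[of x \<rho> \<chi> "Par a \<rho>"] True Par_closed \<phi>
      by (simp add: a(1) sentence_def)
    ultimately have "\<Gamma> \<turnstile> Neg \<psi>" by (intro refutes_inconsistent) auto
    then have "\<Gamma> \<turnstile> \<phi>"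
      unfolding \<phi> a(1) by (intro derives.AllI[OF a(2,3)], rule derives.DNE)
    then have "\<Gamma> \<turnstile> Fls" by (rule derives.ImpE[OF neg])
    then show False using assms(2) by (simp add: consistent_def)
  qed
  then show ?thesis
    using True many_fresh_insert[OF assms(1)] by (auto simp: henkin_step_def \<psi>_def)
next
  case False
  then show ?thesis
    using assms many_fresh_insert[OF assms(1)] by (auto simp: henkin_step_def)
qed

section \<open>The union of the Henkin chain\<close>

locale henkin =
  fixes \<Gamma> :: "fm set"
  assumes many_fresh: "many_fresh \<Gamma>" and consistent: "consistent \<Gamma>"
begin

definition H :: "fm set" where "H = (\<Union>n. henkin_chain \<Gamma> n)"

lemma chain: "many_fresh (henkin_chain \<Gamma> n) \<and> consistent (henkin_chain \<Gamma> n)"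
  using many_fresh consistent by (induction n) (auto simp: henkin_step)

lemma chain_mono: "m \<le> n \<Longrightarrow> henkin_chain \<Gamma> m \<subseteq> henkin_chain \<Gamma> n"
  by (rule lift_Suc_mono_le) (use chain henkin_step in auto)

lemma chain_weaken: "henkin_chain \<Gamma> m \<turnstile> \<phi> \<Longrightarrow> m \<le> n \<Longrightarrow> henkin_chain \<Gamma> n \<turnstile> \<phi>"
  by (rule derives_weaken) (use chain chain_mono in auto)

lemma axioms_H: "\<Gamma> \<subseteq> H"
  using UN_upper[of 0 UNIV "henkin_chain \<Gamma>"] by (simp add: H_def)

text \<open>The sentence is examined at stage \<open>to_nat \<phi>\<close>; being left out means
  that adding it was inconsistent there.\<close>

lemma not_H_refuted:
  assumes "sentence \<phi>" "\<phi> \<notin> H"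
  shows "\<exists>n. henkin_chain \<Gamma> n \<turnstile> Neg \<phi>"
proof -
  let ?n = "to_nat \<phi>"
  have "\<phi> \<notin> henkin_chain \<Gamma> (Suc ?n)" using assms(2) unfolding H_def by blast
  then have "\<not> consistent (insert \<phi> (henkin_chain \<Gamma> ?n))"
    using assms(1) by (auto simp: henkin_step_def split: if_splits)
  then show ?thesis using refutes_inconsistent assms(1) by blast
qed

text \<open>Derivability is measured at the stages of the chain, since \<open>H\<close> itself may
  use up all parameters, and weakening to it would then fail.\<close>

lemma H_iff:
  assumes "sentence \<phi>"
  shows "\<phi> \<in> H \<longleftrightarrow> (\<exists>n. henkin_chain \<Gamma> n \<turnstile> \<phi>)"
proof
  assume "\<phi> \<in> H"
  then show "\<exists>n. henkin_chain \<Gamma> n \<turnstile> \<phi>" by (auto simp: H_def intro: derives.Assm)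
next
  assume "\<exists>n. henkin_chain \<Gamma> n \<turnstile> \<phi>"
  then obtain m where m: "henkin_chain \<Gamma> m \<turnstile> \<phi>" by blast
  show "\<phi> \<in> H"
  proof (rule ccontr)
    assume "\<phi> \<notin> H"
    then obtain n where n: "henkin_chain \<Gamma> n \<turnstile> Neg \<phi>" using not_H_refuted assms by blast
    have "henkin_chain \<Gamma> (max m n) \<turnstile> Fls"
      by (rule derives.ImpE[OF chain_weaken[OF n] chain_weaken[OF m]]) auto
    then show False using chain by (simp add: consistent_def)
  qed
qed

lemma H_Fls: "Fls \<notin> H"
proof -
  have "sentence Fls" by (simp add: sentence_def)
  then show ?thesis using H_iff chain by (auto simp: consistent_def)
qed

lemma H_Imp:
  assumes "sentence \<phi>" "sentence \<psi>"
  shows "Imp \<phi> \<psi> \<in> H \<longleftrightarrow> (\<phi> \<in> H \<longrightarrow> \<psi> \<in> H)"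
proof -
  have s: "sentence (Imp \<phi> \<psi>)" using assms by (simp add: sentence_def)
  show ?thesis
  proof (intro iffI impI)
    assume "Imp \<phi> \<psi> \<in> H" "\<phi> \<in> H"
    then obtain m n where "henkin_chain \<Gamma> m \<turnstile> Imp \<phi> \<psi>" "henkin_chain \<Gamma> n \<turnstile> \<phi>"
      using H_iff s assms by blast
    then have "henkin_chain \<Gamma> (max m n) \<turnstile> \<psi>"
      by (intro derives.ImpE[of _ \<phi> \<psi>]) (auto intro: chain_weaken)
    then show "\<psi> \<in> H" using H_iff assms by blast
  next
    assume "\<phi> \<in> H \<longrightarrow> \<psi> \<in> H"
    then consider "\<psi> \<in> H" | "\<phi> \<notin> H" by blast
    then have "\<exists>n. insert \<phi> (henkin_chain \<Gamma> n) \<turnstile> \<psi>"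
    proof cases
      case 1
      then show ?thesis using H_iff assms(2) chain derives_weaken_insert by blast
    next
      case 2
      then obtain n where "henkin_chain \<Gamma> n \<turnstile> Neg \<phi>" using not_H_refuted assms(1) by blast
      then have "insert \<phi> (henkin_chain \<Gamma> n) \<turnstile> Neg \<phi>"
        using chain derives_weaken_insert by blast
      then have "insert \<phi> (henkin_chain \<Gamma> n) \<turnstile> Fls"
        by (rule derives.ImpE) (auto intro: derives.Assm)
      then show ?thesis using assms(2) chain many_fresh_insert ex_falso by blast
    qed
    then show "Imp \<phi> \<psi> \<in> H"
      using H_iff[OF s] assms(1) by (auto simp: sentence_def intro: derives.ImpI)
  qed
qed

text \<open>If the universal sentence is missing, the stage that rejected it put the negation of an
  instance into \<open>H\<close>, against the instances assumed.\<close>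

lemma H_Forall:
  assumes s: "sentence (Forall x \<rho> \<phi>)"
  shows "Forall x \<rho> \<phi> \<in> H \<longleftrightarrow> (\<forall>t\<in>closed_terms \<rho>. subst x \<rho> t \<phi> \<in> H)"
proof (intro iffI ballI)
  fix t assume "Forall x \<rho> \<phi> \<in> H" and t: "t \<in> closed_terms \<rho>"
  then obtain n where "henkin_chain \<Gamma> n \<turnstile> Forall x \<rho> \<phi>" using H_iff s by blast
  then have "henkin_chain \<Gamma> n \<turnstile> subst x \<rho> t \<phi>"
    using t by (intro derives.AllE) (auto simp: closed_terms_def)
  then show "subst x \<rho> t \<phi> \<in> H" using H_iff sentence_subst[OF s t] by blast
next
  assume all: "\<forall>t\<in>closed_terms \<rho>. subst x \<rho> t \<phi> \<in> H"
  show "Forall x \<rho> \<phi> \<in> H"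
  proof (rule ccontr)
    assume notin: "Forall x \<rho> \<phi> \<notin> H"
    let ?n = "to_nat (Forall x \<rho> \<phi>)"
    let ?\<Delta> = "henkin_chain \<Gamma> ?n"
    have "Forall x \<rho> \<phi> \<notin> henkin_chain \<Gamma> (Suc ?n)" using notin unfolding H_def by blast
    then have "henkin_chain \<Gamma> (Suc ?n) =
        insert (SOME \<psi>. henkin_witness ?\<Delta> (Forall x \<rho> \<phi>) \<psi>) ?\<Delta>"
      using s by (auto simp: henkin_step_def split: if_splits)
    then have "(SOME \<psi>. henkin_witness ?\<Delta> (Forall x \<rho> \<phi>) \<psi>) \<in> H"
      unfolding H_def by blast
    moreover have "henkin_witness ?\<Delta> (Forall x \<rho> \<phi>) (SOME \<psi>. henkin_witness ?\<Delta> (Forall x \<rho> \<phi>) \<psi>)"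
      using chain henkin_witness_SOME by blast
    ultimately obtain a where "Neg (subst x \<rho> (Par a \<rho>) \<phi>) \<in> H"
      by (auto simp: henkin_witness_def)
    moreover have "sentence (subst x \<rho> (Par a \<rho>) \<phi>)" using sentence_subst[OF s Par_closed] .
    ultimately show False
      using all Par_closed H_Fls H_Imp[of "subst x \<rho> (Par a \<rho>) \<phi>" Fls]
      by (auto simp: sentence_def)
  qed
qed

end

section \<open>Extensional Henkin structures\<close>

type_synonym 'v env = "nat \<times> ty \<Rightarrow> 'v"

text \<open>Objects of all types share one HOL type, with \<open>D\<close> separating the levels;
  \<open>I\<close> supplies the values of constants and parameters. Extensionality allows equality
  at higher types to be read as identity.\<close>

locale type_structure =
  fixes D :: "ty \<Rightarrow> 'v set"
    and ap :: "'v \<Rightarrow> 'v \<Rightarrow> 'v"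
    and I :: "trm \<Rightarrow> 'v"
    and lt :: "'v \<Rightarrow> 'v \<Rightarrow> bool"
  assumes ap_D: "f \<in> D (\<rho> \<rightarrow> \<tau>) \<Longrightarrow> x \<in> D \<rho> \<Longrightarrow> ap f x \<in> D \<tau>"
    and I_D: "t \<in> closed_terms \<rho> \<Longrightarrow> I t \<in> D \<rho>"
    and extensional: "f \<in> D (\<rho> \<rightarrow> \<tau>) \<Longrightarrow> g \<in> D (\<rho> \<rightarrow> \<tau>) \<Longrightarrow> (\<And>x. x \<in> D \<rho> \<Longrightarrow> ap f x = ap g x) \<Longrightarrow> f = g"
begin

primrec ev :: "'v env \<Rightarrow> trm \<Rightarrow> 'v" where
  "ev e (Var x \<rho>) = e (x, \<rho>)"
| "ev e (Par a \<rho>) = I (Par a \<rho>)"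
| "ev e Zero = I Zero"
| "ev e One = I One"
| "ev e Plus = I Plus"
| "ev e Times = I Times"
| "ev e (Kc \<rho> \<tau>) = I (Kc \<rho> \<tau>)"
| "ev e (Sc \<rho> \<sigma> \<tau>) = I (Sc \<rho> \<sigma> \<tau>)"
| "ev e Rc = I Rc"
| "ev e (App s t) = ap (ev e s) (ev e t)"

primrec sat :: "'v env \<Rightarrow> fm \<Rightarrow> bool" where
  "sat e Fls \<longleftrightarrow> False"
| "sat e (Eq s t) \<longleftrightarrow> ev e s = ev e t"
| "sat e (Less s t) \<longleftrightarrow> lt (ev e s) (ev e t)"
| "sat e (Imp \<phi> \<psi>) \<longleftrightarrow> (sat e \<phi> \<longrightarrow> sat e \<psi>)"
| "sat e (Forall x \<rho> \<phi>) \<longleftrightarrow> (\<forall>v\<in>D \<rho>. sat (e((x, \<rho>) := v)) \<phi>)"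

definition valid :: "'v env \<Rightarrow> bool" where
  "valid e \<longleftrightarrow> (\<forall>x \<rho>. e (x, \<rho>) \<in> D \<rho>)"

lemma valid_upd: "valid e \<Longrightarrow> v \<in> D \<rho> \<Longrightarrow> valid (e((x, \<rho>) := v))"
  by (simp add: valid_def)

lemma ex_valid: "\<exists>e. valid e"
proof -
  have "valid (\<lambda>(x, \<rho>). I (Par 0 \<rho>))" by (auto simp: valid_def intro: I_D Par_closed)
  then show ?thesis by blast
qed

lemma ev_D: "valid e \<Longrightarrow> tyof t = Some \<tau> \<Longrightarrow> ev e t \<in> D \<tau>"
proof (induction t arbitrary: \<tau>)
  case (App s t)
  then show ?case by (auto elim!: tyof_AppE simp del: tyof.simps intro: ap_D)
qed (auto simp: valid_def intro!: I_D simp: closed_terms_def)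

lemma ev_cong: "\<forall>p\<in>vars t. e p = e' p \<Longrightarrow> ev e t = ev e' t"
  by (induction t) auto

lemma ev_tsubst: "ev e (tsubst x \<rho> u t) = ev (e((x, \<rho>) := ev e u)) t"
  by (induction t) auto

lemma sat_cong: "\<forall>p\<in>fv \<phi>. e p = e' p \<Longrightarrow> sat e \<phi> = sat e' \<phi>"
proof (induction \<phi> arbitrary: e e')
  case (Eq s t)
  then show ?case using ev_cong[of s e e'] ev_cong[of t e e'] by simp
next
  case (Less s t)
  then show ?case using ev_cong[of s e e'] ev_cong[of t e e'] by simp
next
  case (Imp \<phi> \<psi>)
  then have "sat e \<phi> = sat e' \<phi>" "sat e \<psi> = sat e' \<psi>" by auto
  then show ?case by simp
next
  case (Forall x \<rho> \<phi>)
  have "sat (e((x, \<rho>) := v)) \<phi> = sat (e'((x, \<rho>) := v)) \<phi>" for v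
    using Forall.prems by (intro Forall.IH) auto
  then show ?case by simp
qed simp

lemma sat_subst_quantifier_free:
  "quantifier_free \<phi> \<Longrightarrow> sat e (subst x \<rho> u \<phi>) = sat (e((x, \<rho>) := ev e u)) \<phi>"
  by (induction \<phi>) (auto simp: ev_tsubst)

text \<open>Instantiating each quantifier by the value that the environment already assigns leaves
  the environment unchanged, whatever the order of \<open>vs\<close>.\<close>

lemma sat_generalizeD:
  assumes "\<And>e. valid e \<Longrightarrow> sat e (generalize vs \<phi>)" "valid e"
  shows "sat e \<phi>"
  using assms
proof (induction vs arbitrary: e)
  case (Cons p vs)
  obtain x \<rho> where p: "p = (x, \<rho>)" by (cases p)
  have "sat e (generalize vs \<phi>)" if "valid e" for e
  proof -
    have "sat e (Forall x \<rho> (generalize vs \<phi>))"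
      using Cons.prems(1)[OF that] by (simp add: generalize_def p)
    then have "sat (e((x, \<rho>) := e (x, \<rho>))) (generalize vs \<phi>)"
      using that unfolding valid_def sat.simps by blast
    then show ?thesis by simp
  qed
  then show ?case using Cons.IH Cons.prems(2) by blast
qed (simp add: generalize_def)

end


section \<open>Completeness\<close>

text \<open>The variables bound by \<open>eqT\<close> have indices from \<open>d\<close> upwards, so
  the substituted variable with \<open>x < d\<close> is never one of them.\<close>

lemma subst_eqT:
  "x < d \<Longrightarrow> subst x \<sigma> u (eqT \<rho> s t d) =
     eqT \<rho> (\<lambda>d. tsubst x \<sigma> u (s d)) (\<lambda>d. tsubst x \<sigma> u (t d)) d"
proof (induction \<rho> arbitrary: s t d)
  case T0
  then show ?case by (simp add: eq_fm_def)
next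
  case (Fun \<rho> \<tau>)
  have "(\<lambda>k. tsubst x \<sigma> u ((r \<cdot> cst (Var d \<rho>)) k)) = (\<lambda>k. tsubst x \<sigma> u (r k)) \<cdot> cst (Var d \<rho>)" for r
    using Fun.prems by (auto simp: app_def cst_def)
  then show ?case using Fun by (simp add: all_fm_def)
qed

lemma wff_fv_eqT:
  assumes "\<And>d. tyof (s d) = Some \<rho> \<and> vars (s d) \<subseteq> V" "\<And>d. tyof (t d) = Some \<rho> \<and> vars (t d) \<subseteq> V"
  shows "wff (eqT \<rho> s t d) \<and> fv (eqT \<rho> s t d) \<subseteq> V"
  using assms
proof (induction \<rho> arbitrary: s t d V)
  case T0
  then show ?case by (simp add: eq_fm_def)
next
  case (Fun \<rho> \<tau>)
  have "wff (eqT \<tau> (s \<cdot> cst (Var d \<rho>)) (t \<cdot> cst (Var d \<rho>)) (Suc d)) \<and>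
      fv (eqT \<tau> (s \<cdot> cst (Var d \<rho>)) (t \<cdot> cst (Var d \<rho>)) (Suc d)) \<subseteq> insert (d, \<rho>) V"
    using Fun.prems by (intro Fun.IH) (auto simp: app_def cst_def)
  then show ?case by (auto simp: all_fm_def)
qed

section \<open>Simultaneous substitution for all free variables\<close>

primrec msub :: "trm env \<Rightarrow> trm \<Rightarrow> trm" where
  "msub e (Var x \<rho>) = e (x, \<rho>)"
| "msub e (Par a \<rho>) = Par a \<rho>"
| "msub e Zero = Zero"
| "msub e One = One"
| "msub e Plus = Plus"
| "msub e Times = Times"
| "msub e (Kc \<rho> \<tau>) = Kc \<rho> \<tau>"
| "msub e (Sc \<rho> \<sigma> \<tau>) = Sc \<rho> \<sigma> \<tau>"
| "msub e Rc = Rc"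
| "msub e (App s t) = App (msub e s) (msub e t)"

text \<open>Below a quantifier the bound variable is mapped to itself. The environments that arise
  thus send a variable to a closed term or to itself, which is why
  \<open>vars (e p) \<subseteq> {p}\<close> appears as a condition below.\<close>

primrec fsub :: "trm env \<Rightarrow> fm \<Rightarrow> fm" where
  "fsub e Fls = Fls"
| "fsub e (Eq s t) = Eq (msub e s) (msub e t)"
| "fsub e (Less s t) = Less (msub e s) (msub e t)"
| "fsub e (Imp \<phi> \<psi>) = Imp (fsub e \<phi>) (fsub e \<psi>)"
| "fsub e (Forall x \<rho> \<phi>) = Forall x \<rho> (fsub (e((x, \<rho>) := Var x \<rho>)) \<phi>)"

lemma tyof_msub: "\<forall>x \<rho>. tyof (e (x, \<rho>)) = Some \<rho> \<Longrightarrow> tyof (msub e t) = tyof t"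
  by (induction t) (auto split: option.split ty.split)

lemma wff_fsub: "\<forall>x \<rho>. tyof (e (x, \<rho>)) = Some \<rho> \<Longrightarrow> wff (fsub e \<phi>) = wff \<phi>"
  by (induction \<phi> arbitrary: e) (auto simp: tyof_msub)

lemma vars_msub: "\<forall>p. vars (e p) \<subseteq> {p} \<Longrightarrow> vars (msub e t) \<subseteq> {p \<in> vars t. vars (e p) \<noteq> {}}"
  by (induction t) auto

lemma fv_fsub: "\<forall>p. vars (e p) \<subseteq> {p} \<Longrightarrow> fv (fsub e \<phi>) \<subseteq> {p \<in> fv \<phi>. vars (e p) \<noteq> {}}"
proof (induction \<phi> arbitrary: e)
  case (Eq s t)
  then show ?case using vars_msub[of e s] vars_msub[of e t] by auto
next
  case (Less s t)
  then show ?case using vars_msub[of e s] vars_msub[of e t] by auto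
next
  case (Imp \<phi> \<psi>)
  then show ?case using Imp.IH(1)[OF Imp.prems] Imp.IH(2)[OF Imp.prems] by auto
next
  case (Forall x \<rho> \<phi>)
  have "fv (fsub (e((x, \<rho>) := Var x \<rho>)) \<phi>) \<subseteq> {p \<in> fv \<phi>. vars ((e((x, \<rho>) := Var x \<rho>)) p) \<noteq> {}}"
    using Forall.prems by (intro Forall.IH) auto
  then show ?case by (auto split: if_splits)
qed auto

lemma subst_msub:
  assumes "\<forall>p. vars (e p) \<subseteq> {p}"
  shows "tsubst x \<rho> u (msub (e((x, \<rho>) := Var x \<rho>)) t) = msub (e((x, \<rho>) := u)) t"
proof (induction t)
  case (Var y \<sigma>)
  then show ?case using assms by (auto intro!: tsubst_idle)
qed auto

text \<open>Brings an instance of a substituted universal formula back to one simultaneous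
  substitution, the form in which the quantifier case of the truth lemma can use its induction
  hypothesis.\<close>

lemma subst_fsub:
  "\<forall>p. vars (e p) \<subseteq> {p} \<Longrightarrow>
   subst x \<rho> u (fsub (e((x, \<rho>) := Var x \<rho>)) \<phi>) = fsub (e((x, \<rho>) := u)) \<phi>"
proof (induction \<phi> arbitrary: e)
  case (Forall y \<sigma> \<phi>)
  show ?case
  proof (cases "(y, \<sigma>) = (x, \<rho>)")
    case True
    then show ?thesis by (simp only: fsub.simps subst.simps if_True fun_upd_upd prod.inject) simp
  next
    case False
    have "subst x \<rho> u (fsub (e((y, \<sigma>) := Var y \<sigma>, (x, \<rho>) := Var x \<rho>)) \<phi>) =
        fsub (e((y, \<sigma>) := Var y \<sigma>, (x, \<rho>) := u)) \<phi>"
      using Forall.prems by (intro Forall.IH) auto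
    moreover have "e((x, \<rho>) := b, (y, \<sigma>) := c) = e((y, \<sigma>) := c, (x, \<rho>) := b)" for b c
      using False by (intro fun_upd_twist) auto
    ultimately show ?thesis using False by (simp only: fsub.simps subst.simps if_False)
  qed
qed (auto simp: subst_msub)

lemma msub_idle: "\<forall>(x, \<rho>)\<in>vars t. e (x, \<rho>) = Var x \<rho> \<Longrightarrow> msub e t = t"
  by (induction t) auto

lemma fsub_idle: "\<forall>(x, \<rho>)\<in>fv \<phi>. e (x, \<rho>) = Var x \<rho> \<Longrightarrow> fsub e \<phi> = \<phi>"
proof (induction \<phi> arbitrary: e)
  case (Forall x \<rho> \<phi>)
  have "fsub (e((x, \<rho>) := Var x \<rho>)) \<phi> = \<phi>" using Forall.prems by (intro Forall.IH) auto
  then show ?case by simp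
qed (simp_all add: msub_idle ball_Un)

locale henkin_equality = henkin +
  assumes equality_in: "at_depth_0 ` (equality_axioms \<union> extensionality_axioms) \<subseteq> \<Gamma>"
begin

lemma axiom_H: "\<phi> \<in> equality_axioms \<union> extensionality_axioms \<Longrightarrow> \<phi> 0 \<in> H"
  using equality_in axioms_H by (auto simp: at_depth_0_def)

section \<open>Provable equality as a congruence on closed terms\<close>

primrec eqv :: "ty \<Rightarrow> trm \<Rightarrow> trm \<Rightarrow> bool" where
  "eqv T0 s t \<longleftrightarrow> Eq s t \<in> H"
| "eqv (\<rho> \<rightarrow> \<tau>) s t \<longleftrightarrow> (\<forall>r\<in>closed_terms \<rho>. eqv \<tau> (App s r) (App t r))"

lemma H_instance:
  "Forall x \<rho> \<phi> \<in> H \<and> sentence (Forall x \<rho> \<phi>) \<Longrightarrow> t \<in> closed_terms \<rho> \<Longrightarrow>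
   subst x \<rho> t \<phi> \<in> H \<and> sentence (subst x \<rho> t \<phi>)"
  using H_Forall sentence_subst by blast

lemma H_mp: "Imp \<phi> \<psi> \<in> H \<and> sentence (Imp \<phi> \<psi>) \<Longrightarrow> \<phi> \<in> H \<Longrightarrow> \<psi> \<in> H \<and> sentence \<psi>"
  using H_Imp[of \<phi> \<psi>] by (auto simp: sentence_def)

text \<open>\<open>H_Forall\<close> unfolds the formula type by type. This links the axioms, which
  are stated with \<open>eqT\<close>, to the relation \<open>eqv\<close> on terms.\<close>

lemma eqT_H:
  "s \<in> closed_terms \<rho> \<Longrightarrow> t \<in> closed_terms \<rho> \<Longrightarrow> eqT \<rho> (\<lambda>d. s) (\<lambda>d. t) d \<in> H \<longleftrightarrow> eqv \<rho> s t"
proof (induction \<rho> arbitrary: s t d)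
  case T0
  then show ?case by (simp add: eq_fm_def)
next
  case (Fun \<rho> \<tau>)
  have idle: "tsubst x \<rho>' u r = r" if "r \<in> closed_terms (\<rho> \<rightarrow> \<tau>)" for r x \<rho>' u
    using that by (intro tsubst_idle) (auto simp: closed_terms_def)
  have sub: "subst d \<rho> u (eqT \<tau> ((\<lambda>d. s) \<cdot> cst (Var d \<rho>)) ((\<lambda>d. t) \<cdot> cst (Var d \<rho>)) (Suc d)) =
      eqT \<tau> (\<lambda>d. App s u) (\<lambda>d. App t u) (Suc d)" for u
    using idle Fun.prems by (simp add: subst_eqT app_def cst_def)
  have "sentence (eqT (\<rho> \<rightarrow> \<tau>) (\<lambda>d. s) (\<lambda>d. t) d)"
    using wff_fv_eqT[of "\<lambda>d. s" "\<rho> \<rightarrow> \<tau>" "{}" "\<lambda>d. t" d] Fun.prems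
    unfolding sentence_def closed_terms_def by auto
  then have "eqT (\<rho> \<rightarrow> \<tau>) (\<lambda>d. s) (\<lambda>d. t) d \<in> H \<longleftrightarrow>
      (\<forall>u\<in>closed_terms \<rho>. eqT \<tau> (\<lambda>d. App s u) (\<lambda>d. App t u) (Suc d) \<in> H)"
    by (simp add: all_fm_def H_Forall sub)
  also have "\<dots> \<longleftrightarrow> eqv (\<rho> \<rightarrow> \<tau>) s t"
    using Fun.IH(2) Fun.prems App_closed by (metis eqv.simps(2))
  finally show ?case .
qed

text \<open>An instance of the extensionality axiom. Read at depth 0, its three quantifiers bind the
  indices 0, 1 and 2, which leaves \<open>eqT\<close> at depth 3.\<close>

lemma eqv_cong:
  assumes "f \<in> closed_terms (\<rho> \<rightarrow> \<tau>)" "x \<in> closed_terms \<rho>" "y \<in> closed_terms \<rho>" "eqv \<rho> x y"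
  shows "eqv \<tau> (App f x) (App f y)"
proof -
  define A where "A = (\<^bold>\<forall>x\<^bold>:\<rho>. \<^bold>\<forall>y\<^bold>:\<rho>. \<^bold>\<forall>\<phi>\<^bold>:\<rho> \<rightarrow> \<tau>. eqT \<rho> x y \<^bold>\<longrightarrow> eqT \<tau> (\<phi> \<cdot> x) (\<phi> \<cdot> y))"
  let ?x = "Var 0 \<rho>" and ?y = "Var 1 \<rho>" and ?f = "Var 2 (\<rho> \<rightarrow> \<tau>)"
  have A: "A 0 = Forall 0 \<rho> (Forall 1 \<rho> (Forall 2 (\<rho> \<rightarrow> \<tau>)
      (Imp (eqT \<rho> (\<lambda>d. ?x) (\<lambda>d. ?y) 3) (eqT \<tau> (\<lambda>d. App ?f ?x) (\<lambda>d. App ?f ?y) 3))))"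
    by (simp add: A_def all_fm_def imp_fm_def app_def cst_def numeral_eq_Suc)
  have "A \<in> extensionality_axioms" unfolding extensionality_axioms_def A_def by blast
  then have H: "A 0 \<in> H" using axiom_H by blast
  have w: "wff (eqT \<rho> (\<lambda>d. ?x) (\<lambda>d. ?y) 3) \<and> fv (eqT \<rho> (\<lambda>d. ?x) (\<lambda>d. ?y) 3) \<subseteq> {(0, \<rho>), (1, \<rho>), (2, \<rho> \<rightarrow> \<tau>)}"
    "wff (eqT \<tau> (\<lambda>d. App ?f ?x) (\<lambda>d. App ?f ?y) 3) \<and>
      fv (eqT \<tau> (\<lambda>d. App ?f ?x) (\<lambda>d. App ?f ?y) 3) \<subseteq> {(0, \<rho>), (1, \<rho>), (2, \<rho> \<rightarrow> \<tau>)}"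
    by (intro wff_fv_eqT; simp)+
  have "sentence (A 0)" unfolding A sentence_def using w by auto
  then have "A 0 \<in> H \<and> sentence (A 0)" using H by blast
  note H_instance[OF H_instance[OF H_instance[OF this[unfolded A], simplified], simplified], simplified]
  note this[OF assms(2,3,1), simplified]
  moreover have idle: "tsubst i \<sigma> u r = r" if "r \<in> closed_terms \<sigma>'" for r i \<sigma> \<sigma>' u
    using that by (intro tsubst_idle) (auto simp: closed_terms_def)
  ultimately have "Imp (eqT \<rho> (\<lambda>d. x) (\<lambda>d. y) 3) (eqT \<tau> (\<lambda>d. App f x) (\<lambda>d. App f y) 3) \<in> H \<and>
      sentence (Imp (eqT \<rho> (\<lambda>d. x) (\<lambda>d. y) 3) (eqT \<tau> (\<lambda>d. App f x) (\<lambda>d. App f y) 3))"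
    using idle[OF assms(1)] idle[OF assms(2)] idle[OF assms(3)] by (simp add: subst_eqT)
  then have "eqT \<tau> (\<lambda>d. App f x) (\<lambda>d. App f y) 3 \<in> H"
    using H_mp eqT_H[OF assms(2,3)] assms(4) by blast
  then show ?thesis using eqT_H App_closed assms by blast
qed

lemma eqv_T0:
  assumes "r \<in> closed_terms T0" "s \<in> closed_terms T0" "t \<in> closed_terms T0"
  shows "Eq r r \<in> H" "Eq r s \<in> H \<Longrightarrow> Eq s r \<in> H" "Eq r s \<in> H \<Longrightarrow> Eq s t \<in> H \<Longrightarrow> Eq r t \<in> H"
proof -
  let ?x = "Var 0 T0" and ?y = "Var 1 T0" and ?z = "Var 2 T0"
  have "at_depth_0 ` equality_axioms \<subseteq> H" using axiom_H by (auto simp: at_depth_0_def)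
  then have "Forall 0 T0 (Eq ?x ?x) \<in> H" "Forall 0 T0 (Forall 1 T0 (Imp (Eq ?x ?y) (Eq ?y ?x))) \<in> H"
    "Forall 0 T0 (Forall 1 T0 (Forall 2 T0 (Imp (Eq ?x ?y) (Imp (Eq ?y ?z) (Eq ?x ?z))))) \<in> H"
    by (auto simp: equality_axioms_def at_depth_0_def all_fm_def imp_fm_def eq_fm_def cst_def
        numeral_eq_Suc)
  then have *: "Forall 0 T0 (Eq ?x ?x) \<in> H \<and> sentence (Forall 0 T0 (Eq ?x ?x))"
    "Forall 0 T0 (Forall 1 T0 (Imp (Eq ?x ?y) (Eq ?y ?x))) \<in> H \<and>
      sentence (Forall 0 T0 (Forall 1 T0 (Imp (Eq ?x ?y) (Eq ?y ?x))))"
    "Forall 0 T0 (Forall 1 T0 (Forall 2 T0 (Imp (Eq ?x ?y) (Imp (Eq ?y ?z) (Eq ?x ?z))))) \<in> H \<and>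
      sentence (Forall 0 T0 (Forall 1 T0 (Forall 2 T0 (Imp (Eq ?x ?y) (Imp (Eq ?y ?z) (Eq ?x ?z))))))"
    by (auto simp: sentence_def)
  have idle: "tsubst i \<sigma> u r = r" if "r \<in> closed_terms \<sigma>'" for r i \<sigma> \<sigma>' u
    using that by (intro tsubst_idle) (auto simp: closed_terms_def)
  note idle = idle[OF assms(1)] idle[OF assms(2)] idle[OF assms(3)]
  show "Eq r r \<in> H" using H_instance[OF *(1) assms(1)] by simp
  note inst2 = H_instance[OF H_instance[OF *(2) assms(1), simplified] assms(2), simplified, unfolded idle]
  show "Eq s r \<in> H" if "Eq r s \<in> H" using H_mp[OF inst2 that] by blast
  note inst3 = H_instance[OF H_instance[OF H_instance[OF *(3) assms(1), simplified] assms(2), simplified] assms(3),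
      simplified, unfolded idle]
  show "Eq r t \<in> H" if "Eq r s \<in> H" "Eq s t \<in> H" using H_mp[OF H_mp[OF inst3 that(1)] that(2)] by blast
qed

lemma Less_cong:
  assumes "s \<in> closed_terms T0" "t \<in> closed_terms T0" "s' \<in> closed_terms T0" "t' \<in> closed_terms T0"
    "Eq s s' \<in> H" "Eq t t' \<in> H" "Less s t \<in> H"
  shows "Less s' t' \<in> H"
proof -
  let ?x = "Var 0 T0" and ?y = "Var 1 T0" and ?u = "Var 2 T0" and ?v = "Var 3 T0"
  let ?A = "Forall 0 T0 (Forall 1 T0 (Forall 2 T0 (Forall 3 T0
    (Imp (Eq ?x ?u) (Imp (Eq ?y ?v) (Imp (Less ?x ?y) (Less ?u ?v)))))))"
  have "at_depth_0 ` equality_axioms \<subseteq> H" using axiom_H by (auto simp: at_depth_0_def)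
  then have "?A \<in> H"
    by (auto simp: equality_axioms_def at_depth_0_def all_fm_def imp_fm_def eq_fm_def less_fm_def
        cst_def numeral_eq_Suc)
  then have A: "?A \<in> H \<and> sentence ?A" by (auto simp: sentence_def)
  have idle: "tsubst i \<sigma> u r = r" if "r \<in> closed_terms \<sigma>'" for r i \<sigma> \<sigma>' u
    using that by (intro tsubst_idle) (auto simp: closed_terms_def)
  note idle = idle[OF assms(1)] idle[OF assms(2)] idle[OF assms(3)] idle[OF assms(4)]
  note inst = H_instance[OF H_instance[OF H_instance[OF H_instance[OF A assms(1), simplified]
      assms(2), simplified] assms(3), simplified] assms(4), simplified, unfolded idle]
  show ?thesis using H_mp[OF H_mp[OF H_mp[OF inst assms(5)] assms(6)] assms(7)] by blast
qed

lemma eqv_refl: "r \<in> closed_terms \<rho> \<Longrightarrow> eqv \<rho> r r"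
proof (induction \<rho> arbitrary: r)
  case T0
  then show ?case unfolding eqv.simps by (intro eqv_T0(1)[of r r r])
next
  case (Fun \<rho> \<tau>)
  then show ?case by (simp add: App_closed[OF Fun.prems])
qed

lemma eqv_sym: "r \<in> closed_terms \<rho> \<Longrightarrow> s \<in> closed_terms \<rho> \<Longrightarrow> eqv \<rho> r s \<Longrightarrow> eqv \<rho> s r"
proof (induction \<rho> arbitrary: r s)
  case T0
  then show ?case unfolding eqv.simps by (intro eqv_T0(2)[of r s s])
next
  case (Fun \<rho> \<tau>)
  then show ?case by (simp add: App_closed[OF Fun.prems(1)] App_closed[OF Fun.prems(2)])
qed

lemma eqv_trans:
  "r \<in> closed_terms \<rho> \<Longrightarrow> s \<in> closed_terms \<rho> \<Longrightarrow> t \<in> closed_terms \<rho> \<Longrightarrow>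
   eqv \<rho> r s \<Longrightarrow> eqv \<rho> s t \<Longrightarrow> eqv \<rho> r t"
proof (induction \<rho> arbitrary: r s t)
  case T0
  then show ?case unfolding eqv.simps by (intro eqv_T0(3)[of r s t])
next
  case (Fun \<rho> \<tau>)
  have "eqv \<tau> (App r u) (App t u)" if u: "u \<in> closed_terms \<rho>" for u
    using Fun.IH(2)[OF App_closed[OF Fun.prems(1) u] App_closed[OF Fun.prems(2) u] App_closed[OF Fun.prems(3) u]]
      Fun.prems(4,5) u by simp
  then show ?case by simp
qed

section \<open>The quotient term model\<close>

definition cls :: "trm \<Rightarrow> trm set" where
  "cls t = {s \<in> closed_terms (the (tyof t)). eqv (the (tyof t)) t s}"

text \<open>Representatives are chosen arbitrarily; congruence of \<open>eqv\<close> makes the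
  choice harmless.\<close>

definition cls_ap :: "trm set \<Rightarrow> trm set \<Rightarrow> trm set" where
  "cls_ap U W = cls (App (SOME s. s \<in> U) (SOME t. t \<in> W))"

definition cls_lt :: "trm set \<Rightarrow> trm set \<Rightarrow> bool" where
  "cls_lt U W \<longleftrightarrow> (\<exists>s\<in>U. \<exists>t\<in>W. Less s t \<in> H)"

lemma tyof_closed: "t \<in> closed_terms \<rho> \<Longrightarrow> tyof t = Some \<rho>"
  by (simp add: closed_terms_def)

lemma cls_iff: "t \<in> closed_terms \<rho> \<Longrightarrow> s \<in> cls t \<longleftrightarrow> s \<in> closed_terms \<rho> \<and> eqv \<rho> t s"
  by (simp add: cls_def tyof_closed)

lemma cls_eq_iff:
  assumes "s \<in> closed_terms \<rho>" "t \<in> closed_terms \<rho>"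
  shows "cls s = cls t \<longleftrightarrow> eqv \<rho> s t"
proof
  assume "cls s = cls t"
  then show "eqv \<rho> s t" using cls_iff[OF assms(1), of t] cls_iff[OF assms(2), of t] eqv_refl assms by simp
next
  assume st: "eqv \<rho> s t"
  have "r \<in> cls s \<longleftrightarrow> r \<in> cls t" for r
    using cls_iff[OF assms(1), of r] cls_iff[OF assms(2), of r] eqv_sym[OF assms st]
      eqv_trans[OF assms(1,2) _ st, of r] eqv_trans[OF assms(2,1), of r] by blast
  then show "cls s = cls t" by blast
qed

lemma some_in_cls:
  assumes "t \<in> closed_terms \<rho>"
  shows "(SOME s. s \<in> cls t) \<in> closed_terms \<rho> \<and> eqv \<rho> t (SOME s. s \<in> cls t)"
proof -
  have "t \<in> cls t" using assms by (simp add: cls_iff eqv_refl)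
  then have "(SOME s. s \<in> cls t) \<in> cls t" by (rule someI)
  then show ?thesis using assms by (simp add: cls_iff)
qed

lemma eqv_App:
  assumes "s \<in> closed_terms (\<rho> \<rightarrow> \<tau>)" "s' \<in> closed_terms (\<rho> \<rightarrow> \<tau>)" "t \<in> closed_terms \<rho>" "t' \<in> closed_terms \<rho>"
    and "eqv (\<rho> \<rightarrow> \<tau>) s s'" "eqv \<rho> t t'"
  shows "eqv \<tau> (App s t) (App s' t')"
proof (rule eqv_trans)
  show "eqv \<tau> (App s t) (App s' t)" using assms by simp
  show "eqv \<tau> (App s' t) (App s' t')" using assms by (intro eqv_cong)
qed (rule App_closed[OF assms(1,3)] App_closed[OF assms(2,3)] App_closed[OF assms(2,4)])+

lemma cls_ap:
  assumes "s \<in> closed_terms (\<rho> \<rightarrow> \<tau>)" "t \<in> closed_terms \<rho>"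
  shows "cls_ap (cls s) (cls t) = cls (App s t)"
proof -
  let ?s = "SOME r. r \<in> cls s" and ?t = "SOME r. r \<in> cls t"
  have st: "?s \<in> closed_terms (\<rho> \<rightarrow> \<tau>)" "?t \<in> closed_terms \<rho>" "eqv (\<rho> \<rightarrow> \<tau>) ?s s" "eqv \<rho> ?t t"
    using some_in_cls[OF assms(1)] some_in_cls[OF assms(2)]
      eqv_sym[OF assms(1)] eqv_sym[OF assms(2)] by blast+
  have "eqv \<tau> (App ?s ?t) (App s t)" by (rule eqv_App[OF st(1) assms(1) st(2) assms(2) st(3,4)])
  then show ?thesis unfolding cls_ap_def
    using cls_eq_iff[OF App_closed[OF st(1,2)] App_closed[OF assms]] by simp
qed

lemma cls_lt:
  assumes "s \<in> closed_terms T0" "t \<in> closed_terms T0"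
  shows "cls_lt (cls s) (cls t) \<longleftrightarrow> Less s t \<in> H"
proof
  assume "cls_lt (cls s) (cls t)"
  then obtain s' t' where "s' \<in> cls s" "t' \<in> cls t" and l: "Less s' t' \<in> H"
    by (auto simp: cls_lt_def)
  then have c: "s' \<in> closed_terms T0" "t' \<in> closed_terms T0" "Eq s s' \<in> H" "Eq t t' \<in> H"
    using assms cls_iff by auto
  then have "Eq s' s \<in> H" "Eq t' t \<in> H" using eqv_T0(2)[OF assms(1) c(1) c(1)] eqv_T0(2)[OF assms(2) c(2) c(2)] c by blast+
  then show "Less s t \<in> H" using Less_cong[OF c(1,2) assms _ _ l] by blast
next
  assume "Less s t \<in> H"
  moreover have "s \<in> cls s" "t \<in> cls t" using assms by (simp_all add: cls_iff eqv_refl del: eqv.simps)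
  ultimately show "cls_lt (cls s) (cls t)" by (auto simp: cls_lt_def)
qed

sublocale term_model: type_structure "\<lambda>\<rho>. cls ` closed_terms \<rho>" cls_ap cls cls_lt
proof
  fix f x \<rho> \<tau>
  assume "f \<in> cls ` closed_terms (\<rho> \<rightarrow> \<tau>)" "x \<in> cls ` closed_terms \<rho>"
  then obtain s t where "s \<in> closed_terms (\<rho> \<rightarrow> \<tau>)" "f = cls s" "t \<in> closed_terms \<rho>" "x = cls t"
    by blast
  then show "cls_ap f x \<in> cls ` closed_terms \<tau>" by (simp add: cls_ap App_closed)
next
  fix f g \<rho> \<tau>
  assume "f \<in> cls ` closed_terms (\<rho> \<rightarrow> \<tau>)" "g \<in> cls ` closed_terms (\<rho> \<rightarrow> \<tau>)"
    and eq: "\<And>x. x \<in> cls ` closed_terms \<rho> \<Longrightarrow> cls_ap f x = cls_ap g x"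
  then obtain s t where st: "s \<in> closed_terms (\<rho> \<rightarrow> \<tau>)" "f = cls s" "t \<in> closed_terms (\<rho> \<rightarrow> \<tau>)" "g = cls t"
    by blast
  have "eqv \<tau> (App s r) (App t r)" if r: "r \<in> closed_terms \<rho>" for r
  proof -
    have "cls (App s r) = cls (App t r)" using eq[of "cls r"] cls_ap[OF st(1) r] cls_ap[OF st(3) r] st r by simp
    then show ?thesis using cls_eq_iff[OF App_closed[OF st(1) r] App_closed[OF st(3) r]] by simp
  qed
  \<comment> \<open>At function types \<open>eqv\<close> is defined through applications to closed
    terms, so agreement on all arguments already is equality of classes.\<close>
  then show "f = g" using st cls_eq_iff[OF st(1,3)] by simp
qed (rule imageI)

lemma term_model_ev:
  assumes e: "\<And>x \<rho>. e (x, \<rho>) \<in> closed_terms \<rho>"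
  shows "tyof t = Some \<tau> \<Longrightarrow>
    msub e t \<in> closed_terms \<tau> \<and> term_model.ev (\<lambda>p. cls (e p)) t = cls (msub e t)"
proof (induction t arbitrary: \<tau>)
  case (App s t)
  then obtain \<rho> where "tyof s = Some (\<rho> \<rightarrow> \<tau>)" "tyof t = Some \<rho>" by (elim tyof_AppE)
  then show ?case using App.IH(1)[of "\<rho> \<rightarrow> \<tau>"] App.IH(2)[of \<rho>] App_closed cls_ap by auto
qed (use e in \<open>auto simp: closed_terms_def\<close>)

text \<open>The truth lemma: each clause of \<open>sat\<close> meets the matching closure property
  of \<open>H\<close>. In the quantifier case the elements are classes of closed terms, exactly the
  instances in \<open>H_Forall\<close>.\<close>

lemma term_model_sat:
  "\<forall>x \<rho>. e (x, \<rho>) \<in> closed_terms \<rho> \<Longrightarrow> wff \<phi> \<Longrightarrow>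
   term_model.sat (\<lambda>p. cls (e p)) \<phi> \<longleftrightarrow> fsub e \<phi> \<in> H"
proof (induction \<phi> arbitrary: e)
  case Fls
  then show ?case using H_Fls by simp
next
  case (Eq s t)
  then show ?case
    using term_model_ev[of e s T0] term_model_ev[of e t T0] cls_eq_iff[of "msub e s" T0 "msub e t"] by simp
next
  case (Less s t)
  then show ?case
    using term_model_ev[of e s T0] term_model_ev[of e t T0] cls_lt[of "msub e s" "msub e t"] by simp
next
  case (Imp \<phi> \<psi>)
  have c: "\<forall>x \<rho>. tyof (e (x, \<rho>)) = Some \<rho>" "\<forall>p. vars (e p) = {}"
    using Imp.prems(1) by (auto simp: closed_terms_def)
  have "sentence (fsub e \<phi>)" "sentence (fsub e \<psi>)"
    using wff_fsub[OF c(1)] fv_fsub[of e] c(2) Imp.prems(2) by (auto simp: sentence_def)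
  then show ?case using Imp H_Imp by simp
next
  case (Forall x \<rho> \<phi>)
  have c: "\<forall>x \<rho>. tyof (e (x, \<rho>)) = Some \<rho>" "\<forall>p. vars (e p) = {}"
    using Forall.prems(1) by (auto simp: closed_terms_def)
  have "sentence (fsub e (Forall x \<rho> \<phi>))"
    using wff_fsub[OF c(1), of "Forall x \<rho> \<phi>"] fv_fsub[of e "Forall x \<rho> \<phi>"] c(2) Forall.prems(2)
    by (auto simp: sentence_def simp del: fsub.simps fv.simps)
  then have "fsub e (Forall x \<rho> \<phi>) \<in> H \<longleftrightarrow>
      (\<forall>t\<in>closed_terms \<rho>. subst x \<rho> t (fsub (e((x, \<rho>) := Var x \<rho>)) \<phi>) \<in> H)"
    by (simp add: H_Forall)
  also have "\<dots> \<longleftrightarrow> (\<forall>t\<in>closed_terms \<rho>. fsub (e((x, \<rho>) := t)) \<phi> \<in> H)"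
    using c by (subst subst_fsub) auto
  also have "\<dots> \<longleftrightarrow> (\<forall>t\<in>closed_terms \<rho>. term_model.sat (\<lambda>p. cls ((e((x, \<rho>) := t)) p)) \<phi>)"
    using Forall.prems by (intro ball_cong refl Forall.IH[symmetric]) auto
  also have "\<dots> \<longleftrightarrow> (\<forall>t\<in>closed_terms \<rho>. term_model.sat ((\<lambda>p. cls (e p))((x, \<rho>) := cls t)) \<phi>)"
    by (simp add: fun_upd_def if_distrib)
  finally show ?case by auto
qed

text \<open>A sentence does not look at the environment, so it may be evaluated where every variable
  denotes the class of a parameter.\<close>

lemma term_model_sentence:
  assumes "sentence \<phi>" "term_model.valid e"
  shows "term_model.sat e \<phi> \<longleftrightarrow> \<phi> \<in> H"
proof -
  let ?c = "\<lambda>(x, \<rho>). Par 0 \<rho>"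
  have "term_model.sat e \<phi> \<longleftrightarrow> term_model.sat (\<lambda>p. cls (?c p)) \<phi>"
    using assms by (intro term_model.sat_cong) (simp add: sentence_def)
  also have "\<dots> \<longleftrightarrow> fsub ?c \<phi> \<in> H"
    using assms Par_closed by (intro term_model_sat) (auto simp: sentence_def)
  also have "fsub ?c \<phi> = \<phi>" using assms by (intro fsub_idle) (simp add: sentence_def)
  finally show ?thesis .
qed

end

definition models :: "(ty \<Rightarrow> 'v set) \<Rightarrow> ('v \<Rightarrow> 'v \<Rightarrow> 'v) \<Rightarrow> (trm \<Rightarrow> 'v) \<Rightarrow> ('v \<Rightarrow> 'v \<Rightarrow> bool) \<Rightarrow> fm \<Rightarrow> bool" where
  "models D ap I lt \<phi> \<longleftrightarrow>
     (\<forall>e. type_structure.valid D e \<longrightarrow> type_structure.sat D ap I lt e \<phi>)"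

text \<open>The model is the term model of the theory with \<open>Neg \<phi>\<close> added. Its
  elements have the fixed HOL type \<open>trm set\<close>, which later permits a choice among all
  countermodels at once.\<close>

theorem countermodel:
  assumes fresh: "many_fresh \<Gamma>"
    and axioms: "at_depth_0 ` (equality_axioms \<union> extensionality_axioms) \<subseteq> \<Gamma>"
    and goal: "sentence \<phi>" "\<not> \<Gamma> \<turnstile> \<phi>"
  obtains D :: "ty \<Rightarrow> trm set set" and ap I lt where
    "type_structure D ap I" "\<And>\<psi>. \<psi> \<in> \<Gamma> \<Longrightarrow> sentence \<psi> \<Longrightarrow> models D ap I lt \<psi>"
    "\<not> models D ap I lt \<phi>"
proof -
  have neg: "sentence (Neg \<phi>)" using goal(1) by (simp add: sentence_def)
  have con: "consistent (insert (Neg \<phi>) \<Gamma>)"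
  proof (rule ccontr)
    assume "\<not> consistent (insert (Neg \<phi>) \<Gamma>)"
    with neg have "\<Gamma> \<turnstile> Neg (Neg \<phi>)" by (rule refutes_inconsistent)
    with goal(2) show False by (auto dest: derives.DNE)
  qed
  interpret henkin_equality "insert (Neg \<phi>) \<Gamma>"
  proof
    show "many_fresh (insert (Neg \<phi>) \<Gamma>)" using fresh by (rule many_fresh_insert)
    show "at_depth_0 ` (equality_axioms \<union> extensionality_axioms) \<subseteq> insert (Neg \<phi>) \<Gamma>"
      using axioms by (rule subset_insertI2)
  qed (rule con)
  have m: "models (\<lambda>\<rho>. cls ` closed_terms \<rho>) cls_ap cls cls_lt \<psi> \<longleftrightarrow> \<psi> \<in> H" if "sentence \<psi>" for \<psi>
    using term_model_sentence[OF that] term_model.ex_valid unfolding models_def by blast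
  have "Neg \<phi> \<in> H" using axioms_H by simp
  moreover have "sentence Fls" by (simp add: sentence_def)
  ultimately have "\<phi> \<notin> H" using H_Imp[OF goal(1)] H_Fls by simp
  then have "\<not> models (\<lambda>\<rho>. cls ` closed_terms \<rho>) cls_ap cls cls_lt \<phi>"
    using m[OF goal(1)] by simp
  moreover have "models (\<lambda>\<rho>. cls ` closed_terms \<rho>) cls_ap cls cls_lt \<psi>"
    if "\<psi> \<in> \<Gamma>" "sentence \<psi>" for \<psi>
    using m[OF that(2)] that(1) axioms_H by auto
  ultimately show thesis by (intro that[OF term_model.type_structure_axioms])
qed

section \<open>Evaluation of the notation for terms and formulas\<close>

text \<open>
  A world \<open>(V, e)\<close> consists of the free variables that may occur and their values.  \<open>T V e s \<tau> u\<close>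
  and \<open>F V e \<phi> P\<close> say that the term \<open>s\<close> of type \<open>\<tau>\<close> has value \<open>u\<close> and that the formula \<open>\<phi>\<close>
  expresses \<open>P\<close>, at every binder depth that is fresh for \<open>V\<close>.
\<close>

context type_structure
begin

definition fresh :: "(nat \<times> ty) set \<Rightarrow> nat \<Rightarrow> bool" where
  "fresh V d \<longleftrightarrow> (\<forall>(x, \<sigma>)\<in>V. x < d)"

definition world :: "(nat \<times> ty) set \<Rightarrow> 'v env \<Rightarrow> bool" where
  "world V e \<longleftrightarrow> finite V \<and> valid e"

definition extends :: "(nat \<times> ty) set \<Rightarrow> 'v env \<Rightarrow> (nat \<times> ty) set \<Rightarrow> 'v env \<Rightarrow> bool" where
  "extends V e V' e' \<longleftrightarrow> V \<subseteq> V' \<and> (\<forall>p\<in>V. e p = e' p) \<and> world V' e'"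

definition T :: "(nat \<times> ty) set \<Rightarrow> 'v env \<Rightarrow> tm \<Rightarrow> ty \<Rightarrow> 'v \<Rightarrow> bool" where
  "T V e s \<tau> u \<longleftrightarrow>
     (\<forall>d. fresh V d \<longrightarrow> tyof (s d) = Some \<tau> \<and> vars (s d) \<subseteq> V \<and> ev e (s d) = u)"

definition F :: "(nat \<times> ty) set \<Rightarrow> 'v env \<Rightarrow> form \<Rightarrow> bool \<Rightarrow> bool" where
  "F V e \<phi> P \<longleftrightarrow>
     (\<forall>d. fresh V d \<longrightarrow> wff (\<phi> d) \<and> fv (\<phi> d) \<subseteq> V \<and> sat e (\<phi> d) = P)"

lemma fresh_exists: "finite V \<Longrightarrow> \<exists>d. fresh V d"
proof -
  assume "finite V"
  then have "finite (fst ` V)" by simp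
  then obtain d where "\<forall>x\<in>fst ` V. x < d" using finite_nat_set_iff_bounded by blast
  then show ?thesis by (auto simp: fresh_def case_prod_beta)
qed

lemma extends_world: "extends V e V' e' \<Longrightarrow> world V' e'"
  by (simp add: extends_def)

lemma extends_trans: "extends V e V' e' \<Longrightarrow> extends V' e' V'' e'' \<Longrightarrow> extends V e V'' e''"
  by (auto simp: extends_def)

lemma T_mono:
  assumes "T V e s \<tau> u" "extends V e V' e'"
  shows "T V' e' s \<tau> u"
  unfolding T_def
proof (intro allI impI)
  fix d assume "fresh V' d"
  then have "fresh V d" using assms(2) by (auto simp: fresh_def extends_def)
  then have s: "tyof (s d) = Some \<tau>" "vars (s d) \<subseteq> V" "ev e (s d) = u"
    using assms(1) by (auto simp: T_def)
  moreover have "ev e (s d) = ev e' (s d)"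
    using s(2) assms(2) by (intro ev_cong) (auto simp: extends_def)
  ultimately show "tyof (s d) = Some \<tau> \<and> vars (s d) \<subseteq> V' \<and> ev e' (s d) = u"
    using assms(2) by (auto simp: extends_def)
qed

lemma T_mono2:
  "T V e s \<tau> u \<Longrightarrow> extends V e V' e' \<Longrightarrow> extends V' e' V'' e'' \<Longrightarrow> T V'' e'' s \<tau> u"
  by (blast intro: T_mono extends_trans)

lemma T_D: "world V e \<Longrightarrow> T V e s \<tau> u \<Longrightarrow> u \<in> D \<tau>"
  using fresh_exists[of V] ev_D[of e _ \<tau>] unfolding world_def T_def by blast

lemma T_cst: "t \<in> closed_terms \<tau> \<Longrightarrow> ev e t = u \<Longrightarrow> T V e (cst t) \<tau> u"
  by (simp add: T_def cst_def closed_terms_def)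

lemma T_const:
  "T V e (cst Zero) T0 (I Zero)" "T V e (cst One) T0 (I One)"
  "T V e (cst Plus) (T0 \<rightarrow> T0 \<rightarrow> T0) (I Plus)" "T V e (cst Times) (T0 \<rightarrow> T0 \<rightarrow> T0) (I Times)"
  "T V e (cst (Kc \<rho> \<tau>)) (\<rho> \<rightarrow> \<tau> \<rightarrow> \<rho>) (I (Kc \<rho> \<tau>))"
  "T V e (cst (Sc \<rho> \<sigma> \<tau>)) ((\<rho> \<rightarrow> \<sigma> \<rightarrow> \<tau>) \<rightarrow> (\<rho> \<rightarrow> \<sigma>) \<rightarrow> \<rho> \<rightarrow> \<tau>) (I (Sc \<rho> \<sigma> \<tau>))"
  "T V e (cst Rc) ((T0 \<rightarrow> T0 \<rightarrow> T0) \<rightarrow> T0 \<rightarrow> T0 \<rightarrow> T0) (I Rc)"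
  by (simp_all add: T_def cst_def)

lemma T_app: "T V e s (\<rho> \<rightarrow> \<tau>) u \<Longrightarrow> T V e t \<rho> v \<Longrightarrow> T V e (s \<cdot> t) \<tau> (ap u v)"
  by (simp add: T_def app_def)

text \<open>Definitions such as \<open>pair\<close> freeze a closed term by reading it at depth 0;
  its value is carried over to every world.\<close>

lemma T_closed:
  assumes "T {} e s \<tau> u"
  shows "T V e' (cst (s 0)) \<tau> u"
proof -
  have s: "tyof (s 0) = Some \<tau>" "vars (s 0) = {}" "ev e (s 0) = u"
    using assms by (auto simp: T_def fresh_def)
  then have "ev e' (s 0) = u" using ev_cong[of "s 0" e e'] by simp
  then show ?thesis using s by (intro T_cst) (auto simp: closed_terms_def)
qed

lemma F_fls: "F V e fls_fm False"
  by (simp add: F_def fls_fm_def)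

lemma F_eq: "T V e s T0 u \<Longrightarrow> T V e t T0 v \<Longrightarrow> F V e (s \<^bold>= t) (u = v)"
  by (simp add: F_def T_def eq_fm_def)

lemma F_less: "T V e s T0 u \<Longrightarrow> T V e t T0 v \<Longrightarrow> F V e (s \<^bold>< t) (lt u v)"
  by (simp add: F_def T_def less_fm_def)

lemma F_imp: "F V e \<phi> P \<Longrightarrow> F V e \<psi> Q \<Longrightarrow> F V e (\<phi> \<^bold>\<longrightarrow> \<psi>) (P \<longrightarrow> Q)"
  by (simp add: F_def imp_fm_def)

lemma F_neg: "F V e \<phi> P \<Longrightarrow> F V e (\<^bold>\<not> \<phi>) (\<not> P)"
  using F_imp[OF _ F_fls] by (simp add: neg_fm_def)

lemma F_conj: "F V e \<phi> P \<Longrightarrow> F V e \<psi> Q \<Longrightarrow> F V e (\<phi> \<^bold>\<and> \<psi>) (P \<and> Q)"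
  using F_neg[OF F_imp[OF _ F_neg], of V e \<phi> P \<psi> Q] by (simp add: conj_fm_def)

lemma F_disj: "F V e \<phi> P \<Longrightarrow> F V e \<psi> Q \<Longrightarrow> F V e (\<phi> \<^bold>\<or> \<psi>) (P \<or> Q)"
  using F_imp[OF F_neg, of V e \<phi> P \<psi> Q] by (simp add: disj_fm_def disj_imp)

lemma F_iff: "F V e \<phi> P \<Longrightarrow> F V e \<psi> Q \<Longrightarrow> F V e (\<phi> \<^bold>\<longleftrightarrow> \<psi>) (P \<longleftrightarrow> Q)"
  using F_conj[OF F_imp F_imp, of V e \<phi> P \<psi> Q \<psi> Q \<phi> P] by (simp add: iff_fm_def iff_conv_conj_imp)

lemma extends_variable:
  assumes "world V e" "fresh V d" "v \<in> D \<rho>"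
  defines "V' \<equiv> insert (d, \<rho>) V" and "e' \<equiv> e((d, \<rho>) := v)"
  shows "extends V e V' e'" "T V' e' (cst (Var d \<rho>)) \<rho> v" "fresh V' (Suc d)"
  using assms by (auto simp: extends_def world_def valid_upd T_def cst_def fresh_def less_Suc_eq)

text \<open>The body is evaluated in an arbitrary extension, for an abstract term \<open>x\<close>
  with value \<open>v\<close>. Evaluations can therefore follow the syntax of a formula without
  mentioning variable names or depths.\<close>

lemma F_all:
  assumes "world V e"
    and body: "\<And>x v V' e'. v \<in> D \<rho> \<Longrightarrow> extends V e V' e' \<Longrightarrow> T V' e' x \<rho> v \<Longrightarrow> F V' e' (\<phi> x) (P v)"
  shows "F V e (all_fm \<rho> \<phi>) (\<forall>v\<in>D \<rho>. P v)"
  unfolding F_def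
proof (intro allI impI)
  fix d assume d: "fresh V d"
  let ?b = "\<phi> (cst (Var d \<rho>)) (Suc d)"
  have b: "wff ?b \<and> fv ?b \<subseteq> insert (d, \<rho>) V \<and> sat (e((d, \<rho>) := v)) ?b = P v" if "v \<in> D \<rho>" for v
    using body[OF that extends_variable(1,2)[OF assms(1) d that]] extends_variable(3)[OF assms(1) d that]
    unfolding F_def by blast
  \<comment> \<open>Well-formedness of the body is known only together with a value for the
    variable, so some value must exist.\<close>
  have "D \<rho> \<noteq> {}" using I_D[OF Par_closed] by blast
  then have "wff ?b" "fv ?b \<subseteq> insert (d, \<rho>) V" using b by blast+
  then show "wff (all_fm \<rho> \<phi> d) \<and> fv (all_fm \<rho> \<phi> d) \<subseteq> V \<and> sat e (all_fm \<rho> \<phi> d) = (\<forall>v\<in>D \<rho>. P v)"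
    using b by (auto simp: all_fm_def)
qed

lemma F_ex:
  assumes "world V e"
    and "\<And>x v V' e'. v \<in> D \<rho> \<Longrightarrow> extends V e V' e' \<Longrightarrow> T V' e' x \<rho> v \<Longrightarrow> F V' e' (\<phi> x) (P v)"
  shows "F V e (ex_fm \<rho> \<phi>) (\<exists>v\<in>D \<rho>. P v)"
  using F_neg[OF F_all[OF assms(1) F_neg[OF assms(2)]]] by (simp add: ex_fm_def)

text \<open>Extensionality of the structure collapses equality at all arguments to identity, type by
  type.\<close>

lemma F_eqT:
  "world V e \<Longrightarrow> T V e s \<tau> u \<Longrightarrow> T V e t \<tau> v \<Longrightarrow> F V e (eqT \<tau> s t) (u = v)"
proof (induction \<tau> arbitrary: V e s t u v)
  case T0
  then show ?case by (simp add: F_eq)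
next
  case (Fun \<rho> \<tau>)
  have "F V e (eqT (\<rho> \<rightarrow> \<tau>) s t) (\<forall>w\<in>D \<rho>. ap u w = ap v w)"
    unfolding eqT.simps
  proof (rule F_all[OF Fun.prems(1)])
    fix x w V' e' assume w: "extends V e V' e'" "T V' e' x \<rho> w"
    show "F V' e' (eqT \<tau> (s \<cdot> x) (t \<cdot> x)) (ap u w = ap v w)"
      using Fun.prems w by (intro Fun.IH(2) T_app) (auto intro: T_mono extends_world)
  qed
  moreover have "(\<forall>w\<in>D \<rho>. ap u w = ap v w) \<longleftrightarrow> u = v"
    using extensional T_D[OF Fun.prems(1)] Fun.prems(2,3) by blast
  ultimately show ?case by simp
qed

lemma F_closed:
  assumes "\<And>e. world {} e \<Longrightarrow> F {} e \<phi> P"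
  shows "sentence (\<phi> 0) \<and> (\<forall>e. valid e \<longrightarrow> sat e (\<phi> 0) = P)"
  using assms ex_valid by (auto simp: F_def world_def fresh_def sentence_def)

end

section \<open>Bracket abstraction and combinatory completeness\<close>

lemma bracket_syntax:
  "tyof t = Some \<tau> \<Longrightarrow>
   tyof (bracket x \<rho> t) = Some (\<rho> \<rightarrow> \<tau>) \<and> vars (bracket x \<rho> t) = vars t - {(x, \<rho>)}"
proof (induction t arbitrary: \<tau>)
  case (App s t)
  obtain \<sigma> where st: "tyof s = Some (\<sigma> \<rightarrow> \<tau>)" "tyof t = Some \<sigma>"
    using App.prems by (elim tyof_AppE)
  show ?case using App.IH(1)[OF st(1)] App.IH(2)[OF st(2)] st by auto
qed auto

locale combinatory_structure = type_structure D ap I lt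
  for D :: "ty \<Rightarrow> 'v set" and ap I lt +
  assumes K: "x \<in> D \<rho> \<Longrightarrow> y \<in> D \<tau> \<Longrightarrow> ap (ap (I (Kc \<rho> \<tau>)) x) y = x"
    and S: "x \<in> D (\<rho> \<rightarrow> \<sigma> \<rightarrow> \<tau>) \<Longrightarrow> y \<in> D (\<rho> \<rightarrow> \<sigma>) \<Longrightarrow> z \<in> D \<rho> \<Longrightarrow>
      ap (ap (ap (I (Sc \<rho> \<sigma> \<tau>)) x) y) z = ap (ap x z) (ap y z)"
begin

lemma K_D: "I (Kc \<rho> \<tau>) \<in> D (\<rho> \<rightarrow> \<tau> \<rightarrow> \<rho>)"
  by (intro I_D) (simp add: closed_terms_def)

lemma S_D: "I (Sc \<rho> \<sigma> \<tau>) \<in> D ((\<rho> \<rightarrow> \<sigma> \<rightarrow> \<tau>) \<rightarrow> (\<rho> \<rightarrow> \<sigma>) \<rightarrow> \<rho> \<rightarrow> \<tau>)"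
  by (intro I_D) (simp add: closed_terms_def)

lemma SKK: "v \<in> D \<rho> \<Longrightarrow> ap (ap (ap (I (Sc \<rho> (\<rho> \<rightarrow> \<rho>) \<rho>)) (I (Kc \<rho> (\<rho> \<rightarrow> \<rho>)))) (I (Kc \<rho> \<rho>))) v = v"
  using S[OF K_D K_D, of v \<rho> \<rho>] K[OF _ ap_D[OF K_D], of v \<rho> v \<rho> \<rho>]
  by simp

lemma bracket:
  assumes "valid e"
  shows "tyof t = Some \<tau> \<Longrightarrow> v \<in> D \<rho> \<Longrightarrow> ap (ev e (bracket x \<rho> t)) v = ev (e((x, \<rho>) := v)) t"
proof (induction t arbitrary: \<tau>)
  case (App s t)
  obtain \<sigma> where st: "tyof s = Some (\<sigma> \<rightarrow> \<tau>)" "tyof t = Some \<sigma>"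
    using App.prems(1) by (elim tyof_AppE)
  show ?case
  proof (cases "(x, \<rho>) \<in> vars (App s t)")
    case True
    have "ev e (bracket x \<rho> s) \<in> D (\<rho> \<rightarrow> \<sigma> \<rightarrow> \<tau>)" "ev e (bracket x \<rho> t) \<in> D (\<rho> \<rightarrow> \<sigma>)"
      using bracket_syntax[OF st(1)] bracket_syntax[OF st(2)] ev_D[OF assms] by blast+
    then show ?thesis using True App.IH(1)[OF st(1) App.prems(2)] App.IH(2)[OF st(2) App.prems(2)] App.prems(2) st
      by (auto simp: S)
  next
    case False
    then have "ev (e((x, \<rho>) := v)) (App s t) = ev e (App s t)" by (intro ev_cong) auto
    then show ?thesis
      using False App.prems ev_D[OF assms App.prems(1)] by (simp add: K del: fun_upd_apply)
  qed
qed (use assms in \<open>auto simp: K SKK valid_def I_D closed_terms_def\<close>)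

lemma T_lam:
  assumes "world V e"
    and body: "\<And>x v V' e'. v \<in> D \<rho> \<Longrightarrow> extends V e V' e' \<Longrightarrow> T V' e' x \<rho> v \<Longrightarrow> T V' e' (t x) \<tau> (h v)"
  shows "\<exists>u\<in>D (\<rho> \<rightarrow> \<tau>). (\<forall>v\<in>D \<rho>. ap u v = h v) \<and> T V e (lam \<rho> t) (\<rho> \<rightarrow> \<tau>) u"
proof -
  have e: "valid e" using assms(1) by (simp add: world_def)
  have ne: "D \<rho> \<noteq> {}" using I_D[OF Par_closed] by blast
  have lam: "tyof (lam \<rho> t d) = Some (\<rho> \<rightarrow> \<tau>) \<and> vars (lam \<rho> t d) \<subseteq> V \<and>
      (\<forall>v\<in>D \<rho>. ap (ev e (lam \<rho> t d)) v = h v)" if d: "fresh V d" for d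
  proof -
    let ?b = "t (cst (Var d \<rho>)) (Suc d)"
    have b: "tyof ?b = Some \<tau> \<and> vars ?b \<subseteq> insert (d, \<rho>) V \<and> ev (e((d, \<rho>) := v)) ?b = h v"
      if "v \<in> D \<rho>" for v
      using body[OF that extends_variable(1,2)[OF assms(1) d that]] extends_variable(3)[OF assms(1) d that]
      unfolding T_def by blast
    then have ty: "tyof ?b = Some \<tau>" and vars: "vars ?b \<subseteq> insert (d, \<rho>) V" using ne by blast+
    from vars bracket_syntax[OF ty, of d \<rho>] bracket[OF e ty, of _ \<rho> d] b show ?thesis
      by (auto simp: lam_def simp del: fun_upd_apply)
  qed
  obtain d where d: "fresh V d" using fresh_exists assms(1) by (auto simp: world_def)
  let ?u = "ev e (lam \<rho> t d)"
  have lam_D: "ev e (lam \<rho> t d) \<in> D (\<rho> \<rightarrow> \<tau>)" if "fresh V d" for d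
    by (rule ev_D[OF e conjunct1[OF lam[OF that]]])
  note u = lam_D[OF d]
  \<comment> \<open>The abstracted term varies with the depth, but its values at two depths agree on
    all arguments and hence coincide.\<close>
  have "ev e (lam \<rho> t d') = ?u" if "fresh V d'" for d'
  proof (rule extensional[OF _ u])
    show "ev e (lam \<rho> t d') \<in> D (\<rho> \<rightarrow> \<tau>)" using that by (rule lam_D)
    show "ap (ev e (lam \<rho> t d')) v = ap ?u v" if v: "v \<in> D \<rho>" for v
      using lam[OF d] lam[OF \<open>fresh V d'\<close>] v by simp
  qed
  then have "T V e (lam \<rho> t) (\<rho> \<rightarrow> \<tau>) ?u" using lam unfolding T_def by simp
  with u lam[OF d] show ?thesis by (intro bexI[of _ ?u] conjI) simp_all
qed

text \<open>Singles out the functions of the metalogic that exist as objects of the model; the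
  combinators provide constants, identity and pointwise application.\<close>

definition rep :: "ty \<Rightarrow> ty \<Rightarrow> ('v \<Rightarrow> 'v) \<Rightarrow> bool" where
  "rep \<rho> \<tau> h \<longleftrightarrow> (\<exists>u\<in>D (\<rho> \<rightarrow> \<tau>). \<forall>v\<in>D \<rho>. ap u v = h v)"

lemma rep_const: "c \<in> D \<tau> \<Longrightarrow> rep \<rho> \<tau> (\<lambda>v. c)"
  unfolding rep_def by (rule bexI[OF _ ap_D[OF K_D]]) (simp_all add: K)

lemma rep_id: "rep \<rho> \<rho> (\<lambda>v. v)"
proof -
  let ?k = "I (Kc \<rho> \<rho>)" and ?k' = "I (Kc \<rho> (\<rho> \<rightarrow> \<rho>))"
  let ?u = "ap (ap (I (Sc \<rho> (\<rho> \<rightarrow> \<rho>) \<rho>)) ?k') ?k"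
  have "?u \<in> D (\<rho> \<rightarrow> \<rho>)" by (rule ap_D[OF ap_D[OF S_D K_D] K_D])
  moreover have "ap ?u v = v" if "v \<in> D \<rho>" for v
    using that by (rule SKK)
  ultimately show ?thesis by (auto simp: rep_def)
qed

lemma rep_app:
  assumes "rep \<rho> (\<sigma> \<rightarrow> \<tau>) f" "rep \<rho> \<sigma> g"
  shows "rep \<rho> \<tau> (\<lambda>v. ap (f v) (g v))"
proof -
  obtain u w where u: "u \<in> D (\<rho> \<rightarrow> \<sigma> \<rightarrow> \<tau>)" "\<forall>v\<in>D \<rho>. ap u v = f v"
    and w: "w \<in> D (\<rho> \<rightarrow> \<sigma>)" "\<forall>v\<in>D \<rho>. ap w v = g v"
    using assms by (auto simp: rep_def)
  have "ap (ap (I (Sc \<rho> \<sigma> \<tau>)) u) w \<in> D (\<rho> \<rightarrow> \<tau>)" by (rule ap_D[OF ap_D[OF S_D u(1)] w(1)])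
  then show ?thesis
    unfolding rep_def by (rule bexI[rotated]) (simp add: S[OF u(1) w(1)] u(2) w(2))
qed

end

section \<open>Arithmetic in models of the axioms\<close>

lemma wff_generalize: "wff (generalize vs \<phi>) = wff \<phi>"
  by (induction vs) (simp_all add: generalize_def case_prod_beta)

lemma fv_generalize: "fv (generalize vs \<phi>) = fv \<phi> - set vs"
  by (induction vs) (auto simp: generalize_def case_prod_beta)

lemma fv_subst_subset: "fv (subst x \<rho> u \<phi>) \<subseteq> (fv \<phi> - {(x, \<rho>)}) \<union> vars u"
proof -
  have "vars (tsubst x \<rho> u t) \<subseteq> (vars t - {(x, \<rho>)}) \<union> vars u" for t
    by (induction t) auto
  note v = this
  show ?thesis
  proof (induction \<phi>)
    case (Eq s t)
    then show ?case using v[of s] v[of t] by auto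
  next
    case (Less s t)
    then show ?case using v[of s] v[of t] by auto
  next
    case (Imp \<phi> \<psi>)
    then show ?case by (simp add: subset_iff) blast
  next
    case (Forall y \<sigma> \<phi>)
    then show ?case by (cases "(y, \<sigma>) = (x, \<rho>)") (auto simp: subset_iff)
  qed simp
qed

lemma fv_list: obtains vs where "set vs = fv \<phi>"
proof -
  show thesis using finite_list[OF finite_fv[of \<phi>]] that by auto
qed

text \<open>Truth is assumed for axioms that are sentences; closedness is then checked for each
  instance where it is applied.\<close>

locale aca_model = type_structure D ap I lt
  for D :: "ty \<Rightarrow> 'v set" and ap I lt +
  assumes axioms_hold: "\<phi> \<in> ACA0\<omega> \<Longrightarrow> sentence \<phi> \<Longrightarrow> valid e \<Longrightarrow> sat e \<phi>"
begin

text \<open>The evaluation rules compute the meaning \<open>P\<close> of a closed axiom, and truth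
  in the model turns \<open>P\<close> into a fact of the metalogic.\<close>

lemma axiom:
  assumes "\<phi> \<in> equality_axioms \<union> arithmetic_axioms \<union> combinator_axioms \<union> recursor_axioms \<union> {exists2}"
    and "\<And>e. world {} e \<Longrightarrow> F {} e \<phi> P"
  shows P
proof -
  have "\<phi> 0 \<in> ACA0\<omega>" using assms(1) by (auto simp: ACA0\<omega>_def RCA0\<omega>_def at_depth_0_def)
  moreover obtain e where e: "valid e" using ex_valid by blast
  moreover have c: "sentence (\<phi> 0) \<and> (\<forall>e. valid e \<longrightarrow> sat e (\<phi> 0) = P)"
    by (rule F_closed) (rule assms(2))
  ultimately have "sat e (\<phi> 0)" using axioms_hold by simp
  then show P using c e by simp
qed

lemmas F_intros = F_eq F_less F_imp F_neg F_conj F_disj F_iff F_eqT F_fls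

lemma K_axiom: "x \<in> D \<rho> \<Longrightarrow> y \<in> D \<tau> \<Longrightarrow> ap (ap (I (Kc \<rho> \<tau>)) x) y = x"
proof -
  have "\<forall>x\<in>D \<rho>. \<forall>y\<in>D \<tau>. ap (ap (I (Kc \<rho> \<tau>)) x) y = x"
  proof (rule axiom)
    have "(\<^bold>\<forall>x\<^bold>:\<rho>. \<^bold>\<forall>y\<^bold>:\<tau>. eqT \<rho> (cst (Kc \<rho> \<tau>) \<cdot> x \<cdot> y) x) \<in> combinator_axioms"
      unfolding combinator_axioms_def by (rule UnI1, rule CollectI, (rule exI)+, rule conjI, rule refl, rule TrueI)
    then show "(\<^bold>\<forall>x\<^bold>:\<rho>. \<^bold>\<forall>y\<^bold>:\<tau>. eqT \<rho> (cst (Kc \<rho> \<tau>) \<cdot> x \<cdot> y) x) \<in>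
        equality_axioms \<union> arithmetic_axioms \<union> combinator_axioms \<union> recursor_axioms \<union> {exists2}"
      by (rule UnI1[OF UnI1[OF UnI2]])
    show "F {} e (\<^bold>\<forall>x\<^bold>:\<rho>. \<^bold>\<forall>y\<^bold>:\<tau>. eqT \<rho> (cst (Kc \<rho> \<tau>) \<cdot> x \<cdot> y) x)
        (\<forall>x\<in>D \<rho>. \<forall>y\<in>D \<tau>. ap (ap (I (Kc \<rho> \<tau>)) x) y = x)" if "world {} e" for e
      by (rule that F_all F_eqT T_app T_const extends_world | assumption | erule (1) T_mono)+
  qed
  then show "x \<in> D \<rho> \<Longrightarrow> y \<in> D \<tau> \<Longrightarrow> ap (ap (I (Kc \<rho> \<tau>)) x) y = x" by blast
qed

lemma S_axiom:
  assumes "x \<in> D (\<rho> \<rightarrow> \<sigma> \<rightarrow> \<tau>)" "y \<in> D (\<rho> \<rightarrow> \<sigma>)" "z \<in> D \<rho>"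
  shows "ap (ap (ap (I (Sc \<rho> \<sigma> \<tau>)) x) y) z = ap (ap x z) (ap y z)"
proof -
  let ?\<phi> = "\<^bold>\<forall>x\<^bold>:\<rho> \<rightarrow> \<sigma> \<rightarrow> \<tau>. \<^bold>\<forall>y\<^bold>:\<rho> \<rightarrow> \<sigma>. \<^bold>\<forall>z\<^bold>:\<rho>. eqT \<tau> (cst (Sc \<rho> \<sigma> \<tau>) \<cdot> x \<cdot> y \<cdot> z) (x \<cdot> z \<cdot> (y \<cdot> z))"
  have "\<forall>x\<in>D (\<rho> \<rightarrow> \<sigma> \<rightarrow> \<tau>). \<forall>y\<in>D (\<rho> \<rightarrow> \<sigma>). \<forall>z\<in>D \<rho>.
      ap (ap (ap (I (Sc \<rho> \<sigma> \<tau>)) x) y) z = ap (ap x z) (ap y z)" (is ?P)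
  proof (rule axiom)
    have "?\<phi> \<in> combinator_axioms"
      unfolding combinator_axioms_def by (rule UnI2, rule CollectI, (rule exI)+, rule conjI, rule refl, rule TrueI)
    then show "?\<phi> \<in> equality_axioms \<union> arithmetic_axioms \<union> combinator_axioms \<union> recursor_axioms \<union> {exists2}"
      by (rule UnI1[OF UnI1[OF UnI2]])
    show "F {} e ?\<phi> ?P" if "world {} e" for e
      by (rule that F_all F_eqT T_app T_const extends_world | assumption | erule (1) T_mono
          | erule (2) T_mono2)+
  qed
  then show ?thesis using assms by blast
qed

sublocale combinatory_structure
  using K_axiom S_axiom by unfold_locales


lemma T_mono3:
  "T V e s \<tau> u \<Longrightarrow> extends V e V' e' \<Longrightarrow> extends V' e' V'' e'' \<Longrightarrow> extends V'' e'' V3 e3 \<Longrightarrow> T V3 e3 s \<tau> u"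
  by (rule T_mono2[OF T_mono])

section \<open>The arithmetical and recursion axioms read in the model\<close>

abbreviation z :: 'v where "z \<equiv> I Zero"
abbreviation one :: 'v where "one \<equiv> I One"

definition pl :: "'v \<Rightarrow> 'v \<Rightarrow> 'v"  (infixl "\<oplus>" 65) where "a \<oplus> b = ap (ap (I Plus) a) b"
definition tm :: "'v \<Rightarrow> 'v \<Rightarrow> 'v"  (infixl "\<otimes>" 70) where "a \<otimes> b = ap (ap (I Times) a) b"
definition recur :: "'v \<Rightarrow> 'v \<Rightarrow> 'v \<Rightarrow> 'v" where "recur f m n = ap (ap (ap (I Rc) f) m) n"

lemma const_D:
  "z \<in> D T0" "one \<in> D T0" "I Plus \<in> D (T0 \<rightarrow> T0 \<rightarrow> T0)" "I Times \<in> D (T0 \<rightarrow> T0 \<rightarrow> T0)"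
  "I Rc \<in> D ((T0 \<rightarrow> T0 \<rightarrow> T0) \<rightarrow> T0 \<rightarrow> T0 \<rightarrow> T0)"
  by (auto intro!: I_D simp: closed_terms_def)

lemma pl_D [simp]: "a \<in> D T0 \<Longrightarrow> b \<in> D T0 \<Longrightarrow> a \<oplus> b \<in> D T0"
  unfolding pl_def by (rule ap_D[OF ap_D[OF const_D(3)]])

lemma tm_D [simp]: "a \<in> D T0 \<Longrightarrow> b \<in> D T0 \<Longrightarrow> a \<otimes> b \<in> D T0"
  unfolding tm_def by (rule ap_D[OF ap_D[OF const_D(4)]])

lemma recur_D: "f \<in> D (T0 \<rightarrow> T0 \<rightarrow> T0) \<Longrightarrow> a \<in> D T0 \<Longrightarrow> b \<in> D T0 \<Longrightarrow> recur f a b \<in> D T0"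
  unfolding recur_def by (rule ap_D[OF ap_D[OF ap_D[OF const_D(5)]]])

declare const_D(1,2) [simp]

lemma T_plus: "T V e s T0 u \<Longrightarrow> T V e t T0 v \<Longrightarrow> T V e (s \<^bold>+ t) T0 (u \<oplus> v)"
  unfolding plus_tm_def pl_def by (rule T_app[OF T_app[OF T_const(3)]])

lemma T_times: "T V e s T0 u \<Longrightarrow> T V e t T0 v \<Longrightarrow> T V e (s \<^bold>* t) T0 (u \<otimes> v)"
  unfolding times_tm_def tm_def by (rule T_app[OF T_app[OF T_const(4)]])

lemma arithmetic_axiom:
  assumes "\<phi> \<in> arithmetic_axioms" "\<And>e. world {} e \<Longrightarrow> F {} e \<phi> P"
  shows P
  by (rule axiom[of \<phi>]) (use assms in auto)

lemma succ_nonzero: "n \<in> D T0 \<Longrightarrow> n \<oplus> one \<noteq> z"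
proof -
  have "\<forall>n\<in>D T0. \<not> n \<oplus> one = z"
    by (rule arithmetic_axiom[of "\<^bold>\<forall>n\<^bold>:T0. \<^bold>\<not> n \<^bold>+ \<^bold>1 \<^bold>= \<^bold>0"])
      (simp add: arithmetic_axioms_def,
        (rule F_all F_intros T_plus T_const | assumption | erule extends_world | erule (1) T_mono)+)
  then show "n \<in> D T0 \<Longrightarrow> n \<oplus> one \<noteq> z" by blast
qed

lemma succ_inject: "m \<in> D T0 \<Longrightarrow> n \<in> D T0 \<Longrightarrow> m \<oplus> one = n \<oplus> one \<Longrightarrow> m = n"
proof -
  have "\<forall>m\<in>D T0. \<forall>n\<in>D T0. m \<oplus> one = n \<oplus> one \<longrightarrow> m = n"
    by (rule arithmetic_axiom[of "\<^bold>\<forall>m\<^bold>:T0. \<^bold>\<forall>n\<^bold>:T0. m \<^bold>+ \<^bold>1 \<^bold>= n \<^bold>+ \<^bold>1 \<^bold>\<longrightarrow> m \<^bold>= n"])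
      (simp add: arithmetic_axioms_def,
        (rule F_all F_intros T_plus T_const | assumption | erule extends_world | erule (1) T_mono)+)
  then show "m \<in> D T0 \<Longrightarrow> n \<in> D T0 \<Longrightarrow> m \<oplus> one = n \<oplus> one \<Longrightarrow> m = n" by blast
qed

lemma add_zero: "m \<in> D T0 \<Longrightarrow> m \<oplus> z = m"
proof -
  have "\<forall>m\<in>D T0. m \<oplus> z = m"
    by (rule arithmetic_axiom[of "\<^bold>\<forall>m\<^bold>:T0. m \<^bold>+ \<^bold>0 \<^bold>= m"])
      (simp add: arithmetic_axioms_def,
        (rule F_all F_intros T_plus T_const | assumption | erule extends_world | erule (1) T_mono)+)
  then show "m \<in> D T0 \<Longrightarrow> m \<oplus> z = m" by blast
qed

lemma add_succ: "m \<in> D T0 \<Longrightarrow> n \<in> D T0 \<Longrightarrow> m \<oplus> (n \<oplus> one) = m \<oplus> n \<oplus> one"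
proof -
  have "\<forall>m\<in>D T0. \<forall>n\<in>D T0. m \<oplus> (n \<oplus> one) = m \<oplus> n \<oplus> one"
    by (rule arithmetic_axiom[of "\<^bold>\<forall>m\<^bold>:T0. \<^bold>\<forall>n\<^bold>:T0. m \<^bold>+ (n \<^bold>+ \<^bold>1) \<^bold>= (m \<^bold>+ n) \<^bold>+ \<^bold>1"])
      (simp add: arithmetic_axioms_def,
        (rule F_all F_intros T_plus T_const | assumption | erule extends_world | erule (1) T_mono)+)
  then show "m \<in> D T0 \<Longrightarrow> n \<in> D T0 \<Longrightarrow> m \<oplus> (n \<oplus> one) = m \<oplus> n \<oplus> one" by blast
qed

lemma mult_zero: "m \<in> D T0 \<Longrightarrow> m \<otimes> z = z"
proof -
  have "\<forall>m\<in>D T0. m \<otimes> z = z"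
    by (rule arithmetic_axiom[of "\<^bold>\<forall>m\<^bold>:T0. m \<^bold>* \<^bold>0 \<^bold>= \<^bold>0"])
      (simp add: arithmetic_axioms_def,
        (rule F_all F_intros T_times T_const | assumption | erule extends_world | erule (1) T_mono)+)
  then show "m \<in> D T0 \<Longrightarrow> m \<otimes> z = z" by blast
qed

lemma mult_succ: "m \<in> D T0 \<Longrightarrow> n \<in> D T0 \<Longrightarrow> m \<otimes> (n \<oplus> one) = m \<otimes> n \<oplus> m"
proof -
  have "\<forall>m\<in>D T0. \<forall>n\<in>D T0. m \<otimes> (n \<oplus> one) = m \<otimes> n \<oplus> m"
    by (rule arithmetic_axiom[of "\<^bold>\<forall>m\<^bold>:T0. \<^bold>\<forall>n\<^bold>:T0. m \<^bold>* (n \<^bold>+ \<^bold>1) \<^bold>= (m \<^bold>* n) \<^bold>+ m"])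
      (simp add: arithmetic_axioms_def,
        (rule F_all F_intros T_plus T_times T_const | assumption | erule extends_world | erule (1) T_mono)+)
  then show "m \<in> D T0 \<Longrightarrow> n \<in> D T0 \<Longrightarrow> m \<otimes> (n \<oplus> one) = m \<otimes> n \<oplus> m" by blast
qed

lemma not_less_zero: "m \<in> D T0 \<Longrightarrow> \<not> lt m z"
proof -
  have "\<forall>m\<in>D T0. \<not> lt m z"
    by (rule arithmetic_axiom[of "\<^bold>\<forall>m\<^bold>:T0. \<^bold>\<not> m \<^bold>< \<^bold>0"])
      (simp add: arithmetic_axioms_def,
        (rule F_all F_intros T_plus T_const | assumption | erule extends_world | erule (1) T_mono)+)
  then show "m \<in> D T0 \<Longrightarrow> \<not> lt m z" by blast
qed

lemma less_succ: "m \<in> D T0 \<Longrightarrow> n \<in> D T0 \<Longrightarrow> lt m (n \<oplus> one) \<longleftrightarrow> lt m n \<or> m = n"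
proof -
  have "\<forall>m\<in>D T0. \<forall>n\<in>D T0. lt m (n \<oplus> one) \<longleftrightarrow> lt m n \<or> m = n"
    by (rule arithmetic_axiom[of "\<^bold>\<forall>m\<^bold>:T0. \<^bold>\<forall>n\<^bold>:T0. m \<^bold>< n \<^bold>+ \<^bold>1 \<^bold>\<longleftrightarrow> (m \<^bold>< n \<^bold>\<or> m \<^bold>= n)"])
      (simp add: arithmetic_axioms_def,
        (rule F_all F_intros T_plus T_const | assumption | erule extends_world | erule (1) T_mono)+)
  then show "m \<in> D T0 \<Longrightarrow> n \<in> D T0 \<Longrightarrow> lt m (n \<oplus> one) \<longleftrightarrow> lt m n \<or> m = n" by blast
qed

lemma recur_zero: "f \<in> D (T0 \<rightarrow> T0 \<rightarrow> T0) \<Longrightarrow> m \<in> D T0 \<Longrightarrow> recur f m z = m"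
proof -
  have "\<forall>f\<in>D (T0 \<rightarrow> T0 \<rightarrow> T0). \<forall>m\<in>D T0. recur f m z = m"
    unfolding recur_def
    by (rule axiom[of "\<^bold>\<forall>f\<^bold>:T0 \<rightarrow> T0 \<rightarrow> T0. \<^bold>\<forall>m\<^bold>:T0. cst Rc \<cdot> f \<cdot> m \<cdot> \<^bold>0 \<^bold>= m"])
      (simp add: recursor_axioms_def,
        (rule F_all F_intros T_app T_const | assumption | erule extends_world | erule (1) T_mono)+)
  then show "f \<in> D (T0 \<rightarrow> T0 \<rightarrow> T0) \<Longrightarrow> m \<in> D T0 \<Longrightarrow> recur f m z = m" by blast
qed

lemma recur_succ:
  "f \<in> D (T0 \<rightarrow> T0 \<rightarrow> T0) \<Longrightarrow> m \<in> D T0 \<Longrightarrow> n \<in> D T0 \<Longrightarrow>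
   recur f m (n \<oplus> one) = ap (ap f n) (recur f m n)"
proof -
  have "\<forall>f\<in>D (T0 \<rightarrow> T0 \<rightarrow> T0). \<forall>m\<in>D T0. \<forall>n\<in>D T0. recur f m (n \<oplus> one) = ap (ap f n) (recur f m n)"
    unfolding recur_def
    by (rule axiom[of "\<^bold>\<forall>f\<^bold>:T0 \<rightarrow> T0 \<rightarrow> T0. \<^bold>\<forall>m\<^bold>:T0. \<^bold>\<forall>n\<^bold>:T0.
          cst Rc \<cdot> f \<cdot> m \<cdot> (n \<^bold>+ \<^bold>1) \<^bold>= f \<cdot> n \<cdot> (cst Rc \<cdot> f \<cdot> m \<cdot> n)"])
      (simp add: recursor_axioms_def,
        (rule F_all F_intros T_plus T_app T_const | assumption | erule extends_world | erule (1) T_mono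
          | erule (2) T_mono2)+)
  then show "f \<in> D (T0 \<rightarrow> T0 \<rightarrow> T0) \<Longrightarrow> m \<in> D T0 \<Longrightarrow> n \<in> D T0 \<Longrightarrow>
      recur f m (n \<oplus> one) = ap (ap f n) (recur f m n)" by blast
qed

section \<open>Quantifier-free induction and the laws of arithmetic\<close>

lemma induct_sat:
  assumes A: "wff A" "quantifier_free A" "pars A = {}" and e: "valid e"
    and zero: "sat (e((x, T0) := z)) A"
    and step: "\<And>v. v \<in> D T0 \<Longrightarrow> sat (e((x, T0) := v)) A \<Longrightarrow> sat (e((x, T0) := v \<oplus> one)) A"
    and v: "v \<in> D T0"
  shows "sat (e((x, T0) := v)) A"
proof -
  let ?s = "App (App Plus (Var x T0)) One"
  let ?B = "Imp (subst x T0 Zero A) (Imp (Forall x T0 (Imp A (subst x T0 ?s A))) (Forall x T0 A))"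
  obtain vs where vs: "set vs = fv A" by (rule fv_list)
  \<comment> \<open>Closing over all free variables of \<open>A\<close> makes their values in
    \<open>e\<close>, of whatever type, parameters of the induction.\<close>
  have "generalize vs ?B \<in> induction_axioms"
    unfolding induction_axioms_def using A vs by blast
  then have "generalize vs ?B \<in> ACA0\<omega>" by (simp add: ACA0\<omega>_def RCA0\<omega>_def)
  moreover have "sentence (generalize vs ?B)"
    using fv_subst_subset[of x T0 Zero A] fv_subst_subset[of x T0 ?s A] vs A
    by (auto simp: sentence_def wff_generalize fv_generalize wff_subst)
  ultimately have gen: "sat e (generalize vs ?B)" if "valid e" for e using axioms_hold that by simp
  have "sat e ?B" by (rule sat_generalizeD[OF gen e])
  moreover have "sat (e((x, T0) := w)) (subst x T0 ?s A) = sat (e((x, T0) := w \<oplus> one)) A" for w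
    using A(2) by (simp add: sat_subst_quantifier_free pl_def)
  ultimately show ?thesis
    using zero step v A(2) by (simp add: sat_subst_quantifier_free)
qed

text \<open>Variables 1 to 3 carry number parameters; variable 0 is reserved for the
  induction.\<close>

definition env :: "'v \<Rightarrow> 'v \<Rightarrow> 'v \<Rightarrow> 'v env" where
  "env a b c = (\<lambda>(x, \<rho>). I (Par 0 \<rho>))((1, T0) := a, (2, T0) := b, (3, T0) := c)"

lemma valid_env: "a \<in> D T0 \<Longrightarrow> b \<in> D T0 \<Longrightarrow> c \<in> D T0 \<Longrightarrow> valid (env a b c)"
  unfolding env_def by (intro valid_upd) (auto simp: valid_def intro: I_D Par_closed)

abbreviation (input) pT where "pT s t \<equiv> App (App Plus s) t"
abbreviation (input) tT where "tT s t \<equiv> App (App Times s) t"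
abbreviation (input) vT where "vT i \<equiv> Var i T0"

lemma induct_env:
  assumes "wff A" "quantifier_free A" "pars A = {}" "a \<in> D T0" "b \<in> D T0" "c \<in> D T0"
    and "sat ((env a b c)((0, T0) := z)) A"
    and "\<And>v. v \<in> D T0 \<Longrightarrow> sat ((env a b c)((0, T0) := v)) A \<Longrightarrow> sat ((env a b c)((0, T0) := v \<oplus> one)) A"
    and "v \<in> D T0"
  shows "sat ((env a b c)((0, T0) := v)) A"
  by (rule induct_sat[OF assms(1-3) valid_env[OF assms(4-6)] assms(7) _ assms(9)]) (rule assms(8))

lemma induct_pred:
  assumes "\<And>v. sat ((env a b c)((0, T0) := v)) A \<longleftrightarrow> P v"
    and "wff A" "quantifier_free A" "pars A = {}" "a \<in> D T0" "b \<in> D T0" "c \<in> D T0"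
    and "P z" "\<And>v. v \<in> D T0 \<Longrightarrow> P v \<Longrightarrow> P (v \<oplus> one)" "v \<in> D T0"
  shows "P v"
  using induct_env[of A a b c v] assms by simp

lemmas env_simps = env_def pl_def[symmetric] tm_def[symmetric]

lemma add_assoc': "a \<in> D T0 \<Longrightarrow> b \<in> D T0 \<Longrightarrow> n \<in> D T0 \<Longrightarrow> a \<oplus> b \<oplus> n = a \<oplus> (b \<oplus> n)"
  using induct_env[of "Eq (pT (pT (vT 1) (vT 2)) (vT 0)) (pT (vT 1) (pT (vT 2) (vT 0)))" a b z n]
  by (simp add: env_simps add_zero add_succ)

lemma zero_add: "n \<in> D T0 \<Longrightarrow> z \<oplus> n = n"
  using induct_env[of "Eq (pT Zero (vT 0)) (vT 0)" z z z n]
  by (simp add: env_simps add_zero add_succ)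

lemma add_succ_left: "a \<in> D T0 \<Longrightarrow> n \<in> D T0 \<Longrightarrow> a \<oplus> one \<oplus> n = a \<oplus> n \<oplus> one"
  using induct_env[of "Eq (pT (pT (vT 1) One) (vT 0)) (pT (pT (vT 1) (vT 0)) One)" a z z n]
  by (simp add: env_simps add_zero add_succ)

lemma add_commute': "a \<in> D T0 \<Longrightarrow> n \<in> D T0 \<Longrightarrow> a \<oplus> n = n \<oplus> a"
  using induct_env[of "Eq (pT (vT 1) (vT 0)) (pT (vT 0) (vT 1))" a z z n]
  by (simp add: env_simps add_zero zero_add add_succ add_succ_left)

lemma zero_mult: "n \<in> D T0 \<Longrightarrow> z \<otimes> n = z"
  using induct_env[of "Eq (tT Zero (vT 0)) Zero" z z z n]
  by (simp add: env_simps mult_zero mult_succ add_zero)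

lemma add_left_commute': "a \<in> D T0 \<Longrightarrow> b \<in> D T0 \<Longrightarrow> c \<in> D T0 \<Longrightarrow> b \<oplus> (a \<oplus> c) = a \<oplus> (b \<oplus> c)"
  using add_assoc'[of a b c] add_assoc'[of b a c] add_commute'[of a b] by simp

lemmas add_ac' = add_assoc' add_commute' add_left_commute'

lemma mult_succ_left: "a \<in> D T0 \<Longrightarrow> n \<in> D T0 \<Longrightarrow> (a \<oplus> one) \<otimes> n = a \<otimes> n \<oplus> n"
proof -
  assume a: "a \<in> D T0" and n: "n \<in> D T0"
  have "a \<otimes> v \<oplus> v \<oplus> (a \<oplus> one) = a \<otimes> v \<oplus> a \<oplus> (v \<oplus> one)" if v: "v \<in> D T0" for v
    using a v by (simp add: add_ac')
  then show ?thesis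
    using a n induct_env[of "Eq (tT (pT (vT 1) One) (vT 0)) (pT (tT (vT 1) (vT 0)) (vT 0))" a z z n]
    by (simp add: env_simps mult_zero mult_succ add_zero)
qed

lemma mult_commute': "a \<in> D T0 \<Longrightarrow> n \<in> D T0 \<Longrightarrow> a \<otimes> n = n \<otimes> a"
  using induct_env[of "Eq (tT (vT 1) (vT 0)) (tT (vT 0) (vT 1))" a z z n]
  by (simp add: env_simps mult_zero zero_mult mult_succ mult_succ_left)

lemma distrib': "a \<in> D T0 \<Longrightarrow> b \<in> D T0 \<Longrightarrow> n \<in> D T0 \<Longrightarrow> a \<otimes> (b \<oplus> n) = a \<otimes> b \<oplus> a \<otimes> n"
proof -
  assume a: "a \<in> D T0" and b: "b \<in> D T0" and n: "n \<in> D T0"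
  have "a \<otimes> b \<oplus> a \<otimes> v \<oplus> a = a \<otimes> b \<oplus> (a \<otimes> v \<oplus> a)" if v: "v \<in> D T0" for v
    using a b v by (simp add: add_assoc')
  then show ?thesis
    using a b n
      induct_env[of "Eq (tT (vT 1) (pT (vT 2) (vT 0))) (pT (tT (vT 1) (vT 2)) (tT (vT 1) (vT 0)))" a b z n]
    by (simp add: env_simps mult_zero mult_succ add_zero add_succ)
qed

lemma mult_assoc': "a \<in> D T0 \<Longrightarrow> b \<in> D T0 \<Longrightarrow> n \<in> D T0 \<Longrightarrow> a \<otimes> b \<otimes> n = a \<otimes> (b \<otimes> n)"
  using induct_env[of "Eq (tT (tT (vT 1) (vT 2)) (vT 0)) (tT (vT 1) (tT (vT 2) (vT 0)))" a b z n]
  by (simp add: env_simps mult_zero mult_succ distrib'[where n = b])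

lemma one_mult: "n \<in> D T0 \<Longrightarrow> one \<otimes> n = n"
  using mult_succ_left[of z n] by (simp add: zero_add zero_mult)

lemma add_cancel: "a \<in> D T0 \<Longrightarrow> b \<in> D T0 \<Longrightarrow> n \<in> D T0 \<Longrightarrow> n \<oplus> a = n \<oplus> b \<Longrightarrow> a = b"
proof -
  assume D: "a \<in> D T0" "b \<in> D T0" "n \<in> D T0" and eq: "n \<oplus> a = n \<oplus> b"
  have "a \<oplus> n = b \<oplus> n \<longrightarrow> a = b"
    using induct_env[of "Imp (Eq (pT (vT 1) (vT 0)) (pT (vT 2) (vT 0))) (Eq (vT 1) (vT 2))" a b z n]
      D succ_inject[of "a \<oplus> _" "b \<oplus> _"] by (simp add: env_simps add_zero add_succ)
  then show "a = b" using eq add_commute'[OF D(3,1)] add_commute'[OF D(3,2)] by simp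
qed

lemma less_trans': "a \<in> D T0 \<Longrightarrow> b \<in> D T0 \<Longrightarrow> n \<in> D T0 \<Longrightarrow> lt a b \<Longrightarrow> lt b n \<Longrightarrow> lt a n"
  using induct_env[of "Imp (Less (vT 1) (vT 2)) (Imp (Less (vT 2) (vT 0)) (Less (vT 1) (vT 0)))" a b z n]
  by (auto simp add: env_simps less_succ not_less_zero)

lemma less_irrefl': "n \<in> D T0 \<Longrightarrow> \<not> lt n n"
proof -
  assume n: "n \<in> D T0"
  have "\<not> lt (v \<oplus> one) (v \<oplus> one)" if v: "v \<in> D T0" "\<not> lt v v" for v
  proof
    assume "lt (v \<oplus> one) (v \<oplus> one)"
    moreover have "lt v (v \<oplus> one)" using v(1) by (simp add: less_succ)
    ultimately show False using v less_succ[of "v \<oplus> one" v] less_trans'[of v "v \<oplus> one" v] by auto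
  qed
  then show ?thesis
    using n induct_env[of "Neg (Less (vT 0) (vT 0))" z z z n] by (simp add: env_simps not_less_zero)
qed

lemma less_add_succ: "a \<in> D T0 \<Longrightarrow> n \<in> D T0 \<Longrightarrow> lt a (a \<oplus> n \<oplus> one)"
  using induct_env[of "Less (vT 1) (pT (pT (vT 1) (vT 0)) One)" a z z n]
  by (simp add: env_simps less_succ add_zero add_succ)

text \<open>Predecessor by recursion: the step \<open>Kc T0 T0\<close> returns the index and
  discards the previous value. With predecessor and truncated subtraction given by terms, statements
  about differences need no existential quantifier and stay within reach of quantifier-free
  induction.\<close>

abbreviation "predF \<equiv> ap (ap (I Rc) (I (Kc T0 T0))) z"

definition pd :: "'v \<Rightarrow> 'v" where "pd n = ap predF n"
definition mn :: "'v \<Rightarrow> 'v \<Rightarrow> 'v" where "mn m n = recur (ap (I (Kc T1 T0)) predF) m n"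

abbreviation (input) pred_T where "pred_T \<equiv> App (App Rc (Kc T0 T0)) Zero"
abbreviation (input) dT where "dT s t \<equiv> App (App (App Rc (App (Kc T1 T0) pred_T)) s) t"

lemma predF_D: "predF \<in> D T1"
  by (rule ap_D[OF ap_D[OF const_D(5) K_D] const_D(1)])

lemma pd: "pd z = z" "n \<in> D T0 \<Longrightarrow> pd (n \<oplus> one) = n" "n \<in> D T0 \<Longrightarrow> pd n \<in> D T0"
  using recur_zero[OF K_D const_D(1)] recur_succ[OF K_D const_D(1), of n] recur_D[OF K_D const_D(1), of n]
  by (simp_all add: pd_def recur_def K ap_D[OF predF_D])

lemma mn:
  assumes "m \<in> D T0"
  shows "mn m z = m" "n \<in> D T0 \<Longrightarrow> mn m (n \<oplus> one) = pd (mn m n)" "n \<in> D T0 \<Longrightarrow> mn m n \<in> D T0"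
proof -
  have f: "ap (I (Kc T1 T0)) predF \<in> D (T0 \<rightarrow> T0 \<rightarrow> T0)" by (rule ap_D[OF K_D predF_D])
  show "mn m z = m" using recur_zero[OF f assms] by (simp add: mn_def)
  show "n \<in> D T0 \<Longrightarrow> mn m n \<in> D T0" using recur_D[OF f assms] by (simp add: mn_def)
  show "n \<in> D T0 \<Longrightarrow> mn m (n \<oplus> one) = pd (mn m n)"
    using recur_succ[OF f assms] by (simp add: mn_def pd_def K[OF predF_D])
qed

lemma zero_or_succ: "n \<in> D T0 \<Longrightarrow> n = z \<or> n = pd n \<oplus> one"
proof -
  have e: "sat ((env z z z)((0, T0) := v))
      (Imp (Neg (Eq (vT 0) Zero)) (Eq (vT 0) (pT (App pred_T (vT 0)) One))) \<longleftrightarrow> v = z \<or> v = pd v \<oplus> one" for v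
    by (simp add: env_simps pd_def disj_imp)
  show "n \<in> D T0 \<Longrightarrow> n = z \<or> n = pd n \<oplus> one"
    using induct_env[of "Imp (Neg (Eq (vT 0) Zero)) (Eq (vT 0) (pT (App pred_T (vT 0)) One))" z z z n]
    unfolding e by (simp add: pd)
qed

text \<open>Induction on \<open>n\<close> with the explicit difference \<open>mn b n\<close>: while
  \<open>n\<close> is strictly below \<open>b\<close> the difference is nonzero, hence a successor,
  and one unit can move to the left summand.\<close>

lemma add_diff: "b \<in> D T0 \<Longrightarrow> n \<in> D T0 \<Longrightarrow> lt n b \<or> n = b \<Longrightarrow> n \<oplus> mn b n = b"
proof -
  assume b: "b \<in> D T0" and n: "n \<in> D T0" "lt n b \<or> n = b"
  have zero: "lt z b \<or> z = b \<longrightarrow> z \<oplus> mn b z = b" using b by (simp add: zero_add mn)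
  have step: "lt (v \<oplus> one) b \<or> v \<oplus> one = b \<longrightarrow> v \<oplus> one \<oplus> mn b (v \<oplus> one) = b"
    if v: "v \<in> D T0" and IH: "lt v b \<or> v = b \<longrightarrow> v \<oplus> mn b v = b" for v
  proof
    assume le: "lt (v \<oplus> one) b \<or> v \<oplus> one = b"
    have succ: "lt v (v \<oplus> one)" using less_succ[OF v v] by blast
    from le have less: "lt v b"
    proof
      assume "lt (v \<oplus> one) b"
      then show "lt v b" using less_trans'[OF v pl_D[OF v const_D(2)] b succ] by blast
    qed (use succ in \<open>simp only:\<close>)
    then have eq: "v \<oplus> mn b v = b" using IH by blast
    have "mn b v \<noteq> z"
    proof
      assume "mn b v = z"
      then have "v = b" using eq add_zero[OF v] by (simp only:)
      then show False using less less_irrefl'[OF b] by (simp only:)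
    qed
    then have w: "mn b v = pd (mn b v) \<oplus> one" using zero_or_succ[of "mn b v"] mn(3)[OF b v] by blast
    have "v \<oplus> one \<oplus> pd (mn b v) = v \<oplus> (pd (mn b v) \<oplus> one)"
      using add_succ_left add_succ v pd(3) mn(3)[OF b v] by simp
    also have "\<dots> = b" using eq by (simp only: w[symmetric])
    finally show "v \<oplus> one \<oplus> mn b (v \<oplus> one) = b" by (simp only: mn(2)[OF b v])
  qed
  have "lt n b \<or> n = b \<longrightarrow> n \<oplus> mn b n = b"
  proof (rule induct_pred[where P = "\<lambda>v. lt v b \<or> v = b \<longrightarrow> v \<oplus> mn b v = b"])
    show "sat ((env b z z)((0, T0) := v))
        (Imp (Imp (Neg (Less (vT 0) (vT 1))) (Eq (vT 0) (vT 1))) (Eq (pT (vT 0) (dT (vT 1) (vT 0))) (vT 1))) \<longleftrightarrow>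
      (lt v b \<or> v = b \<longrightarrow> v \<oplus> mn b v = b)" for v
    proof -
      let ?e = "(env b z z)((0, T0) := v)"
      have "ev ?e (pT (vT 0) (dT (vT 1) (vT 0))) = v \<oplus> mn b v" "ev ?e (vT 0) = v" "ev ?e (vT 1) = b"
        by (simp_all add: env_simps mn_def recur_def)
      then show ?thesis by (simp only: sat.simps) blast
    qed
  qed (rule b n(1) const_D zero step wff.simps | assumption | simp)+
  then show ?thesis using n(2) by blast
qed

lemma less_or_succ_le: "a \<in> D T0 \<Longrightarrow> n \<in> D T0 \<Longrightarrow> lt a n \<Longrightarrow> lt (a \<oplus> one) n \<or> a \<oplus> one = n"
proof -
  assume a: "a \<in> D T0" and n: "n \<in> D T0" "lt a n"
  have zero: "lt a z \<longrightarrow> lt (a \<oplus> one) z \<or> a \<oplus> one = z" using not_less_zero[OF a] by blast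
  have step: "lt a (v \<oplus> one) \<longrightarrow> lt (a \<oplus> one) (v \<oplus> one) \<or> a \<oplus> one = v \<oplus> one"
    if v: "v \<in> D T0" and IH: "lt a v \<longrightarrow> lt (a \<oplus> one) v \<or> a \<oplus> one = v" for v
    using IH less_succ[OF a v] less_succ[OF pl_D[OF a const_D(2)] v] by blast
  have "lt a n \<longrightarrow> lt (a \<oplus> one) n \<or> a \<oplus> one = n"
  proof (rule induct_pred[where P = "\<lambda>v. lt a v \<longrightarrow> lt (a \<oplus> one) v \<or> a \<oplus> one = v"])
    show "sat ((env a z z)((0, T0) := v))
        (Imp (Less (vT 1) (vT 0)) (Imp (Neg (Less (pT (vT 1) One) (vT 0))) (Eq (pT (vT 1) One) (vT 0)))) \<longleftrightarrow>
      (lt a v \<longrightarrow> lt (a \<oplus> one) v \<or> a \<oplus> one = v)" for v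
    proof -
      let ?e = "(env a z z)((0, T0) := v)"
      have "ev ?e (pT (vT 1) One) = a \<oplus> one" "ev ?e (vT 0) = v" "ev ?e (vT 1) = a"
        by (simp_all add: env_simps)
      then show ?thesis by (simp only: sat.simps) blast
    qed
  qed (rule a n(1) const_D zero step | assumption | simp)+
  then show ?thesis using n(2) by blast
qed

text \<open>In the step only the case \<open>lt v a\<close> needs an argument; there
  \<open>less_or_succ_le\<close> yields the two alternatives for the successor of
  \<open>v\<close>.\<close>

lemma less_linear': "a \<in> D T0 \<Longrightarrow> n \<in> D T0 \<Longrightarrow> lt a n \<or> a = n \<or> lt n a"
proof -
  assume a: "a \<in> D T0" and n: "n \<in> D T0"
  have zero: "lt a z \<or> a = z \<or> lt z a"
  proof -
    have "lt z (pd a \<oplus> one)"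
      using less_add_succ[OF const_D(1) pd(3)[OF a]] zero_add[OF pd(3)[OF a]] by simp
    then show ?thesis using zero_or_succ[OF a] by metis
  qed
  have step: "lt a (v \<oplus> one) \<or> a = v \<oplus> one \<or> lt (v \<oplus> one) a"
    if v: "v \<in> D T0" and IH: "lt a v \<or> a = v \<or> lt v a" for v
    using IH less_or_succ_le[OF v a] less_succ[OF a v] by blast
  show ?thesis
  proof (rule induct_pred[where P = "\<lambda>v. lt a v \<or> a = v \<or> lt v a"])
    show "sat ((env a z z)((0, T0) := v))
        (Imp (Neg (Less (vT 1) (vT 0))) (Imp (Neg (Eq (vT 1) (vT 0))) (Less (vT 0) (vT 1)))) \<longleftrightarrow>
      lt a v \<or> a = v \<or> lt v a" for v
    proof -
      let ?e = "(env a z z)((0, T0) := v)"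
      have "ev ?e (vT 0) = v" "ev ?e (vT 1) = a"
        by (simp_all add: env_simps)
      then show ?thesis by (simp only: sat.simps) blast
    qed
  qed (rule a n const_D zero step | assumption | simp)+
qed

end

text \<open>The order is recovered from addition: \<open>a \<le> b\<close> means that \<open>p a c = b\<close> for some \<open>c\<close>.\<close>

definition ordered_semiring_on ::
    "'a set \<Rightarrow> 'a \<Rightarrow> 'a \<Rightarrow> ('a \<Rightarrow> 'a \<Rightarrow> 'a) \<Rightarrow> ('a \<Rightarrow> 'a \<Rightarrow> 'a) \<Rightarrow> bool" where
  "ordered_semiring_on C z u p t \<longleftrightarrow>
     z \<in> C \<and> u \<in> C \<and> z \<noteq> u \<and>
     (\<forall>a\<in>C. p z a = a \<and> t z a = z \<and> t u a = a) \<and>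
     (\<forall>a\<in>C. \<forall>b\<in>C. p a b \<in> C \<and> t a b \<in> C \<and> p a b = p b a \<and> t a b = t b a \<and>
       (p a b = z \<longrightarrow> a = z) \<and> (t a b = z \<longrightarrow> a = z \<or> b = z) \<and>
       (\<exists>c\<in>C. p a c = b \<or> p b c = a)) \<and>
     (\<forall>a\<in>C. \<forall>b\<in>C. \<forall>c\<in>C. p (p a b) c = p a (p b c) \<and> t (t a b) c = t a (t b c) \<and>
       t a (p b c) = p (t a b) (t a c) \<and> (p c a = p c b \<longrightarrow> a = b))"

context aca_model
begin

lemma add_eq_zero: "a \<in> D T0 \<Longrightarrow> b \<in> D T0 \<Longrightarrow> a \<oplus> b = z \<Longrightarrow> a = z"
proof -
  assume D: "a \<in> D T0" "b \<in> D T0" and ab: "a \<oplus> b = z"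
  have "b \<noteq> pd b \<oplus> one"
    using succ_nonzero[of "a \<oplus> pd b"] add_succ[OF D(1) pd(3)[OF D(2)]] D ab pd(3)[OF D(2)]
    by (metis pl_D)
  then show "a = z" using zero_or_succ[OF D(2)] add_zero[OF D(1)] ab by metis
qed

lemma mult_eq_zero: "a \<in> D T0 \<Longrightarrow> b \<in> D T0 \<Longrightarrow> a \<otimes> b = z \<Longrightarrow> a = z \<or> b = z"
proof -
  assume a: "a \<in> D T0" and b: "b \<in> D T0" and ab: "a \<otimes> b = z"
  have "a = z" if "b = pd b \<oplus> one"
  proof -
    have "a \<oplus> a \<otimes> pd b = a \<otimes> (pd b \<oplus> one)" using a b mult_succ[of a "pd b"] add_commute'[of "a \<otimes> pd b" a] by (simp add: pd)
    then have "a \<oplus> a \<otimes> pd b = z" using that ab by metis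
    then show "a = z" using add_eq_zero[of a "a \<otimes> pd b"] a b by (simp add: pd)
  qed
  then show ?thesis using zero_or_succ[OF b] by blast
qed

lemma less_iff:
  assumes "a \<in> D T0" "b \<in> D T0"
  shows "lt a b \<longleftrightarrow> a \<noteq> b \<and> (\<exists>c\<in>D T0. a \<oplus> c = b)"
proof
  assume "lt a b"
  then show "a \<noteq> b \<and> (\<exists>c\<in>D T0. a \<oplus> c = b)"
    using assms add_diff[of b a] less_irrefl'[of a] mn(3)[of b a] by auto
next
  assume "a \<noteq> b \<and> (\<exists>c\<in>D T0. a \<oplus> c = b)"
  then obtain c where c: "c \<in> D T0" "a \<oplus> c = b" "a \<noteq> b" by blast
  then have "c \<noteq> z" using assms add_zero by auto
  then have "c = pd c \<oplus> one" using zero_or_succ[OF c(1)] by blast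
  then have "b = a \<oplus> pd c \<oplus> one" using c(2) add_succ[OF assms(1) pd(3)[OF c(1)]] by metis
  then show "lt a b" using less_add_succ[OF assms(1) pd(3)[OF c(1)]] by (simp only:)
qed

lemma ordered_semiring: "ordered_semiring_on (D T0) z one (\<oplus>) (\<otimes>)"
  unfolding ordered_semiring_on_def
proof (intro conjI ballI)
  show "z \<noteq> one" using succ_nonzero[of z] by (simp add: zero_add)
next
  fix a b assume D: "a \<in> D T0" "b \<in> D T0"
  show "a \<oplus> b \<in> D T0" "a \<otimes> b \<in> D T0" using D by simp_all
  show "a \<oplus> b = b \<oplus> a" "a \<otimes> b = b \<otimes> a" using D by (rule add_commute' mult_commute')+
  show "a \<oplus> b = z \<longrightarrow> a = z" using add_eq_zero[OF D] by blast
  show "a \<otimes> b = z \<longrightarrow> a = z \<or> b = z" using mult_eq_zero[OF D] by blast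
  show "\<exists>c\<in>D T0. a \<oplus> c = b \<or> b \<oplus> c = a"
    using less_linear'[OF D] less_iff[OF D] less_iff[OF D(2,1)] add_zero[OF D(1)] const_D(1) by blast
next
  fix a b c assume D: "a \<in> D T0" "b \<in> D T0" "c \<in> D T0"
  show "a \<oplus> b \<oplus> c = a \<oplus> (b \<oplus> c)" using D by (rule add_assoc')
  show "a \<otimes> b \<otimes> c = a \<otimes> (b \<otimes> c)" using D by (rule mult_assoc')
  show "a \<otimes> (b \<oplus> c) = a \<otimes> b \<oplus> a \<otimes> c" using D by (rule distrib')
  show "c \<oplus> a = c \<oplus> b \<longrightarrow> a = b" using add_cancel[OF D] by blast
qed (simp_all add: zero_add zero_mult one_mult)

end

section \<open>Definable functions and relations\<close>

lemma (in type_structure) rep_unique2: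
  assumes "U \<in> D (\<rho> \<rightarrow> \<sigma> \<rightarrow> \<tau>)" "W \<in> D (\<rho> \<rightarrow> \<sigma> \<rightarrow> \<tau>)"
    and eq: "\<And>x y. x \<in> D \<rho> \<Longrightarrow> y \<in> D \<sigma> \<Longrightarrow> ap (ap U x) y = ap (ap W x) y"
  shows "U = W"
proof (rule extensional[OF assms(1,2)])
  fix x assume x: "x \<in> D \<rho>"
  show "ap U x = ap W x"
    by (rule extensional[OF ap_D[OF assms(1) x] ap_D[OF assms(2) x]]) (rule eq[OF x])
qed

locale arithmetic_model = aca_model D ap I lt
  for D :: "ty \<Rightarrow> 'v set" and ap I lt +
  fixes of_n :: "'n::linordered_semidom \<Rightarrow> 'v"
  assumes bij: "bij_betw of_n UNIV (D T0)"
    and of_n_zero: "of_n 0 = z" and of_n_one: "of_n 1 = one"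
    and of_n_add: "of_n (a + b) = of_n a \<oplus> of_n b" and of_n_mult: "of_n (a * b) = of_n a \<otimes> of_n b"
    and of_n_less: "lt (of_n a) (of_n b) \<longleftrightarrow> a < b"
begin

lemma of_n_D [simp]: "of_n a \<in> D T0"
  using bij by (auto simp: bij_betw_def)

lemma of_n_eq [simp]: "of_n a = of_n b \<longleftrightarrow> a = b"
  using bij by (auto simp: bij_betw_def inj_on_def)

lemma of_n_cases: "v \<in> D T0 \<Longrightarrow> \<exists>n. v = of_n n"
  using bij by (auto simp: bij_betw_def)

lemma ball_T0: "(\<forall>v\<in>D T0. P v) \<longleftrightarrow> (\<forall>n. P (of_n n))"
  by (auto dest!: of_n_cases)

lemma bex_T0: "(\<exists>v\<in>D T0. P v) \<longleftrightarrow> (\<exists>n. P (of_n n))"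
  by (auto dest!: of_n_cases)

definition num :: "'v \<Rightarrow> 'n" where "num v = (THE n. v = of_n n)"

lemma num_of_n [simp]: "num (of_n n) = n"
  by (simp add: num_def)

lemma of_n_num: "v \<in> D T0 \<Longrightarrow> of_n (num v) = v"
  by (auto dest!: of_n_cases)

definition val1 :: "'v \<Rightarrow> 'n \<Rightarrow> 'n"  (infixl "\<star>" 80) where
  "u \<star> n = num (ap u (of_n n))"

lemma val1: "u \<in> D T1 \<Longrightarrow> ap u (of_n n) = of_n (u \<star> n)"
  using ap_D[of u T0 T0 "of_n n"] by (simp add: val1_def of_n_num)

definition repn :: "ty \<Rightarrow> ('n \<Rightarrow> 'v) \<Rightarrow> bool" where
  "repn \<tau> h \<longleftrightarrow> (\<exists>u\<in>D (T0 \<rightarrow> \<tau>). \<forall>n. ap u (of_n n) = h n)"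

lemma repn_rep: "repn \<tau> h \<longleftrightarrow> rep T0 \<tau> (\<lambda>v. h (num v))"
  unfolding repn_def rep_def ball_T0 by simp

lemma repn_const: "c \<in> D \<tau> \<Longrightarrow> repn \<tau> (\<lambda>n. c)"
  unfolding repn_rep by (rule rep_const)

lemma repn_ap: "u \<in> D (T0 \<rightarrow> \<tau>) \<Longrightarrow> repn \<tau> (\<lambda>n. ap u (of_n n))"
  unfolding repn_def by blast

lemma repn_id: "repn T0 of_n"
  unfolding repn_def using rep_id[of T0] unfolding rep_def ball_T0 .

lemma repn_app: "repn (\<sigma> \<rightarrow> \<tau>) f \<Longrightarrow> repn \<sigma> g \<Longrightarrow> repn \<tau> (\<lambda>n. ap (f n) (g n))"
  unfolding repn_rep by (rule rep_app)

lemma repn_comp: "u \<in> D (\<sigma> \<rightarrow> \<tau>) \<Longrightarrow> repn \<sigma> g \<Longrightarrow> repn \<tau> (\<lambda>n. ap u (g n))"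
  by (rule repn_app[OF repn_const])

section \<open>Definable number functions\<close>

definition dfn :: "('n \<Rightarrow> 'n) \<Rightarrow> bool" where
  "dfn h \<longleftrightarrow> repn T0 (\<lambda>n. of_n (h n))"

text \<open>Curried, because this is the form in which the recursor takes its step function.\<close>

definition dfn2 :: "('n \<Rightarrow> 'n \<Rightarrow> 'n) \<Rightarrow> bool" where
  "dfn2 B \<longleftrightarrow> (\<exists>U\<in>D (T0 \<rightarrow> T0 \<rightarrow> T0). \<forall>a b. ap (ap U (of_n a)) (of_n b) = of_n (B a b))"

lemma dfn_obtain:
  assumes "dfn h"
  obtains u where "u \<in> D T1" "\<And>n. u \<star> n = h n"
proof -
  obtain u where "u \<in> D T1" "\<forall>n. ap u (of_n n) = of_n (h n)"
    using assms by (auto simp: dfn_def repn_def)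
  then show thesis using that[of u] by (simp add: val1_def)
qed

lemma dfn_const: "dfn (\<lambda>n. c)"
  unfolding dfn_def by (rule repn_const) simp

lemma dfn_id: "dfn (\<lambda>n. n)"
  unfolding dfn_def by (rule repn_id)

lemma dfn_val1: "u \<in> D T1 \<Longrightarrow> dfn (\<lambda>n. u \<star> n)"
  unfolding dfn_def using repn_ap[of u T0] by (simp add: val1)

lemma repn_dfn: "u \<in> D (T0 \<rightarrow> \<tau>) \<Longrightarrow> dfn g \<Longrightarrow> repn \<tau> (\<lambda>n. ap u (of_n (g n)))"
  unfolding dfn_def by (rule repn_comp)

lemma dfn_comp: "dfn f \<Longrightarrow> dfn g \<Longrightarrow> dfn (\<lambda>n. f (g n))"
proof -
  assume "dfn f" and g: "dfn g"
  from \<open>dfn f\<close> obtain u where u: "u \<in> D T1" "\<And>n. u \<star> n = f n" by (rule dfn_obtain) blast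
  show "dfn (\<lambda>n. f (g n))" using repn_dfn[OF u(1) g] by (simp add: dfn_def val1[OF u(1)] u(2))
qed

lemma dfn_bin: "dfn2 B \<Longrightarrow> dfn f \<Longrightarrow> dfn g \<Longrightarrow> dfn (\<lambda>n. B (f n) (g n))"
proof -
  assume "dfn2 B" and fg: "dfn f" "dfn g"
  then obtain U where U: "U \<in> D (T0 \<rightarrow> T0 \<rightarrow> T0)" "\<And>a b. ap (ap U (of_n a)) (of_n b) = of_n (B a b)"
    by (auto simp: dfn2_def)
  have "repn T0 (\<lambda>n. ap (ap U (of_n (f n))) (of_n (g n)))"
    using fg unfolding dfn_def by (intro repn_app[OF repn_comp[OF U(1)]])
  then show ?thesis by (simp add: dfn_def U(2))
qed

lemma dfn2_plus: "dfn2 (+)"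
  unfolding dfn2_def by (rule bexI[OF _ const_D(3)]) (simp add: of_n_add pl_def)

lemma dfn2_times: "dfn2 (*)"
  unfolding dfn2_def by (rule bexI[OF _ const_D(4)]) (simp add: of_n_mult tm_def)

text \<open>For fixed \<open>a\<close>, the combinator \<open>Sc\<close> applied to the constant
  function with value \<open>u\<close> and to \<open>ap U (of_n a)\<close> is the composite; the
  rest makes this uniform in \<open>a\<close>.\<close>

lemma dfn2_comp: "dfn h \<Longrightarrow> dfn2 B \<Longrightarrow> dfn2 (\<lambda>a b. h (B a b))"
proof -
  assume "dfn h" "dfn2 B"
  then obtain U where U: "U \<in> D (T0 \<rightarrow> T0 \<rightarrow> T0)" "\<And>a b. ap (ap U (of_n a)) (of_n b) = of_n (B a b)"
    by (auto simp: dfn2_def)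
  from \<open>dfn h\<close> obtain u where u: "u \<in> D T1" "\<And>n. u \<star> n = h n" by (rule dfn_obtain) blast
  let ?k = "ap (I (Kc T1 T0)) u"
  let ?c = "ap (I (Sc T0 T0 T0)) ?k"
  have k: "?k \<in> D (T0 \<rightarrow> T1)" by (rule ap_D[OF K_D u(1)])
  have "repn T1 (\<lambda>a. ap ?c (ap U (of_n a)))"
    by (rule repn_comp[OF ap_D[OF S_D k] repn_ap[OF U(1)]])
  then obtain W where W: "W \<in> D (T0 \<rightarrow> T1)" "\<And>a. ap W (of_n a) = ap ?c (ap U (of_n a))"
    by (auto simp: repn_def)
  have "ap (ap W (of_n a)) (of_n b) = of_n (h (B a b))" for a b
    using S[OF k ap_D[OF U(1) of_n_D] of_n_D] K[OF u(1) of_n_D]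
    by (simp add: W(2) U(2) val1[OF u(1)] u(2))
  then show ?thesis unfolding dfn2_def using W(1) by blast
qed

text \<open>A function of the step alone: \<open>SOME\<close> picks a representing object, and
  extensionality makes that object unique, so the value agrees with any representation at
  hand.\<close>

definition nrec :: "('n \<Rightarrow> 'n \<Rightarrow> 'n) \<Rightarrow> 'n \<Rightarrow> 'n \<Rightarrow> 'n" where
  "nrec h a b = num (recur (SOME U. U \<in> D (T0 \<rightarrow> T0 \<rightarrow> T0) \<and>
     (\<forall>i r. ap (ap U (of_n i)) (of_n r) = of_n (h i r))) (of_n a) (of_n b))"

lemma nrec_recur:
  assumes U: "U \<in> D (T0 \<rightarrow> T0 \<rightarrow> T0)" "\<And>i r. ap (ap U (of_n i)) (of_n r) = of_n (h i r)"
  shows "recur U (of_n a) (of_n b) = of_n (nrec h a b)"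
proof -
  let ?P = "\<lambda>U. U \<in> D (T0 \<rightarrow> T0 \<rightarrow> T0) \<and> (\<forall>i r. ap (ap U (of_n i)) (of_n r) = of_n (h i r))"
  have P: "?P (SOME U. ?P U)" by (rule someI[of ?P U]) (use U in blast)
  have "(SOME U. ?P U) = U"
  proof (rule rep_unique2[OF conjunct1[OF P] U(1)])
    show "ap (ap (SOME U. ?P U) x) y = ap (ap U x) y" if "x \<in> D T0" "y \<in> D T0" for x y
      using of_n_cases[OF that(1)] of_n_cases[OF that(2)] P U(2) by auto
  qed
  then show ?thesis unfolding nrec_def using recur_D[OF U(1), of "of_n a" "of_n b"] by (simp add: of_n_num)
qed

lemma nrec:
  assumes "dfn2 h"
  shows "nrec h a 0 = a" "nrec h a (n + 1) = h n (nrec h a n)"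
proof -
  obtain U where U: "U \<in> D (T0 \<rightarrow> T0 \<rightarrow> T0)" "\<And>i r. ap (ap U (of_n i)) (of_n r) = of_n (h i r)"
    using assms by (auto simp: dfn2_def)
  have rec: "of_n (nrec h a b) = recur U (of_n a) (of_n b)" for b
    by (rule nrec_recur[where h = h, OF U, symmetric])
  have "of_n (nrec h a 0) = of_n a"
    unfolding rec of_n_zero by (rule recur_zero[OF U(1) of_n_D])
  then show "nrec h a 0 = a" by simp
  have "of_n (nrec h a (n + 1)) = ap (ap U (of_n n)) (of_n (nrec h a n))"
    unfolding rec of_n_add of_n_one by (rule recur_succ[OF U(1) of_n_D of_n_D])
  also have "\<dots> = of_n (h n (nrec h a n))" by (rule U(2))
  finally show "nrec h a (n + 1) = h n (nrec h a n)" by simp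
qed

lemma dfn_nrec: "dfn2 h \<Longrightarrow> dfn f \<Longrightarrow> dfn g \<Longrightarrow> dfn (\<lambda>n. nrec h (f n) (g n))"
proof -
  assume "dfn2 h" and fg: "dfn f" "dfn g"
  then obtain U where U: "U \<in> D (T0 \<rightarrow> T0 \<rightarrow> T0)" "\<And>i r. ap (ap U (of_n i)) (of_n r) = of_n (h i r)"
    by (auto simp: dfn2_def)
  have "repn T0 (\<lambda>n. ap (ap (ap (I Rc) U) (of_n (f n))) (of_n (g n)))"
    using fg unfolding dfn_def by (intro repn_app[OF repn_comp[OF ap_D[OF const_D(5) U(1)]]])
  then show ?thesis
    using nrec_recur[where h = h, OF U] by (simp add: dfn_def recur_def)
qed

section \<open>Evaluation rules for numbers, abstraction and recursion\<close>

lemma F_all0: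
  assumes "world V e"
    and "\<And>x n V' e'. extends V e V' e' \<Longrightarrow> T V' e' x T0 (of_n n) \<Longrightarrow> F V' e' (\<phi> x) (P n)"
  shows "F V e (all_fm T0 \<phi>) (\<forall>n. P n)"
proof -
  have "F V e (all_fm T0 \<phi>) (\<forall>v\<in>D T0. P (num v))"
    by (rule F_all[OF assms(1)]) (rule assms(2), assumption, simp add: of_n_num)
  then show ?thesis by (simp add: ball_T0)
qed

lemma F_ex0:
  assumes "world V e"
    and "\<And>x n V' e'. extends V e V' e' \<Longrightarrow> T V' e' x T0 (of_n n) \<Longrightarrow> F V' e' (\<phi> x) (P n)"
  shows "F V e (ex_fm T0 \<phi>) (\<exists>n. P n)"
proof -
  have "F V e (ex_fm T0 \<phi>) (\<exists>v\<in>D T0. P (num v))"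
    by (rule F_ex[OF assms(1)]) (rule assms(2), assumption, simp add: of_n_num)
  then show ?thesis by (simp add: bex_T0)
qed

lemma F_eq0: "T V e s T0 (of_n a) \<Longrightarrow> T V e t T0 (of_n b) \<Longrightarrow> F V e (s \<^bold>= t) (a = b)"
  using F_eq by fastforce

lemma F_less0: "T V e s T0 (of_n a) \<Longrightarrow> T V e t T0 (of_n b) \<Longrightarrow> F V e (s \<^bold>< t) (a < b)"
  using F_less[of V e s "of_n a" t "of_n b"] by (simp add: of_n_less)

lemma F_le0: "T V e s T0 (of_n a) \<Longrightarrow> T V e t T0 (of_n b) \<Longrightarrow> F V e (s \<^bold>\<le> t) (a \<le> b)"
  using F_disj[OF F_less0 F_eq0, of V e s a t b s a t b] by (simp add: le_fm_def le_less)

lemma T_zero0: "T V e \<^bold>0 T0 (of_n 0)" and T_one0: "T V e \<^bold>1 T0 (of_n 1)"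
  using T_const by (simp_all add: of_n_zero of_n_one)

lemma T_plus0: "T V e s T0 (of_n a) \<Longrightarrow> T V e t T0 (of_n b) \<Longrightarrow> T V e (s \<^bold>+ t) T0 (of_n (a + b))"
  using T_plus by (simp add: of_n_add)

lemma T_times0: "T V e s T0 (of_n a) \<Longrightarrow> T V e t T0 (of_n b) \<Longrightarrow> T V e (s \<^bold>* t) T0 (of_n (a * b))"
  using T_times by (simp add: of_n_mult)

lemma T_app0:
  "world V e \<Longrightarrow> T V e s T1 u \<Longrightarrow> T V e t T0 (of_n n) \<Longrightarrow> T V e (s \<cdot> t) T0 (of_n (u \<star> n))"
  using T_app[of V e s T0 T0 u t "of_n n"] T_D[of V e s T1 u] by (simp add: val1)

lemma T_lam0:
  assumes "world V e"
    and "\<And>x n V' e'. extends V e V' e' \<Longrightarrow> T V' e' x T0 (of_n n) \<Longrightarrow> T V' e' (t x) \<tau> (h n)"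
  shows "\<exists>u\<in>D (T0 \<rightarrow> \<tau>). (\<forall>n. ap u (of_n n) = h n) \<and> T V e (lam T0 t) (T0 \<rightarrow> \<tau>) u"
proof -
  have "\<exists>u\<in>D (T0 \<rightarrow> \<tau>). (\<forall>v\<in>D T0. ap u v = h (num v)) \<and> T V e (lam T0 t) (T0 \<rightarrow> \<tau>) u"
    by (rule T_lam[OF assms(1)]) (rule assms(2), assumption, simp add: of_n_num)
  then show ?thesis by (simp add: ball_T0)
qed

lemma T_lam1:
  assumes "world V e"
    and "\<And>x n V' e'. extends V e V' e' \<Longrightarrow> T V' e' x T0 (of_n n) \<Longrightarrow> T V' e' (t x) T0 (of_n (h n))"
  shows "\<exists>u\<in>D T1. (\<forall>n. u \<star> n = h n) \<and> T V e (lam T0 t) T1 u"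
proof -
  have "\<exists>u\<in>D T1. (\<forall>n. ap u (of_n n) = of_n (h n)) \<and> T V e (lam T0 t) T1 u"
    by (rule T_lam0[OF assms(1)]) (rule assms(2))
  then obtain u where "u \<in> D T1" "\<forall>n. ap u (of_n n) = of_n (h n)" "T V e (lam T0 t) T1 u" by blast
  then show ?thesis by (intro bexI[of _ u]) (simp_all add: val1_def)
qed

lemma T_lam2:
  assumes "world V e"
    and body: "\<And>x y a b V' e'. extends V e V' e' \<Longrightarrow> T V' e' x T0 (of_n a) \<Longrightarrow> T V' e' y T0 (of_n b) \<Longrightarrow>
      T V' e' (t x y) T0 (of_n (h a b))"
  shows "\<exists>U\<in>D (T0 \<rightarrow> T0 \<rightarrow> T0). (\<forall>a b. ap (ap U (of_n a)) (of_n b) = of_n (h a b)) \<and>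
    T V e (lam T0 (\<lambda>x. lam T0 (t x))) (T0 \<rightarrow> T0 \<rightarrow> T0) U"
proof -
  \<comment> \<open>The outer abstraction needs the value of the inner one as a function of
    \<open>a\<close> alone. Extensionality makes the inner value unique, so \<open>THE\<close> names
    it independently of the world.\<close>
  define w where "w a = (THE u. u \<in> D T1 \<and> (\<forall>b. ap u (of_n b) = of_n (h a b)))" for a
  have inner: "T V' e' (lam T0 (t x)) T1 (w a) \<and> w a \<in> D T1 \<and> (\<forall>b. ap (w a) (of_n b) = of_n (h a b))"
    if x: "extends V e V' e'" "T V' e' x T0 (of_n a)" for V' e' x a
  proof -
    have "\<exists>u\<in>D T1. (\<forall>b. ap u (of_n b) = of_n (h a b)) \<and> T V' e' (lam T0 (t x)) T1 u"
      by (rule T_lam0[OF extends_world[OF x(1)]])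
        (rule body, erule extends_trans[OF x(1)], erule T_mono[OF x(2)])
    then obtain u where u: "u \<in> D T1" "\<And>b. ap u (of_n b) = of_n (h a b)" "T V' e' (lam T0 (t x)) T1 u"
      by blast
    have "w a = u" unfolding w_def
    proof (rule the_equality)
      fix u' assume u': "u' \<in> D T1 \<and> (\<forall>b. ap u' (of_n b) = of_n (h a b))"
      show "u' = u"
      proof (rule extensional[OF _ u(1)])
        show "u' \<in> D T1" using u' by blast
        show "ap u' v = ap u v" if "v \<in> D T0" for v
          using of_n_cases[OF that] u' u(2) by auto
      qed
    qed (use u in blast)
    then show ?thesis using u by simp
  qed
  have "\<exists>U\<in>D (T0 \<rightarrow> T1). (\<forall>a. ap U (of_n a) = w a) \<and> T V e (lam T0 (\<lambda>x. lam T0 (t x))) (T0 \<rightarrow> T1) U"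
    by (rule T_lam0[OF assms(1)]) (rule conjunct1[OF inner])
  then obtain U where U: "U \<in> D (T0 \<rightarrow> T1)" "\<And>a. ap U (of_n a) = w a"
      "T V e (lam T0 (\<lambda>x. lam T0 (t x))) (T0 \<rightarrow> T1) U"
    by blast
  obtain d where d: "fresh V d" using fresh_exists assms(1) by (auto simp: world_def)
  have "ap (w a) (of_n b) = of_n (h a b)" for a b
    using inner[OF extends_variable(1,2)[OF assms(1) d of_n_D]] by blast
  then show ?thesis using U by (intro bexI[of _ U]) simp_all
qed

text \<open>Serves the definitions by frozen closed terms: the first conclusion gives definability
  of the function, the second evaluates the term in any context.\<close>

lemma T_closed1:
  assumes "\<And>V e x n. world V e \<Longrightarrow> T V e x T0 (of_n n) \<Longrightarrow> T V e (t x) T0 (of_n (h n))"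
  shows "dfn h" "T V e s T0 (of_n n) \<Longrightarrow> T V e (cst (lam T0 t 0) \<cdot> s) T0 (of_n (h n))"
proof -
  obtain e0 where e0: "world {} e0" using ex_valid by (auto simp: world_def)
  obtain u where u: "u \<in> D T1" "\<And>n. u \<star> n = h n" "T {} e0 (lam T0 t) T1 u"
  proof -
    have "\<exists>u\<in>D T1. (\<forall>n. u \<star> n = h n) \<and> T {} e0 (lam T0 t) T1 u"
      by (rule T_lam1[OF e0]) (rule assms[OF extends_world])
    then show thesis using that by blast
  qed
  show "dfn h" using dfn_val1[OF u(1)] by (simp add: u(2))
  show "T V e s T0 (of_n n) \<Longrightarrow> T V e (cst (lam T0 t 0) \<cdot> s) T0 (of_n (h n))"
    using T_app[OF T_closed[OF u(3)], of V e s "of_n n"] by (simp add: val1[OF u(1)] u(2))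
qed

lemma T_closed2:
  assumes "\<And>V e x y a b. world V e \<Longrightarrow> T V e x T0 (of_n a) \<Longrightarrow> T V e y T0 (of_n b) \<Longrightarrow>
    T V e (t x y) T0 (of_n (h a b))"
  shows "dfn2 h" "T V e s T0 (of_n a) \<Longrightarrow> T V e r T0 (of_n b) \<Longrightarrow>
    T V e (cst (lam T0 (\<lambda>x. lam T0 (t x)) 0) \<cdot> s \<cdot> r) T0 (of_n (h a b))"
proof -
  obtain e0 where e0: "world {} e0" using ex_valid by (auto simp: world_def)
  obtain U where U: "U \<in> D (T0 \<rightarrow> T0 \<rightarrow> T0)" "\<And>a b. ap (ap U (of_n a)) (of_n b) = of_n (h a b)"
      "T {} e0 (lam T0 (\<lambda>x. lam T0 (t x))) (T0 \<rightarrow> T0 \<rightarrow> T0) U"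
  proof -
    have "\<exists>U\<in>D (T0 \<rightarrow> T0 \<rightarrow> T0). (\<forall>a b. ap (ap U (of_n a)) (of_n b) = of_n (h a b)) \<and>
        T {} e0 (lam T0 (\<lambda>x. lam T0 (t x))) (T0 \<rightarrow> T0 \<rightarrow> T0) U"
      by (rule T_lam2[OF e0]) (rule assms[OF extends_world])
    then show thesis using that by blast
  qed
  show "dfn2 h" using U by (auto simp: dfn2_def)
  show "T V e s T0 (of_n a) \<Longrightarrow> T V e r T0 (of_n b) \<Longrightarrow>
      T V e (cst (lam T0 (\<lambda>x. lam T0 (t x)) 0) \<cdot> s \<cdot> r) T0 (of_n (h a b))"
    using T_app[OF T_app[OF T_closed[OF U(3)]], of V e s "of_n a" r "of_n b"] by (simp add: U(2))
qed

lemma T_primrec: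
  assumes "world V e"
    and body: "\<And>x y i r V' e'. extends V e V' e' \<Longrightarrow> T V' e' x T0 (of_n i) \<Longrightarrow> T V' e' y T0 (of_n r) \<Longrightarrow>
      T V' e' (f x y) T0 (of_n (h i r))"
    and m: "T V e m T0 (of_n a)" and n: "T V e n T0 (of_n b)"
  shows "T V e (primrec_tm f m n) T0 (of_n (nrec h a b))" "dfn2 h"
proof -
  have "\<exists>U\<in>D (T0 \<rightarrow> T0 \<rightarrow> T0). (\<forall>a b. ap (ap U (of_n a)) (of_n b) = of_n (h a b)) \<and>
      T V e (lam T0 (\<lambda>x. lam T0 (f x))) (T0 \<rightarrow> T0 \<rightarrow> T0) U"
    by (rule T_lam2[OF assms(1)]) (rule body)
  then obtain U where U: "U \<in> D (T0 \<rightarrow> T0 \<rightarrow> T0)" "\<And>a b. ap (ap U (of_n a)) (of_n b) = of_n (h a b)"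
      "T V e (lam T0 (\<lambda>x. lam T0 (f x))) (T0 \<rightarrow> T0 \<rightarrow> T0) U"
    by blast
  show "dfn2 h" using U by (auto simp: dfn2_def)
  have "T V e (primrec_tm f m n) T0 (recur U (of_n a) (of_n b))"
    unfolding primrec_tm_def recur_def by (rule T_app[OF T_app[OF T_app[OF T_const(7) U(3)] m] n])
  then show "T V e (primrec_tm f m n) T0 (of_n (nrec h a b))"
    by (simp add: nrec_recur[where h = h, OF U(1,2)])
qed

end

section \<open>The ordered field generated by an ordered semidomain\<close>

text \<open>The usual construction of the integers: a pair stands for the difference of its
  components, compared without subtracting.\<close>

definition diff_rel :: "'a::linordered_semidom \<times> 'a \<Rightarrow> 'a \<times> 'a \<Rightarrow> bool" where
  "diff_rel p q \<longleftrightarrow> fst p + snd q = fst q + snd p"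

lemma diff_rel_trans:
  assumes "diff_rel p q" "diff_rel q r"
  shows "diff_rel p r"
proof -
  have "fst p + snd r + snd q = fst r + snd p + snd q"
    using assms unfolding diff_rel_def by (metis add.assoc add.commute)
  then show ?thesis by (simp add: diff_rel_def)
qed

quotient_type (overloaded) 'a differences = "'a::linordered_semidom \<times> 'a" / diff_rel
  morphisms rep_diff diff_class
proof (rule equivpI)
  show "reflp diff_rel" by (rule reflpI) (simp add: diff_rel_def)
  show "symp diff_rel" by (rule sympI) (simp add: diff_rel_def)
  show "transp diff_rel" by (rule transpI) (rule diff_rel_trans)
qed

instantiation differences :: (linordered_semidom) comm_ring_1
begin

lift_definition zero_differences :: "'a differences" is "(0, 0)" .

lift_definition one_differences :: "'a differences" is "(1, 0)" .

lift_definition plus_differences :: "'a differences \<Rightarrow> 'a differences \<Rightarrow> 'a differences"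
  is "\<lambda>p q. (fst p + fst q, snd p + snd q)"
proof -
  fix p q r s :: "'a \<times> 'a"
  assume "diff_rel p q" "diff_rel r s"
  then have "(fst p + snd q) + (fst r + snd s) = (fst q + snd p) + (fst s + snd r)"
    by (simp add: diff_rel_def)
  then show "diff_rel (fst p + fst r, snd p + snd r) (fst q + fst s, snd q + snd s)"
    by (simp add: diff_rel_def ac_simps)
qed

lift_definition uminus_differences :: "'a differences \<Rightarrow> 'a differences"
  is "\<lambda>p. (snd p, fst p)"
  by (simp add: diff_rel_def ac_simps)

definition minus_differences :: "'a differences \<Rightarrow> 'a differences \<Rightarrow> 'a differences" where
  "minus_differences a b = a + - b"

lift_definition times_differences :: "'a differences \<Rightarrow> 'a differences \<Rightarrow> 'a differences"
  is "\<lambda>p q. (fst p * fst q + snd p * snd q, fst p * snd q + snd p * fst q)"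
proof -
  \<comment> \<open>It suffices to vary one factor; commutativity and transitivity handle the
    other.\<close>
  have step: "diff_rel (fst p * fst r + snd p * snd r, fst p * snd r + snd p * fst r)
      (fst q * fst r + snd q * snd r, fst q * snd r + snd q * fst r)"
    if "diff_rel p q" for p q r :: "'a \<times> 'a"
  proof -
    have "(fst p + snd q) * fst r + (fst q + snd p) * snd r = (fst q + snd p) * fst r + (fst p + snd q) * snd r"
      using that by (simp add: diff_rel_def)
    then show ?thesis by (simp add: diff_rel_def algebra_simps)
  qed
  fix p q r s :: "'a \<times> 'a"
  assume "diff_rel p q" and rs: "diff_rel r s"
  then have "diff_rel (fst p * fst r + snd p * snd r, fst p * snd r + snd p * fst r)
      (fst q * fst r + snd q * snd r, fst q * snd r + snd q * fst r)" by (intro step)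
  moreover have "diff_rel (fst q * fst r + snd q * snd r, fst q * snd r + snd q * fst r)
      (fst q * fst s + snd q * snd s, fst q * snd s + snd q * fst s)"
    using step[OF rs, of q] by (simp add: ac_simps)
  ultimately show "diff_rel (fst p * fst r + snd p * snd r, fst p * snd r + snd p * fst r)
      (fst q * fst s + snd q * snd s, fst q * snd s + snd q * fst s)" by (rule diff_rel_trans)
qed

instance
proof
  fix a b c :: "'a differences"
  show "a + b = b + a" by transfer (simp add: diff_rel_def ac_simps)
  show "a + b + c = a + (b + c)" by transfer (simp add: diff_rel_def ac_simps)
  show "0 + a = a" by transfer (simp add: diff_rel_def)
  show "- a + a = 0" by transfer (simp add: diff_rel_def ac_simps)
  show "a - b = a + - b" by (simp add: minus_differences_def)
  show "a * b * c = a * (b * c)" by transfer (simp add: diff_rel_def algebra_simps)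
  show "a * b = b * a" by transfer (simp add: diff_rel_def ac_simps)
  show "1 * a = a" by transfer (simp add: diff_rel_def)
  show "(a + b) * c = a * c + b * c" by transfer (simp add: diff_rel_def algebra_simps)
  show "(0 :: 'a differences) \<noteq> 1" by transfer (simp add: diff_rel_def)
qed

end

instantiation differences :: (linordered_semidom) linordered_idom
begin

lift_definition less_eq_differences :: "'a differences \<Rightarrow> 'a differences \<Rightarrow> bool"
  is "\<lambda>p q. fst p + snd q \<le> fst q + snd p"
proof -
  fix p q r s :: "'a \<times> 'a"
  assume "diff_rel p q" "diff_rel r s"
  then have pq: "fst p + snd q = fst q + snd p" and rs: "fst r + snd s = fst s + snd r"
    by (simp_all add: diff_rel_def)
  have "fst p + snd r \<le> fst r + snd p \<longleftrightarrow>
      fst p + snd r + (snd q + snd s) \<le> fst r + snd p + (snd q + snd s)" by simp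
  also have "fst p + snd r + (snd q + snd s) = fst q + snd s + (snd p + snd r)"
    using pq by (metis add.assoc add.commute)
  also have "fst r + snd p + (snd q + snd s) = fst s + snd q + (snd p + snd r)"
    using rs by (metis add.assoc add.commute)
  finally show "fst p + snd r \<le> fst r + snd p \<longleftrightarrow> fst q + snd s \<le> fst s + snd q" by simp
qed

definition less_differences :: "'a differences \<Rightarrow> 'a differences \<Rightarrow> bool" where
  "less_differences a b \<longleftrightarrow> a \<le> b \<and> \<not> b \<le> a"

definition abs_differences :: "'a differences \<Rightarrow> 'a differences" where
  "abs_differences a = (if a < 0 then - a else a)"

definition sgn_differences :: "'a differences \<Rightarrow> 'a differences" where
  "sgn_differences a = (if a = 0 then 0 else if 0 < a then 1 else - 1)"

lemma differences_le_trans: "a \<le> b \<Longrightarrow> b \<le> c \<Longrightarrow> a \<le> (c :: 'a differences)"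
proof transfer
  fix p q r :: "'a \<times> 'a"
  assume "fst p + snd q \<le> fst q + snd p" "fst q + snd r \<le> fst r + snd q"
  then have "(fst p + snd q) + (fst q + snd r) \<le> (fst q + snd p) + (fst r + snd q)" by (rule add_mono)
  then have "(fst p + snd r) + (fst q + snd q) \<le> (fst r + snd p) + (fst q + snd q)" by (simp add: ac_simps)
  then show "fst p + snd r \<le> fst r + snd p" by simp
qed

text \<open>A positive difference already exists in the semiring. Writing
  \<open>fst p = x + snd p\<close> and \<open>fst q = y + snd q\<close> reduces the claim to
  positivity of \<open>x * y\<close> there.\<close>

lemma differences_mult_pos: "0 < a \<Longrightarrow> 0 < b \<Longrightarrow> 0 < a * (b :: 'a differences)"
  unfolding less_differences_def
proof transfer
  fix p q :: "'a \<times> 'a"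
  assume "fst (0, 0) + snd p \<le> fst p + snd (0, 0) \<and> \<not> fst p + snd (0, 0) \<le> fst (0, 0) + snd p"
    and "fst (0, 0) + snd q \<le> fst q + snd (0, 0) \<and> \<not> fst q + snd (0, 0) \<le> fst (0, 0) + snd q"
  then have p: "snd p < fst p" and q: "snd q < fst q" by auto
  define x y where "x = fst p - snd p" and "y = fst q - snd q"
  have x: "fst p = x + snd p" and y: "fst q = y + snd q"
    using p q by (simp_all add: x_def y_def less_imp_le)
  have "0 + snd p < x + snd p" "0 + snd q < y + snd q" using p q x y by simp_all
  then have xy: "0 < x" "0 < y" by (simp_all only: add_less_cancel_right)
  have "fst p * fst q + snd p * snd q = x * y + (fst p * snd q + snd p * fst q)"
    by (simp add: x y algebra_simps)
  moreover have "0 < x * y" using xy by simp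
  ultimately show "fst (0, 0) + snd (fst p * fst q + snd p * snd q, fst p * snd q + snd p * fst q)
      \<le> fst (fst p * fst q + snd p * snd q, fst p * snd q + snd p * fst q) + snd (0, 0) \<and>
    \<not> fst (fst p * fst q + snd p * snd q, fst p * snd q + snd p * fst q) + snd (0, 0)
      \<le> fst (0, 0) + snd (fst p * fst q + snd p * snd q, fst p * snd q + snd p * fst q)"
    using \<open>0 < x * y\<close> by (simp add: less_imp_le not_le)
qed

instance
proof
  fix a b c :: "'a differences"
  show "a < b \<longleftrightarrow> a \<le> b \<and> \<not> b \<le> a" by (simp add: less_differences_def)
  show "a \<le> a" by transfer simp
  show "a \<le> b \<Longrightarrow> b \<le> c \<Longrightarrow> a \<le> c" by (rule differences_le_trans)
  show "a \<le> b \<Longrightarrow> b \<le> a \<Longrightarrow> a = b" by transfer (simp add: diff_rel_def)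
  show "a \<le> b \<or> b \<le> a" by transfer (simp add: linear)
  show mono: "a \<le> b \<Longrightarrow> c + a \<le> c + b" for a b c :: "'a differences"
  proof transfer
    fix p q r :: "'a \<times> 'a"
    assume "fst p + snd q \<le> fst q + snd p"
    then have "(fst p + snd q) + (fst r + snd r) \<le> (fst q + snd p) + (fst r + snd r)" by simp
    then show "fst (fst r + fst p, snd r + snd p) + snd (fst r + fst q, snd r + snd q)
        \<le> fst (fst r + fst q, snd r + snd q) + snd (fst r + fst p, snd r + snd p)"
      by (simp add: ac_simps)
  qed
  show "\<bar>a\<bar> = (if a < 0 then - a else a)" by (simp add: abs_differences_def)
  show "sgn a = (if a = 0 then 0 else if 0 < a then 1 else - 1)" by (simp add: sgn_differences_def)
  show "c * a < c * b" if "a < b" "0 < c"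
  proof -
    \<comment> \<open>Once both orders are expressed through differences, strict monotonicity of
      multiplication is positivity of the product \<open>c * (b - a)\<close>.\<close>
    have le_iff: "x \<le> y \<longleftrightarrow> 0 \<le> y - x" for x y :: "'a differences"
      using mono[of x y "- x"] mono[of 0 "y - x" x] by auto
    have "y \<le> x \<longleftrightarrow> y - x \<le> 0" for x y :: "'a differences"
      using mono[of y x "- x"] mono[of "y - x" 0 x] by auto
    then have less_iff: "x < y \<longleftrightarrow> 0 < y - x" for x y :: "'a differences"
      using le_iff by (simp add: less_differences_def)
    have "0 < c * (b - a)" using that less_iff[of a b] differences_mult_pos by blast
    then show ?thesis using less_iff[of "c * a" "c * b"] by (simp add: right_diff_distrib)
  qed
qed

end

lift_definition difference :: "'a::linordered_semidom \<Rightarrow> 'a differences" is "\<lambda>a. (a, 0)" .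

lemma difference_simps:
  "difference 0 = 0" "difference 1 = 1" "difference (a + b) = difference a + difference b"
  "difference (a * b) = difference a * difference b"
  by (transfer; simp add: diff_rel_def)+

lemma difference_le_iff: "difference a \<le> difference b \<longleftrightarrow> a \<le> b"
  by transfer simp

lemma difference_cases: "\<exists>a b. x = difference a - difference b"
proof -
  have "\<exists>a b. x = difference a + - difference b"
  proof transfer
    fix p :: "'a \<times> 'a"
    have "diff_rel p (fst (fst p, 0) + fst (snd (snd p, 0), fst (snd p, 0)), snd (fst p, 0) + snd (snd (snd p, 0), fst (snd p, 0)))"
      by (simp add: diff_rel_def)
    then show "\<exists>a b. diff_rel p (fst (a, 0) + fst (snd (b, 0), fst (b, 0)), snd (a, 0) + snd (snd (b, 0), fst (b, 0)))"
      by blast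
  qed
  then show ?thesis by simp
qed

definition frac_of :: "'a::linordered_semidom \<Rightarrow> 'a differences fract" where
  "frac_of a = Fract (difference a) 1"

lemma frac_of_simps [simp]:
  "frac_of 0 = 0" "frac_of 1 = 1" "frac_of (a + b) = frac_of a + frac_of b" "frac_of (a * b) = frac_of a * frac_of b"
  by (simp_all add: frac_of_def difference_simps Zero_fract_def One_fract_def)

lemma frac_of_le_iff [simp]: "frac_of a \<le> frac_of b \<longleftrightarrow> a \<le> b"
  by (simp add: frac_of_def le_fract difference_le_iff)

lemma frac_of_less_iff [simp]: "frac_of a < frac_of b \<longleftrightarrow> a < b"
  using frac_of_le_iff[of b a] by (simp add: less_le_not_le)

lemma frac_of_eq_iff [simp]: "frac_of a = frac_of b \<longleftrightarrow> a = b"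
  by (simp add: order_eq_iff)

text \<open>Once its sign is made positive, the denominator is a difference that exists in the
  semiring. This brings every field element into the shape of the rational codes.\<close>

lemma fract_cases: "\<exists>a b d. d \<noteq> 0 \<and> x = (frac_of a - frac_of b) / frac_of d"
proof -
  have "\<exists>p q. 0 < q \<and> x = Fract p q"
  proof (cases x)
    case (Fract p q)
    then have "0 < q \<or> 0 < - q \<and> x = Fract (- p) (- q)" by auto
    then show ?thesis using Fract(1) by blast
  qed
  then obtain p q where x: "0 < q" "x = Fract p q" by blast
  obtain a b where p: "p = difference a - difference b" using difference_cases by blast
  obtain c d where q: "q = difference c - difference d" using difference_cases by blast
  have "\<not> c \<le> d" using x(1) difference_le_iff[of c d] by (simp add: q)
  then have "difference (c - d + d) = difference c" by simp
  then have d: "q = difference (c - d)" using q by (simp add: difference_simps algebra_simps)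
  then have "c - d \<noteq> 0" using x(1) d difference_simps(1) by (metis less_irrefl)
  moreover have "x = Fract p 1 / Fract q 1" using x by simp
  moreover have "Fract p 1 = frac_of a - frac_of b" by (simp add: frac_of_def p)
  ultimately have "c - d \<noteq> 0 \<and> x = (frac_of a - frac_of b) / frac_of (c - d)"
    using d by (simp add: frac_of_def)
  then show ?thesis by blast
qed

context arithmetic_model
begin

section \<open>Primitive recursive arithmetic and Cantor pairing\<close>

definition predN :: "'n \<Rightarrow> 'n" where "predN n = nrec (\<lambda>i r. i) 0 n"
definition monusN :: "'n \<Rightarrow> 'n \<Rightarrow> 'n" where "monusN m n = nrec (\<lambda>i r. predN r) m n"
definition pow2N :: "'n \<Rightarrow> 'n" where "pow2N n = nrec (\<lambda>i r. r + r) 1 n"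
definition triN :: "'n \<Rightarrow> 'n" where "triN n = nrec (\<lambda>i r. r + (i + 1)) 0 n"
definition pairN :: "'n \<Rightarrow> 'n \<Rightarrow> 'n" where "pairN a b = triN (a + b) + b"
definition diagN :: "'n \<Rightarrow> 'n" where
  "diagN k = nrec (\<lambda>i r. r + monusN 1 (monusN (triN (r + 1)) (i + 1))) 0 k"
definition sndN :: "'n \<Rightarrow> 'n" where "sndN k = monusN k (triN (diagN k))"
definition fstN :: "'n \<Rightarrow> 'n" where "fstN k = monusN (diagN k) (sndN k)"

lemma T_pred: "world V e \<Longrightarrow> T V e n T0 (of_n b) \<Longrightarrow> T V e (pred_tm n) T0 (of_n (predN b))"
  unfolding pred_tm_def predN_def by (rule T_primrec(1)) (assumption | rule T_zero0)+

lemma T_monus: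
  "world V e \<Longrightarrow> T V e m T0 (of_n a) \<Longrightarrow> T V e n T0 (of_n b) \<Longrightarrow> T V e (m \<^bold>- n) T0 (of_n (monusN a b))"
  unfolding monus_tm_def monusN_def
  by (rule T_primrec(1)) (assumption | rule T_pred | erule extends_world)+

lemma T_pow2: "world V e \<Longrightarrow> T V e n T0 (of_n b) \<Longrightarrow> T V e (pow2 n) T0 (of_n (pow2N b))"
  unfolding pow2_def pow2N_def by (rule T_primrec(1)) (assumption | rule T_one0 T_plus0)+

lemma T_tri: "world V e \<Longrightarrow> T V e n T0 (of_n b) \<Longrightarrow> T V e (tri n) T0 (of_n (triN b))"
  unfolding tri_def triN_def by (rule T_primrec(1)) (assumption | rule T_zero0 T_one0 T_plus0)+

lemma T_pair:
  "T V e s T0 (of_n a) \<Longrightarrow> T V e t T0 (of_n b) \<Longrightarrow> T V e (pair s t) T0 (of_n (pairN a b))"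
  unfolding pair_def
  by (rule T_closed2(2)[where h = pairN])
    (unfold pairN_def, (assumption | rule T_plus0 T_tri)+)

lemma dfn2_pair: "dfn2 pairN"
  by (rule T_closed2(1)[where t = "\<lambda>a b. tri (a \<^bold>+ b) \<^bold>+ b"])
    (unfold pairN_def, (assumption | rule T_plus0 T_tri)+)

lemma T_diag: "T V e s T0 (of_n a) \<Longrightarrow> T V e (diag s) T0 (of_n (diagN a))"
  unfolding diag_def
  by (rule T_closed1(2)[where h = diagN])
    (unfold diagN_def, (assumption | rule T_primrec(1) T_zero0 T_one0 T_plus0 T_monus T_tri | erule extends_world)+)

lemma T_second: "T V e s T0 (of_n a) \<Longrightarrow> T V e (second s) T0 (of_n (sndN a))"
  unfolding second_def
  by (rule T_closed1(2)[where h = sndN])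
    (unfold sndN_def, (assumption | rule T_monus T_tri T_diag)+)

lemma T_first: "T V e s T0 (of_n a) \<Longrightarrow> T V e (first s) T0 (of_n (fstN a))"
  unfolding first_def
  by (rule T_closed1(2)[where h = fstN])
    (unfold fstN_def, (assumption | rule T_monus T_diag T_second)+)

lemma dfn2_steps:
  "dfn2 (\<lambda>i r. i)" "dfn2 (\<lambda>i r. predN r)" "dfn2 (\<lambda>i r. r + r)" "dfn2 (\<lambda>i r. r + (i + 1))"
  "dfn2 (\<lambda>i r. r + monusN 1 (monusN (triN (r + 1)) (i + 1)))" "dfn2 monusN"
proof -
  show "dfn2 (\<lambda>i r. i)" by (rule T_closed2(1)[where t = "\<lambda>x y. x"])
  show "dfn2 (\<lambda>i r. predN r)" by (rule T_closed2(1)[where t = "\<lambda>x y. pred_tm y"]) (rule T_pred)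
  show "dfn2 (\<lambda>i r. r + r)"
    by (rule T_closed2(1)[where t = "\<lambda>x y. y \<^bold>+ y"]) (rule T_plus0)
  show "dfn2 (\<lambda>i r. r + (i + 1))"
    by (rule T_closed2(1)[where t = "\<lambda>x y. y \<^bold>+ (x \<^bold>+ \<^bold>1)"]) (assumption | rule T_plus0 T_one0)+
  show "dfn2 (\<lambda>i r. r + monusN 1 (monusN (triN (r + 1)) (i + 1)))"
    by (rule T_closed2(1)[where t = "\<lambda>i r. r \<^bold>+ (\<^bold>1 \<^bold>- (tri (r \<^bold>+ \<^bold>1) \<^bold>- (i \<^bold>+ \<^bold>1)))"])
      (assumption | rule T_plus0 T_one0 T_monus T_tri)+
  show "dfn2 monusN" by (rule T_closed2(1)[where t = "\<lambda>m n. m \<^bold>- n"]) (rule T_monus)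
qed

lemma pow2N: "pow2N 0 = 1" "pow2N (n + 1) = pow2N n + pow2N n"
  unfolding pow2N_def using nrec[OF dfn2_steps(3), of 1] by simp_all

lemma triN: "triN 0 = 0" "triN (n + 1) = triN n + (n + 1)"
  unfolding triN_def using nrec[OF dfn2_steps(4), of 0] by simp_all

lemma predN: "predN 0 = 0" "predN (n + 1) = n"
  unfolding predN_def using nrec[OF dfn2_steps(1), of 0] by simp_all

lemma monusN: "monusN m 0 = m" "monusN m (n + 1) = predN (monusN m n)"
  unfolding monusN_def using nrec[OF dfn2_steps(2), of m] by simp_all

lemma diagN:
  "diagN 0 = 0" "diagN (k + 1) = diagN k + monusN 1 (monusN (triN (diagN k + 1)) (k + 1))"
  unfolding diagN_def using nrec[OF dfn2_steps(5), of 0] by simp_all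

lemma nonzero_cases: "(n :: 'n) \<noteq> 0 \<Longrightarrow> \<exists>m. n = m + 1"
proof -
  assume "n \<noteq> 0"
  then have "of_n n \<noteq> z" using of_n_eq[of n 0] by (simp add: of_n_zero)
  then have "of_n n = pd (of_n n) \<oplus> one" using zero_or_succ[OF of_n_D] by blast
  moreover obtain m where "pd (of_n n) = of_n m" using of_n_cases[OF pd(3)[OF of_n_D]] by blast
  ultimately have "of_n n = of_n (m + 1)" by (metis of_n_add of_n_one)
  then show ?thesis by auto
qed

lemma less_succN: "(a :: 'n) < b + 1 \<longleftrightarrow> a \<le> b"
  using less_succ[of "of_n a" "of_n b"] of_n_less[of a "b + 1"] of_n_less[of a b]
  by (simp add: of_n_add of_n_one le_less)

lemma succ_leN: "(a :: 'n) + 1 \<le> b \<longleftrightarrow> a < b"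
  by (simp add: not_less[symmetric] less_succN)

lemma zero_leN [simp]: "0 \<le> (a :: 'n)"
  using less_add_succ[OF const_D(1) of_n_D, of a] less_succN[of 0 a]
  by (simp add: of_n_less of_n_zero[symmetric] of_n_one[symmetric] of_n_add[symmetric])

text \<open>All inductions from here on rest on this one; the four definable functions enter as
  values of variables of type 1. The guard serves bounded statements about \<open>monusN\<close>, at
  a stage where inequalities have no characteristic functions yet.\<close>

lemma induct_less_eq:
  assumes "dfn fa" "dfn ga" "dfn fb" "dfn gb"
    and zero: "fa 0 < ga 0 \<longrightarrow> fb 0 = gb 0"
    and step: "\<And>n. fa n < ga n \<longrightarrow> fb n = gb n \<Longrightarrow> fa (n + 1) < ga (n + 1) \<longrightarrow> fb (n + 1) = gb (n + 1)"
  shows "fa n < ga n \<longrightarrow> fb n = gb n"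
proof -
  from assms(1) obtain u1 where u1: "u1 \<in> D T1" "\<And>n. u1 \<star> n = fa n" by (rule dfn_obtain) blast
  from assms(2) obtain w1 where w1: "w1 \<in> D T1" "\<And>n. w1 \<star> n = ga n" by (rule dfn_obtain) blast
  from assms(3) obtain u2 where u2: "u2 \<in> D T1" "\<And>n. u2 \<star> n = fb n" by (rule dfn_obtain) blast
  from assms(4) obtain w2 where w2: "w2 \<in> D T1" "\<And>n. w2 \<star> n = gb n" by (rule dfn_obtain) blast
  obtain e0 where e0: "valid e0" using ex_valid by blast
  define e where "e = e0((1, T1) := u1, (2, T1) := w1, (3, T1) := u2, (4, T1) := w2)"
  have e: "valid e" unfolding e_def by (intro valid_upd e0 u1 w1 u2 w2)
  let ?x = "Var 0 T0"
  define B where "B = Imp (Less (App (Var 1 T1) ?x) (App (Var 2 T1) ?x)) (Eq (App (Var 3 T1) ?x) (App (Var 4 T1) ?x))"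
  have sat: "sat (e((0, T0) := of_n k)) B \<longleftrightarrow> (fa k < ga k \<longrightarrow> fb k = gb k)" for k
    by (simp add: B_def e_def val1 u1 w1 u2 w2 of_n_less)
  have "sat (e((0, T0) := of_n n)) B"
  proof (rule induct_sat[OF _ _ _ e])
    show "wff B" "quantifier_free B" "pars B = {}" by (simp_all add: B_def)
    show "sat (e((0, T0) := z)) B" using sat[of 0] zero by (simp only: of_n_zero)
    fix v assume v: "v \<in> D T0" "sat (e((0, T0) := v)) B"
    obtain k where k: "v = of_n k" using of_n_cases[OF v(1)] by blast
    then have "fa k < ga k \<longrightarrow> fb k = gb k" using v(2) sat by blast
    then have "sat (e((0, T0) := of_n (k + 1))) B" unfolding sat by (rule step)
    then show "sat (e((0, T0) := v \<oplus> one)) B" by (simp only: k of_n_add of_n_one)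
  qed (rule of_n_D)
  then show ?thesis by (simp only: sat)
qed

lemma induct_eq:
  assumes "dfn f" "dfn g" "f 0 = g 0" "\<And>n. f n = g n \<Longrightarrow> f (n + 1) = g (n + 1)"
  shows "f n = g n"
  using induct_less_eq[OF dfn_const[of 0] dfn_const[of 1] assms(1,2), of n] assms(3,4) by simp

lemmas dfn_plus = dfn_bin[OF dfn2_plus]
lemmas dfn_times = dfn_bin[OF dfn2_times]
lemmas dfn_monus = dfn_bin[OF dfn2_steps(6)]
lemmas dfn_pair = dfn_bin[OF dfn2_pair]

lemma dfn_pow2: "dfn f \<Longrightarrow> dfn (\<lambda>n. pow2N (f n))"
  unfolding pow2N_def by (rule dfn_nrec[OF dfn2_steps(3) dfn_const])

lemma dfn_tri: "dfn f \<Longrightarrow> dfn (\<lambda>n. triN (f n))"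
  unfolding triN_def by (rule dfn_nrec[OF dfn2_steps(4) dfn_const])

lemma dfn_diag: "dfn f \<Longrightarrow> dfn (\<lambda>n. diagN (f n))"
  unfolding diagN_def by (rule dfn_nrec[OF dfn2_steps(5) dfn_const])

lemma dfn_snd: "dfn f \<Longrightarrow> dfn (\<lambda>n. sndN (f n))"
  unfolding sndN_def by (intro dfn_monus dfn_tri dfn_diag)

lemma dfn_fst: "dfn f \<Longrightarrow> dfn (\<lambda>n. fstN (f n))"
  unfolding fstN_def by (intro dfn_monus dfn_snd dfn_diag)

lemma add_monusN: "n \<le> m \<Longrightarrow> n + monusN m n = m"
proof -
  have "n < m + 1 \<longrightarrow> n + monusN m n = m"
  proof (rule induct_less_eq[where n = n and fa = "\<lambda>n. n" and ga = "\<lambda>n. m + 1"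
        and fb = "\<lambda>n. n + monusN m n" and gb = "\<lambda>n. m"])
    show "dfn (\<lambda>n. n)" "dfn (\<lambda>n. m + 1)" "dfn (\<lambda>n. n + monusN m n)" "dfn (\<lambda>n. m)"
      by (intro dfn_id dfn_const dfn_plus dfn_monus)+
    show "0 < m + 1 \<longrightarrow> 0 + monusN m 0 = m" by (simp add: monusN)
    fix n assume IH: "n < m + 1 \<longrightarrow> n + monusN m n = m"
    show "n + 1 < m + 1 \<longrightarrow> n + 1 + monusN m (n + 1) = m"
    proof
      assume "n + 1 < m + 1"
      then have n: "n < m" by simp
      then have eq: "n + monusN m n = m" using IH less_succN by (simp add: less_imp_le)
      then have "monusN m n \<noteq> 0" using n by auto
      then obtain c where c: "monusN m n = c + 1" using nonzero_cases by blast
      then have "monusN m (n + 1) = c" by (simp only: monusN predN)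
      moreover have "n + 1 + c = m" using eq c by (simp add: ac_simps)
      ultimately show "n + 1 + monusN m (n + 1) = m" by (simp only:)
    qed
  qed
  then show "n \<le> m \<Longrightarrow> n + monusN m n = m" by (simp add: less_succN)
qed

text \<open>Turns the order into an equation with zero, the form in which predicates are decided
  below.\<close>

lemma monusN_zero_iff: "monusN m n = 0 \<longleftrightarrow> m \<le> n"
proof
  assume "monusN m n = 0"
  then show "m \<le> n" using add_monusN[of n m] by (cases "n \<le> m") auto
next
  assume "m \<le> n"
  then have "n = m + monusN n m" by (simp add: add_monusN)
  then obtain k where n: "n = m + k" by blast
  have "monusN m (m + k) = 0"
  proof (rule induct_eq[where n = k and f = "\<lambda>k. monusN m (m + k)" and g = "\<lambda>k. 0"])
    show "dfn (\<lambda>k. monusN m (m + k))" "dfn (\<lambda>k. 0)" by (intro dfn_id dfn_const dfn_plus dfn_monus)+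
    show "monusN m (m + 0) = 0" using add_monusN[of m m] by simp
    show "monusN m (m + n) = 0 \<Longrightarrow> monusN m (m + (n + 1)) = 0" for n
      by (simp add: add.assoc[symmetric] monusN predN)
  qed
  then show "monusN m n = 0" by (simp add: n)
qed

lemma monusN_add [simp]: "monusN (n + k) n = k" "monusN (k + n) n = k"
proof -
  show "monusN (n + k) n = k" using add_monusN[of n "n + k"] by simp
  then show "monusN (k + n) n = k" by (simp add: add.commute)
qed

section \<open>Decidable predicates and induction on them\<close>

definition decd :: "('n \<Rightarrow> bool) \<Rightarrow> bool" where
  "decd P \<longleftrightarrow> (\<exists>h. dfn h \<and> (\<forall>n. P n \<longleftrightarrow> h n = 0))"

lemma decdI: "dfn h \<Longrightarrow> (\<And>n. P n \<longleftrightarrow> h n = 0) \<Longrightarrow> decd P"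
  by (auto simp: decd_def)

lemma decd_le: "dfn f \<Longrightarrow> dfn g \<Longrightarrow> decd (\<lambda>n. f n \<le> g n)"
  by (rule decdI[OF dfn_monus]) (auto simp: monusN_zero_iff)

lemma decd_less: "dfn f \<Longrightarrow> dfn g \<Longrightarrow> decd (\<lambda>n. f n < g n)"
  using decd_le[OF dfn_plus[OF _ dfn_const[of 1]], of f g] by (simp add: succ_leN)

lemma decd_not: "decd P \<Longrightarrow> decd (\<lambda>n. \<not> P n)"
proof -
  assume "decd P"
  then obtain h where h: "dfn h" "\<And>n. P n \<longleftrightarrow> h n = 0" by (auto simp: decd_def)
  have "\<not> P n \<longleftrightarrow> 1 \<le> h n" for n using succ_leN[of 0 "h n"] zero_leN[of "h n"] by (auto simp: h(2) less_le)
  then show ?thesis using decd_le[OF dfn_const[of 1] h(1)] by simp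
qed

lemma decd_conj: "decd P \<Longrightarrow> decd Q \<Longrightarrow> decd (\<lambda>n. P n \<and> Q n)"
proof -
  assume "decd P" "decd Q"
  then obtain h k where h: "dfn h" "\<And>n. P n \<longleftrightarrow> h n = 0" and k: "dfn k" "\<And>n. Q n \<longleftrightarrow> k n = 0"
    by (auto simp: decd_def)
  show ?thesis
    by (rule decdI[OF dfn_plus[OF h(1) k(1)]]) (simp add: h(2) k(2) add_nonneg_eq_0_iff)
qed

lemma decd_imp: "decd P \<Longrightarrow> decd Q \<Longrightarrow> decd (\<lambda>n. P n \<longrightarrow> Q n)"
  using decd_not[OF decd_conj[OF _ decd_not, of P Q]] by simp

lemma decd_comp: "decd P \<Longrightarrow> dfn g \<Longrightarrow> decd (\<lambda>n. P (g n))"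
proof -
  assume "decd P" and g: "dfn g"
  then obtain h where h: "dfn h" "\<And>n. P n \<longleftrightarrow> h n = 0" by (auto simp: decd_def)
  show ?thesis by (rule decdI[OF dfn_comp[OF h(1) g]]) (simp add: h(2))
qed

text \<open>The induction formula is the equation \<open>h n = 0\<close> for the deciding function,
  hence quantifier-free.\<close>

lemma decd_induct:
  assumes "decd P" "P 0" "\<And>n. P n \<Longrightarrow> P (n + 1)"
  shows "P n"
proof -
  obtain h where h: "dfn h" "\<And>n. P n \<longleftrightarrow> h n = 0" using assms(1) by (auto simp: decd_def)
  have "h n = 0"
    by (rule induct_eq[OF h(1) dfn_const]) (use assms(2,3) in \<open>simp_all add: h(2)\<close>)
  then show ?thesis by (simp add: h(2))
qed

lemma triN_mono: "a \<le> b \<Longrightarrow> triN a \<le> triN b"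
proof -
  have "triN a \<le> triN (a + k)" for k
  proof (rule decd_induct[where n = k])
    show "decd (\<lambda>k. triN a \<le> triN (a + k))" by (intro decd_le dfn_tri dfn_plus dfn_const dfn_id)
    show "triN a \<le> triN (a + n) \<Longrightarrow> triN a \<le> triN (a + (n + 1))" for n
      using triN(2)[of "a + n"] by (simp add: add.assoc add_increasing2)
  qed simp
  from this[of "monusN b a"] show "a \<le> b \<Longrightarrow> triN a \<le> triN b" by (simp add: add_monusN)
qed

text \<open>The invariant of the recursion for \<open>diagN\<close>: the diagonal advances exactly
  when \<open>k + 1\<close> reaches the next triangular number.\<close>

lemma diagN_bounds: "triN (diagN k) \<le> k \<and> k < triN (diagN k + 1)"
proof (rule decd_induct[where n = k])
  show "decd (\<lambda>k. triN (diagN k) \<le> k \<and> k < triN (diagN k + 1))"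
    by (intro decd_conj decd_le decd_less dfn_tri dfn_plus dfn_diag dfn_const dfn_id)
  show "triN (diagN 0) \<le> 0 \<and> 0 < triN (diagN 0 + 1)" using triN(2)[of 0] by (simp add: diagN triN)
  fix k assume IH: "triN (diagN k) \<le> k \<and> k < triN (diagN k + 1)"
  show "triN (diagN (k + 1)) \<le> k + 1 \<and> k + 1 < triN (diagN (k + 1) + 1)"
  proof (cases "triN (diagN k + 1) \<le> k + 1")
    case True
    then have "diagN (k + 1) = diagN k + 1"
      using monusN_zero_iff[of "triN (diagN k + 1)" "k + 1"] by (simp add: diagN monusN)
    moreover have "k + 1 \<le> triN (diagN k + 1)" using IH by (simp add: succ_leN)
    moreover have "0 < diagN k + 1 + 1" by (rule add_nonneg_pos) simp_all
    then have "triN (diagN k + 1) < triN (diagN k + 1 + 1)" by (simp only: triN(2)[of "diagN k + 1"] less_add_same_cancel1)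
    ultimately show ?thesis using True by (simp only: le_less_trans)
  next
    case False
    then have "monusN (triN (diagN k + 1)) (k + 1) \<noteq> 0" by (simp add: monusN_zero_iff)
    then have "1 \<le> monusN (triN (diagN k + 1)) (k + 1)"
      using succ_leN[of 0 "monusN (triN (diagN k + 1)) (k + 1)"] by (simp add: less_le)
    then have "diagN (k + 1) = diagN k" by (simp add: diagN monusN_zero_iff[THEN iffD2])
    moreover have "triN (diagN k) \<le> k + 1" using IH by (simp add: add_increasing2)
    ultimately show ?thesis using False by simp
  qed
qed

lemma diagN_unique: "triN d \<le> k \<Longrightarrow> k < triN (d + 1) \<Longrightarrow> diagN k = d"
proof -
  assume d: "triN d \<le> k" "k < triN (d + 1)"
  have "\<not> diagN k + 1 \<le> d" using triN_mono[of "diagN k + 1" d] d diagN_bounds[of k] by auto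
  moreover have "\<not> d + 1 \<le> diagN k" using triN_mono[of "d + 1" "diagN k"] d diagN_bounds[of k] by auto
  ultimately show ?thesis by (simp add: succ_leN)
qed

lemma pairN [simp]: "fstN (pairN a b) = a" "sndN (pairN a b) = b"
proof -
  \<comment> \<open>The offset \<open>b\<close> stays below the gap \<open>a + b + 1\<close> to the
    next triangular number, so the code lies on diagonal \<open>a + b\<close>.\<close>
  have "b < a + b + 1" by (simp add: less_succN add_increasing)
  then have "pairN a b < triN (a + b + 1)" unfolding pairN_def triN by (rule add_strict_left_mono)
  moreover have "triN (a + b) \<le> pairN a b" by (simp add: pairN_def add_increasing2)
  ultimately have d: "diagN (pairN a b) = a + b" by (intro diagN_unique)
  show s: "sndN (pairN a b) = b" by (simp add: sndN_def d) (simp add: pairN_def)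
  show "fstN (pairN a b) = a" by (simp add: fstN_def d s)
qed

section \<open>Number quantifiers, choice and recursion\<close>

lemma exists2_functional: "\<exists>\<phi>\<in>D (T1 \<rightarrow> T0). \<forall>f\<in>D T1. (\<exists>n. f \<star> n = 0) \<longleftrightarrow> ap \<phi> f = of_n 0"
proof -
  have "\<exists>\<phi>\<in>D (T1 \<rightarrow> T0). (\<forall>f\<in>D T1. lt (ap \<phi> f) (of_n 1) \<or> ap \<phi> f = of_n 1) \<and>
      (\<forall>f\<in>D T1. (\<exists>n. f \<star> n = 0) \<longleftrightarrow> ap \<phi> f = of_n 0)"
  proof (rule axiom[of exists2])
    show "exists2 \<in> equality_axioms \<union> arithmetic_axioms \<union> combinator_axioms \<union> recursor_axioms \<union> {exists2}"
      by (rule UnI2) (rule singletonI)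
    fix e :: "'v env" assume "world {} e"
    then show "F {} e exists2 (\<exists>\<phi>\<in>D (T1 \<rightarrow> T0). (\<forall>f\<in>D T1. lt (ap \<phi> f) (of_n 1) \<or> ap \<phi> f = of_n 1) \<and>
        (\<forall>f\<in>D T1. (\<exists>n. f \<star> n = 0) \<longleftrightarrow> ap \<phi> f = of_n 0))"
      unfolding exists2_def le_fm_def
      by - (assumption | rule T_one0 T_zero0 F_conj F_iff F_disj F_ex0 F_eq0 F_ex F_all F_less F_eq T_app0 T_app
        | erule extends_world | erule (1) T_mono)+
  qed
  then obtain \<phi> where "\<phi> \<in> D (T1 \<rightarrow> T0)" "\<forall>f\<in>D T1. (\<exists>n. f \<star> n = 0) \<longleftrightarrow> ap \<phi> f = of_n 0"
    by (elim bexE conjE)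
  then show ?thesis by (rule bexI[rotated])
qed

text \<open>Currying makes the deciding function of \<open>Q p\<close> an object of type 1, and the
  functional of \<open>exists2\<close> tells whether it has a zero. Several parameters are
  accommodated by coding them into \<open>p\<close>.\<close>

lemma decd_ex: "decd (\<lambda>p. Q (fstN p) (sndN p)) \<Longrightarrow> decd (\<lambda>p. \<exists>n. Q p n)"
proof -
  assume "decd (\<lambda>p. Q (fstN p) (sndN p))"
  then obtain h where h: "dfn h" "\<And>p. Q (fstN p) (sndN p) \<longleftrightarrow> h p = 0" by (auto simp: decd_def)
  obtain \<phi> where \<phi>: "\<phi> \<in> D (T1 \<rightarrow> T0)" "\<And>f. f \<in> D T1 \<Longrightarrow> (\<exists>n. f \<star> n = 0) \<longleftrightarrow> ap \<phi> f = of_n 0"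
    using exists2_functional by blast
  obtain W where W: "W \<in> D (T0 \<rightarrow> T1)" "\<And>p n. ap (ap W (of_n p)) (of_n n) = of_n (h (pairN p n))"
    using dfn2_comp[OF h(1) dfn2_pair] by (auto simp: dfn2_def)
  have W1: "ap W (of_n p) \<in> D T1" for p by (rule ap_D[OF W(1) of_n_D])
  have eq: "of_n (num (ap \<phi> (ap W (of_n p)))) = ap \<phi> (ap W (of_n p))" for p
    by (rule of_n_num[OF ap_D[OF \<phi>(1) W1]])
  show "decd (\<lambda>p. \<exists>n. Q p n)"
  proof (rule decdI)
    show "dfn (\<lambda>p. num (ap \<phi> (ap W (of_n p))))"
      unfolding dfn_def eq by (rule repn_comp[OF \<phi>(1) repn_ap[OF W(1)]])
    fix p
    have "(\<exists>n. Q p n) \<longleftrightarrow> (\<exists>n. ap W (of_n p) \<star> n = 0)"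
      using h(2)[of "pairN p _"] by (simp add: val1_def W(2))
    also have "\<dots> \<longleftrightarrow> num (ap \<phi> (ap W (of_n p))) = 0"
      using \<phi>(2)[OF W1, of p] of_n_eq[of "num (ap \<phi> (ap W (of_n p)))" 0] eq[of p] by (simp only:)
    finally show "(\<exists>n. Q p n) \<longleftrightarrow> num (ap \<phi> (ap W (of_n p))) = 0" .
  qed
qed

lemma decd_all: "decd (\<lambda>p. Q (fstN p) (sndN p)) \<Longrightarrow> decd (\<lambda>p. \<forall>n. Q p n)"
  using decd_not[OF decd_ex[OF decd_not, of Q]] by simp

text \<open>The matrix of the axiom instance is \<open>U (f 0) n = 0\<close>, so the argument of
  type 1 acts only through its value at zero.\<close>

lemma choice_functional:
  assumes "U \<in> D (T0 \<rightarrow> T1)" "\<And>p. \<exists>n. ap (ap U (of_n p)) (of_n n) = of_n 0"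
  shows "\<exists>\<Phi>\<in>D (T1 \<rightarrow> T0). \<forall>f\<in>D T1. ap (ap U (ap f z)) (ap \<Phi> f) = z"
proof -
  let ?A = "Eq (App (App (Var 2 (T0 \<rightarrow> T1)) (App (Var 0 T1) Zero)) (Var 1 T0)) Zero"
  let ?B = "Imp (Forall 0 T1 (Exists 1 T0 ?A))
    (Exists 3 (T1 \<rightarrow> T0) (Forall 0 T1 (subst 1 T0 (App (Var 3 (T1 \<rightarrow> T0)) (Var 0 T1)) ?A)))"
  have "generalize [(2, T0 \<rightarrow> T1)] ?B \<in> QF_AC_10_axioms"
    unfolding QF_AC_10_axioms_def by (rule CollectI, (rule exI)+, rule conjI, rule refl) simp
  then have "generalize [(2, T0 \<rightarrow> T1)] ?B \<in> ACA0\<omega>" by (simp add: ACA0\<omega>_def RCA0\<omega>_def)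
  moreover have "sentence (generalize [(2, T0 \<rightarrow> T1)] ?B)"
    by (auto simp: sentence_def generalize_def)
  ultimately have gen: "sat e (generalize [(2, T0 \<rightarrow> T1)] ?B)" if "valid e" for e
    using axioms_hold that by blast
  obtain e0 where e0: "valid e0" using ex_valid by blast
  have "sat (e0((2, T0 \<rightarrow> T1) := U)) ?B"
    by (rule sat_generalizeD[OF gen valid_upd[OF e0 assms(1)]])
  moreover have "\<forall>f\<in>D T1. \<exists>v\<in>D T0. ap (ap U (ap f z)) v = z"
  proof
    fix f assume f: "f \<in> D T1"
    have "ap f z = of_n (f \<star> 0)" using val1[OF f, of 0] by (simp add: of_n_zero)
    then show "\<exists>v\<in>D T0. ap (ap U (ap f z)) v = z" using assms(2)[of "f \<star> 0"] by (auto simp: of_n_zero)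
  qed
  ultimately show ?thesis by simp
qed

text \<open>The sequence with constant value \<open>p\<close> serves as the argument of type 1 in the axiom of choice.\<close>

lemma choice:
  assumes "decd (\<lambda>p. Q (fstN p) (sndN p))" "\<And>p. \<exists>n. Q p n"
  shows "\<exists>h. dfn h \<and> (\<forall>p. Q p (h p))"
proof -
  obtain h where h: "dfn h" "\<And>p. Q (fstN p) (sndN p) \<longleftrightarrow> h p = 0" using assms(1) by (auto simp: decd_def)
  obtain U where U: "U \<in> D (T0 \<rightarrow> T1)" "\<And>p n. ap (ap U (of_n p)) (of_n n) = of_n (h (pairN p n))"
    using dfn2_comp[OF h(1) dfn2_pair] by (auto simp: dfn2_def)
  have Q: "Q p n \<longleftrightarrow> ap (ap U (of_n p)) (of_n n) = of_n 0" for p n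
    using h(2)[of "pairN p n"] by (simp add: U(2))
  obtain \<Phi> where \<Phi>: "\<Phi> \<in> D (T1 \<rightarrow> T0)" "\<And>f. f \<in> D T1 \<Longrightarrow> ap (ap U (ap f z)) (ap \<Phi> f) = z"
    using choice_functional[OF U(1)] assms(2) Q by blast
  let ?k = "\<lambda>p. ap (I (Kc T0 T0)) (of_n p)"
  have k: "?k p \<in> D T1" "ap (?k p) z = of_n p" for p
    using ap_D[OF K_D of_n_D] K[OF of_n_D const_D(1)] by blast+
  have eq: "of_n (num (ap \<Phi> (?k p))) = ap \<Phi> (?k p)" for p
    by (rule of_n_num[OF ap_D[OF \<Phi>(1) k(1)]])
  have "dfn (\<lambda>p. num (ap \<Phi> (?k p)))"
    unfolding dfn_def eq by (rule repn_comp[OF \<Phi>(1) repn_ap[OF K_D]])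
  moreover have "Q p (num (ap \<Phi> (?k p)))" for p
    unfolding Q eq using \<Phi>(2)[OF k(1)[of p]] by (simp add: k(2) of_n_zero)
  ultimately show ?thesis by blast
qed

text \<open>The step sees index and previous value as one pair, so that unary definability of
  \<open>h\<close>, as delivered by \<open>choice\<close>, is enough.\<close>

lemma sequence:
  assumes "dfn h"
  shows "\<exists>s. dfn s \<and> s 0 = a \<and> (\<forall>n. s (n + 1) = h (pairN n (s n)))"
proof -
  have h2: "dfn2 (\<lambda>i r. h (pairN i r))" by (rule dfn2_comp[OF assms dfn2_pair])
  show ?thesis
    using dfn_nrec[OF h2 dfn_const dfn_id, of a] nrec[OF h2]
    by (intro exI[of _ "nrec (\<lambda>i r. h (pairN i r)) a"]) simp
qed

end

section \<open>Rational and real numbers in the model\<close>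

context arithmetic_model
begin

lemma frac_of_nonneg [simp]: "0 \<le> frac_of (a :: 'n)"
  using frac_of_le_iff[of 0 a] by simp

section \<open>Rational codes and their values in the field\<close>

definition qposN :: "'n \<Rightarrow> 'n" where "qposN q = fstN (fstN q)"
definition qnegN :: "'n \<Rightarrow> 'n" where "qnegN q = sndN (fstN q)"
definition qdenN :: "'n \<Rightarrow> 'n" where "qdenN q = sndN q + 1"
definition quotN :: "'n \<Rightarrow> 'n \<Rightarrow> 'n \<Rightarrow> 'n" where "quotN a b c = pairN (pairN a b) c"

definition qaddN :: "'n \<Rightarrow> 'n \<Rightarrow> 'n" where
  "qaddN p q = quotN (qposN p * qdenN q + qposN q * qdenN p) (qnegN p * qdenN q + qnegN q * qdenN p)
     (predN (qdenN p * qdenN q))"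

definition quminusN :: "'n \<Rightarrow> 'n" where "quminusN q = quotN (qnegN q) (qposN q) (sndN q)"

definition qabsN :: "'n \<Rightarrow> 'n" where
  "qabsN q = quotN (monusN (qposN q) (qnegN q) + monusN (qnegN q) (qposN q)) 0 (sndN q)"

definition qepsN :: "'n \<Rightarrow> 'n" where "qepsN n = quotN 1 0 (predN (pow2N n))"

definition val :: "'n \<Rightarrow> 'n differences fract" where
  "val q = (frac_of (qposN q) - frac_of (qnegN q)) / frac_of (qdenN q)"

definition eps :: "'n \<Rightarrow> 'n differences fract" where "eps n = val (qepsN n)"

lemma quotN [simp]: "qposN (quotN a b c) = a" "qnegN (quotN a b c) = b" "sndN (quotN a b c) = c"
  by (simp_all add: quotN_def qposN_def qnegN_def)

lemma val_quotN: "val (quotN a b c) = (frac_of a - frac_of b) / (frac_of c + 1)"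
  by (simp add: val_def qdenN_def)

lemma qdenN_pos: "0 < frac_of (qdenN q)"
  unfolding qdenN_def by (simp add: add_nonneg_pos)

lemma frac_of_predN: "n \<noteq> 0 \<Longrightarrow> frac_of (predN n) + 1 = frac_of n"
  using nonzero_cases[of n] by (auto simp: predN)

lemma val_qaddN: "val (qaddN p q) = val p + val q"
proof -
  have "frac_of (qdenN p * qdenN q) \<noteq> frac_of 0"
    unfolding frac_of_simps using qdenN_pos[of p] qdenN_pos[of q] by simp
  then have nz: "qdenN p * qdenN q \<noteq> 0" by auto
  have "frac_of (predN (qdenN p * qdenN q)) + 1 = frac_of (qdenN p) * frac_of (qdenN q)"
    unfolding frac_of_simps(4)[symmetric] by (rule frac_of_predN[OF nz])
  then show ?thesis
    using qdenN_pos[of p] qdenN_pos[of q]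
    by (simp add: qaddN_def val_quotN) (simp add: val_def field_simps)
qed

lemma val_quminusN: "val (quminusN q) = - val q"
  by (simp add: quminusN_def val_quotN) (simp add: val_def qdenN_def minus_divide_left)

text \<open>One of the two truncated differences is zero and the other is the absolute
  value.\<close>

lemma frac_of_monus_abs: "frac_of (monusN a b + monusN b a) = \<bar>frac_of a - frac_of b\<bar>"
proof -
  have *: "frac_of (monusN a b + monusN b a) = frac_of b - frac_of a" if "a \<le> b" for a b
  proof -
    have "monusN a b = 0" using that by (simp add: monusN_zero_iff)
    moreover have "frac_of (a + monusN b a) = frac_of b" using that by (simp only: add_monusN)
    ultimately show ?thesis by (simp add: algebra_simps)
  qed
  show ?thesis
  proof (cases "a \<le> b")
    case True
    then have "frac_of a \<le> frac_of b" by simp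
    then show ?thesis using *[OF True] by simp
  next
    case False
    then have "b \<le> a" by simp
    then have "frac_of b \<le> frac_of a" by simp
    then show ?thesis using *[OF \<open>b \<le> a\<close>] by (simp add: add.commute)
  qed
qed

lemma val_qabsN: "val (qabsN q) = \<bar>val q\<bar>"
proof -
  have "val (qabsN q) = \<bar>frac_of (qposN q) - frac_of (qnegN q)\<bar> / frac_of (qdenN q)"
    unfolding qabsN_def val_quotN frac_of_monus_abs by (simp add: qdenN_def)
  then show ?thesis using qdenN_pos[of q] by (simp add: val_def abs_divide)
qed

lemma val_less:
  "qposN p * qdenN q + qnegN q * qdenN p < qposN q * qdenN p + qnegN p * qdenN q \<longleftrightarrow> val p < val q"
proof -
  have "qposN p * qdenN q + qnegN q * qdenN p < qposN q * qdenN p + qnegN p * qdenN q \<longleftrightarrow>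
      frac_of (qposN p * qdenN q + qnegN q * qdenN p) < frac_of (qposN q * qdenN p + qnegN p * qdenN q)"
    by (simp only: frac_of_less_iff)
  also have "\<dots> \<longleftrightarrow> (frac_of (qposN p) - frac_of (qnegN p)) * frac_of (qdenN q) <
      (frac_of (qposN q) - frac_of (qnegN q)) * frac_of (qdenN p)"
    by (simp add: algebra_simps del: frac_of_less_iff)
  also have "\<dots> \<longleftrightarrow> val p < val q"
    using qdenN_pos[of p] qdenN_pos[of q] by (simp add: val_def divide_less_eq less_divide_eq mult.commute)
  finally show ?thesis .
qed

text \<open>Since every field element has a code, arbitrary field constants may appear in decidable
  conditions.\<close>

lemma val_surj: "\<exists>q. val q = x"
proof -
  obtain a b d where "d \<noteq> 0" "x = (frac_of a - frac_of b) / frac_of d" using fract_cases[of x] by blast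
  moreover obtain c where "d = c + 1" using nonzero_cases[OF \<open>d \<noteq> 0\<close>] by blast
  ultimately have "val (quotN a b c) = x" by (simp add: val_quotN)
  then show ?thesis by blast
qed

lemma pow2N_pos: "0 < pow2N n"
proof (rule decd_induct[where n = n])
  show "decd (\<lambda>n. 0 < pow2N n)" by (intro decd_less dfn_const dfn_pow2 dfn_id)
qed (simp_all add: pow2N add_pos_pos)

lemma eps: "eps n = 1 / frac_of (pow2N n)"
  using frac_of_predN[of "pow2N n"] pow2N_pos[of n] by (simp add: eps_def qepsN_def val_quotN)

lemma eps_pos: "0 < eps n"
  using frac_of_less_iff[of 0 "pow2N n"] pow2N_pos[of n] by (simp add: eps)

lemma eps_succ: "eps n = eps (n + 1) + eps (n + 1)"
proof -
  have "frac_of (pow2N (n + 1)) = frac_of (pow2N n) + frac_of (pow2N n)" by (simp add: pow2N)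
  then show ?thesis
    using frac_of_less_iff[of 0 "pow2N n"] pow2N_pos[of n] unfolding eps by (simp add: field_simps)
qed

lemma eps_add_mono: "eps (n + k) \<le> eps n"
proof -
  have "pow2N n \<le> pow2N (n + k)"
  proof (rule decd_induct[where n = k])
    show "decd (\<lambda>k. pow2N n \<le> pow2N (n + k))" by (intro decd_le dfn_pow2 dfn_plus dfn_const dfn_id)
    show "pow2N n \<le> pow2N (n + k) \<Longrightarrow> pow2N n \<le> pow2N (n + (k + 1))" for k
      using pow2N(2)[of "n + k"] by (simp add: add.assoc add_increasing2)
  qed simp
  then have "frac_of (pow2N n) \<le> frac_of (pow2N (n + k))" by simp
  then show ?thesis
    using frac_of_less_iff[of 0 "pow2N n"] pow2N_pos[of n] frac_of_less_iff[of 0 "pow2N (n + k)"] pow2N_pos[of "n + k"]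
    unfolding eps by (intro divide_left_mono mult_pos_pos) auto
qed

lemma eps_mono: "m \<le> n \<Longrightarrow> eps n \<le> eps m"
  using eps_add_mono[of m "monusN n m"] by (simp add: add_monusN)

text \<open>The field is Archimedean relative to the numbers of the model, standard or not: a
  positive \<open>(a - b) / d\<close> is at least \<open>1 / d\<close>, because \<open>b < a\<close>
  gives \<open>b + 1 \<le> a\<close>, and \<open>d < pow2N d\<close>.\<close>

lemma archimedean: "0 < x \<Longrightarrow> \<exists>n. eps n < x"
proof -
  assume x: "0 < x"
  obtain a b d where d: "d \<noteq> 0" "x = (frac_of a - frac_of b) / frac_of d" using fract_cases[of x] by blast
  have d0: "0 < frac_of d" using d(1) frac_of_less_iff[of 0 d] by (simp add: less_le)
  then have "frac_of b < frac_of a" using x by (simp add: d zero_less_divide_iff)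
  then have "frac_of (b + 1) \<le> frac_of a" by (simp only: frac_of_le_iff frac_of_less_iff succ_leN)
  then have "1 / frac_of d \<le> x" using d0 by (simp add: d divide_right_mono)
  moreover have "d < pow2N d"
  proof (rule decd_induct[where n = d])
    show "decd (\<lambda>d. d < pow2N d)" by (intro decd_less dfn_pow2 dfn_id)
    fix n assume "n < pow2N n"
    moreover have "1 \<le> pow2N n" using succ_leN[of 0 "pow2N n"] pow2N_pos[of n] by simp
    ultimately show "n + 1 < pow2N (n + 1)" unfolding pow2N by (rule add_less_le_mono)
  qed (simp add: pow2N)
  then have "eps d < 1 / frac_of d"
    using d0 unfolding eps by (intro divide_strict_left_mono mult_pos_pos) (auto intro: less_trans)
  ultimately show ?thesis using less_le_trans by blast
qed

lemma le_by_eps: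
  assumes "\<And>n. x \<le> y + eps n"
  shows "x \<le> y"
proof (rule ccontr)
  assume "\<not> x \<le> y"
  then have "0 < x - y" by simp
  then obtain n where "eps n < x - y" using archimedean by blast
  then show False using assms[of n] by (simp add: algebra_simps)
qed

lemma T_quot:
  "T V e s T0 (of_n a) \<Longrightarrow> T V e t T0 (of_n b) \<Longrightarrow> T V e r T0 (of_n c) \<Longrightarrow> T V e (quot s t r) T0 (of_n (quotN a b c))"
  unfolding quot_def quotN_def by (intro T_pair)

lemma T_qparts:
  assumes "T V e s T0 (of_n a)"
  shows "T V e (qpos s) T0 (of_n (qposN a))" "T V e (qneg s) T0 (of_n (qnegN a))" "T V e (qden s) T0 (of_n (qdenN a))"
  unfolding qpos_def qposN_def qneg_def qnegN_def qden_def qdenN_def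
  by (intro T_first T_second T_plus0 T_one0 assms)+

lemma T_qadd:
  "T V e s T0 (of_n a) \<Longrightarrow> T V e t T0 (of_n b) \<Longrightarrow> T V e (s +\<^sub>Q t) T0 (of_n (qaddN a b))"
  unfolding qadd_def
  by (rule T_closed2(2)[where h = qaddN])
    (unfold qaddN_def, (assumption | rule T_quot T_plus0 T_times0 T_qparts T_pred)+)

lemma dfn2_qadd: "dfn2 qaddN"
  by (rule T_closed2(1)[where t = "\<lambda>s t. s +\<^sub>Q t"]) (rule T_qadd)

lemma T_quminus: "T V e s T0 (of_n a) \<Longrightarrow> T V e (-\<^sub>Q s) T0 (of_n (quminusN a))"
  unfolding quminus_def
  by (rule T_closed1(2)[where h = quminusN])
    (unfold quminusN_def, (assumption | rule T_quot T_qparts T_second)+)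

lemma dfn_quminus: "dfn quminusN"
  by (rule T_closed1(1)[where t = "\<lambda>s. -\<^sub>Q s"]) (rule T_quminus)

lemma T_qabs: "T V e s T0 (of_n a) \<Longrightarrow> T V e (qabs s) T0 (of_n (qabsN a))"
  unfolding qabs_def
  by (rule T_closed1(2)[where h = qabsN])
    (unfold qabsN_def, (assumption | rule T_quot T_plus0 T_monus T_qparts T_second T_zero0)+)

lemma dfn_qabs: "dfn qabsN"
  by (rule T_closed1(1)[where t = qabs]) (rule T_qabs)

lemma T_qeps: "world V e \<Longrightarrow> T V e s T0 (of_n a) \<Longrightarrow> T V e (qeps s) T0 (of_n (qepsN a))"
  unfolding qeps_def qepsN_def by (assumption | rule T_quot T_one0 T_zero0 T_pred T_pow2)+

lemma dfn_qeps: "dfn qepsN"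
  by (rule T_closed1(1)[where t = qeps]) (rule T_qeps)

lemma T_qnat: "T V e s T0 (of_n a) \<Longrightarrow> T V e (qnat s) T0 (of_n (quotN a 0 0))"
  unfolding qnat_def by (assumption | rule T_quot T_zero0)+

lemma F_qless: "T V e s T0 (of_n a) \<Longrightarrow> T V e t T0 (of_n b) \<Longrightarrow> F V e (s <\<^sub>Q t) (val a < val b)"
  unfolding qless_def val_less[symmetric]
  by (rule F_less0) (assumption | rule T_plus0 T_times0 T_qparts)+

lemma F_qle: "T V e s T0 (of_n a) \<Longrightarrow> T V e t T0 (of_n b) \<Longrightarrow> F V e (s \<le>\<^sub>Q t) (val a \<le> val b)"
  using F_neg[OF F_qless, of V e t b s a] by (simp add: qle_def not_less)

lemma decd_val_less: "dfn f \<Longrightarrow> dfn g \<Longrightarrow> decd (\<lambda>n. val (f n) < val (g n))"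
  unfolding val_less[symmetric] qposN_def qnegN_def qdenN_def
  by (intro decd_less dfn_plus dfn_times dfn_fst dfn_snd dfn_const)

lemma decd_val_le: "dfn f \<Longrightarrow> dfn g \<Longrightarrow> decd (\<lambda>n. val (f n) \<le> val (g n))"
  using decd_not[OF decd_val_less, of g f] by (simp add: not_less)

section \<open>Meaning of the formulas about reals and functions\<close>

definition approx :: "'v \<Rightarrow> 'n \<Rightarrow> 'n differences fract" where "approx u n = val (u \<star> n)"

definition isreal :: "'v \<Rightarrow> bool" where
  "isreal u \<longleftrightarrow> (\<forall>n i. \<bar>approx u n - approx u (n + i)\<bar> < eps n)"

definition eqreal :: "'v \<Rightarrow> 'v \<Rightarrow> bool" where
  "eqreal u w \<longleftrightarrow> (\<forall>n. \<bar>approx u n - approx w n\<bar> \<le> eps n + eps n)"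

text \<open>The shift by one comes from \<open>rdist\<close>, whose \<open>n\<close>-th
  approximation compares its arguments at \<open>n + 1\<close>; the summand
  \<open>eps n + eps n\<close> is the margin built into the order of reals.\<close>

definition near :: "'v \<Rightarrow> 'v \<Rightarrow> 'n \<Rightarrow> bool" where
  "near u w k \<longleftrightarrow> (\<exists>n. \<bar>approx u (n + 1) - approx w (n + 1)\<bar> + (eps n + eps n) < eps k)"

definition isunit :: "'v \<Rightarrow> bool" where
  "isunit u \<longleftrightarrow> isreal u \<and> \<not> (\<exists>n. approx u n + (eps n + eps n) < 0) \<and> \<not> (\<exists>n. 1 + (eps n + eps n) < approx u n)"

definition unitfun :: "'v \<Rightarrow> bool" where
  "unitfun g \<longleftrightarrow> (\<forall>u\<in>D T1. isunit u \<longrightarrow> isreal (ap g u)) \<and>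
     (\<forall>u\<in>D T1. isunit u \<longrightarrow> (\<forall>w\<in>D T1. isunit w \<longrightarrow> eqreal u w \<longrightarrow> eqreal (ap g u) (ap g w)))"

definition contat :: "'v \<Rightarrow> 'v \<Rightarrow> bool" where
  "contat g u \<longleftrightarrow> (\<forall>k. \<exists>m. \<forall>w\<in>D T1. isunit w \<longrightarrow> near u w m \<longrightarrow> near (ap g u) (ap g w) k)"

definition isbaire1 :: "'v \<Rightarrow> bool" where
  "isbaire1 f \<longleftrightarrow> (\<exists>g\<in>D (T0 \<rightarrow> T1 \<rightarrow> T1).
     (\<forall>n. unitfun (ap g (of_n n)) \<and> (\<forall>u\<in>D T1. isunit u \<longrightarrow> contat (ap g (of_n n)) u)) \<and>
     (\<forall>u\<in>D T1. isunit u \<longrightarrow> (\<forall>k. \<exists>m. \<forall>n. m \<le> n \<longrightarrow> near (ap (ap g (of_n n)) u) (ap f u) k)))"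

definition isdense :: "('v \<Rightarrow> bool) \<Rightarrow> bool" where
  "isdense P \<longleftrightarrow> (\<forall>w\<in>D T1. isunit w \<longrightarrow> (\<forall>k. \<exists>u\<in>D T1. isunit u \<and> P u \<and> near w u k))"

lemmas val_simps = val_qaddN val_quminusN val_qabsN eps_def[symmetric] approx_def[symmetric]

lemma F_is_real:
  assumes "world V e" "T V e x T1 u"
  shows "F V e (is_real x) (isreal u)"
proof -
  have "F V e (is_real x) (\<forall>n i. val (qabsN (qaddN (u \<star> n) (quminusN (u \<star> (n + i))))) < val (qepsN n))"
    unfolding is_real_def using assms
    by - (assumption | rule F_all0 F_qless T_qabs T_qadd T_quminus T_qeps T_plus0 T_app0
        | erule extends_world | erule (1) T_mono | erule (2) T_mono2)+
  then show ?thesis by (simp add: isreal_def val_simps)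
qed

lemma F_req:
  assumes "world V e" "T V e x T1 u" "T V e y T1 w"
  shows "F V e (x =\<^sub>R y) (eqreal u w)"
proof -
  have "F V e (x =\<^sub>R y) (\<forall>n. val (qabsN (qaddN (u \<star> n) (quminusN (w \<star> n)))) \<le> val (qaddN (qepsN n) (qepsN n)))"
    unfolding req_def using assms
    by - (assumption | rule F_all0 F_qle T_qabs T_qadd T_quminus T_qeps T_app0
        | erule extends_world | erule (1) T_mono)+
  then show ?thesis by (simp add: eqreal_def val_simps)
qed

lemma F_rless:
  assumes "world V e" "T V e x T1 u" "T V e y T1 w"
  shows "F V e (x <\<^sub>R y) (\<exists>n. approx u n + (eps n + eps n) < approx w n)"
proof -
  have "F V e (x <\<^sub>R y) (\<exists>n. val (qaddN (u \<star> n) (qaddN (qepsN n) (qepsN n))) < val (w \<star> n))"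
    unfolding rless_def using assms
    by - (assumption | rule F_ex0 F_qless T_qadd T_qeps T_app0
        | erule extends_world | erule (1) T_mono)+
  then show ?thesis by (simp add: val_simps)
qed

lemma T_rconst:
  assumes "world V e" "T V e x T0 (of_n q)"
  shows "\<exists>u\<in>D T1. (\<forall>n. approx u n = val q) \<and> T V e (rconst x) T1 u"
proof -
  have "\<exists>u\<in>D T1. (\<forall>n. u \<star> n = q) \<and> T V e (rconst x) T1 u"
    unfolding rconst_def by (rule T_lam1[OF assms(1)]) (erule T_mono[OF assms(2)])
  then show ?thesis by (auto simp: approx_def)
qed

lemma F_near:
  assumes "world V e" "T V e x T1 u" "T V e y T1 w" "T V e s T0 (of_n k)"
  shows "F V e (rdist x y <\<^sub>R rconst (qeps s)) (near u w k)"
proof -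
  have "\<exists>r\<in>D T1. (\<forall>n. r \<star> n = qabsN (qaddN (u \<star> (n + 1)) (quminusN (w \<star> (n + 1))))) \<and> T V e (rdist x y) T1 r"
    unfolding rdist_def
    by (rule T_lam1[OF assms(1)])
      (assumption | rule T_qabs T_qadd T_quminus T_plus0 T_one0 T_app0
        | erule extends_world | erule T_mono[OF assms(2)] T_mono[OF assms(3)])+
  then obtain r where r: "r \<in> D T1" "\<And>n. approx r n = \<bar>approx u (n + 1) - approx w (n + 1)\<bar>" "T V e (rdist x y) T1 r"
    by (auto simp: approx_def val_qabsN val_qaddN val_quminusN)
  obtain c where c: "\<And>n. approx c n = val (qepsN k)" "T V e (rconst (qeps s)) T1 c"
    using T_rconst[OF assms(1) T_qeps[OF assms(1,4)]] by blast
  show ?thesis using F_rless[OF assms(1) r(3) c(2)] by (simp add: near_def r(2) c(1) eps_def)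
qed

lemma F_unit_interval:
  assumes "world V e" "T V e x T1 u"
  shows "F V e (unit_interval x) (isunit u)"
proof -
  obtain a where a: "\<And>n. approx a n = val (quotN 0 0 0)" "T V e (rconst (qnat \<^bold>0)) T1 a"
    using T_rconst[OF assms(1) T_qnat[OF T_zero0]] by blast
  obtain b where b: "\<And>n. approx b n = val (quotN 1 0 0)" "T V e (rconst (qnat \<^bold>1)) T1 b"
    using T_rconst[OF assms(1) T_qnat[OF T_one0]] by blast
  have "F V e (unit_interval x) (isreal u \<and> \<not> (\<exists>n. approx u n + (eps n + eps n) < approx a n) \<and>
      \<not> (\<exists>n. approx b n + (eps n + eps n) < approx u n))"
    unfolding unit_interval_def rle_def
    by (intro F_conj F_neg F_is_real F_rless assms a(2) b(2))
  then show ?thesis by (simp add: isunit_def a(1) b(1) val_quotN)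
qed

lemma F_all_unit:
  assumes "world V e"
    and "\<And>x u V' e'. u \<in> D T1 \<Longrightarrow> extends V e V' e' \<Longrightarrow> T V' e' x T1 u \<Longrightarrow> F V' e' (\<phi> x) (P u)"
  shows "F V e (\<^bold>\<forall>\<^sub>I x. \<phi> x) (\<forall>u\<in>D T1. isunit u \<longrightarrow> P u)"
  unfolding all_unit_def
  by (rule F_all[OF assms(1)]) (rule F_imp[OF F_unit_interval[OF extends_world] assms(2)])

lemma F_ex_unit:
  assumes "world V e"
    and "\<And>x u V' e'. u \<in> D T1 \<Longrightarrow> extends V e V' e' \<Longrightarrow> T V' e' x T1 u \<Longrightarrow> F V' e' (\<phi> x) (P u)"
  shows "F V e (\<^bold>\<exists>\<^sub>I x. \<phi> x) (\<exists>u\<in>D T1. isunit u \<and> P u)"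
  unfolding ex_unit_def
  by (rule F_ex[OF assms(1)]) (rule F_conj[OF F_unit_interval[OF extends_world] assms(2)])

lemma F_unit_function:
  assumes "world V e" "T V e f (T1 \<rightarrow> T1) g"
  shows "F V e (unit_function f) (unitfun g)"
  unfolding unit_function_def unitfun_def using assms
  by - (assumption | rule F_conj F_all_unit F_imp F_is_real F_req T_app[where \<rho> = T1]
    | erule extends_world | erule (1) T_mono | erule (2) T_mono2)+

lemma F_continuous_at:
  assumes "world V e" "T V e f (T1 \<rightarrow> T1) g" "T V e x T1 u"
  shows "F V e (continuous_at f x) (contat g u)"
  unfolding continuous_at_def contat_def using assms
  by - (assumption | rule F_all0 F_ex0 F_all_unit F_imp F_near T_app[where \<rho> = T1]
    | erule extends_world | erule (1) T_mono | erule (2) T_mono2 | erule (3) T_mono3)+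

lemma F_baire1:
  assumes "world V e" "T V e f (T1 \<rightarrow> T1) h"
  shows "F V e (baire1 f) (isbaire1 h)"
  unfolding baire1_def isbaire1_def
proof (rule F_ex[OF assms(1)])
  fix x g V' e'
  assume g: "extends V e V' e'" "T V' e' x (T0 \<rightarrow> T1 \<rightarrow> T1) g"
  have w: "world V' e'" by (rule extends_world[OF g(1)])
  have f: "T V' e' f (T1 \<rightarrow> T1) h" by (rule T_mono[OF assms(2) g(1)])
  have 1: "F V' e' (\<^bold>\<forall>n\<^bold>:T0. unit_function (x \<cdot> n) \<^bold>\<and> (\<^bold>\<forall>\<^sub>I y. continuous_at (x \<cdot> n) y))
      (\<forall>n. unitfun (ap g (of_n n)) \<and> (\<forall>u\<in>D T1. isunit u \<longrightarrow> contat (ap g (of_n n)) u))"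
    using w g(2)
    by - (assumption | rule F_all0 F_conj F_unit_function F_all_unit F_continuous_at T_app[where \<rho> = T0]
      | erule extends_world | erule (1) T_mono | erule (2) T_mono2)+
  have 2: "F V' e' (\<^bold>\<forall>\<^sub>I y. \<^bold>\<forall>k\<^bold>:T0. \<^bold>\<exists>m\<^bold>:T0. \<^bold>\<forall>n\<^bold>:T0. m \<^bold>\<le> n \<^bold>\<longrightarrow>
           rdist (x \<cdot> n \<cdot> y) (f \<cdot> y) <\<^sub>R rconst (qeps k))
      (\<forall>u\<in>D T1. isunit u \<longrightarrow> (\<forall>k. \<exists>m. \<forall>n. m \<le> n \<longrightarrow> near (ap (ap g (of_n n)) u) (ap h u) k))"
  proof (rule F_all_unit[OF w])
    fix y u V1 e1
    assume u: "extends V' e' V1 e1" "T V1 e1 y T1 u"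
    have "T V1 e1 x (T0 \<rightarrow> T1 \<rightarrow> T1) g" "T V1 e1 (f \<cdot> y) T1 (ap h u)" "world V1 e1"
      by (rule T_mono[OF g(2) u(1)] T_app[OF T_mono[OF f u(1)] u(2)] extends_world[OF u(1)])+
    then show "F V1 e1 (\<^bold>\<forall>k\<^bold>:T0. \<^bold>\<exists>m\<^bold>:T0. \<^bold>\<forall>n\<^bold>:T0. m \<^bold>\<le> n \<^bold>\<longrightarrow>
           rdist (x \<cdot> n \<cdot> y) (f \<cdot> y) <\<^sub>R rconst (qeps k))
      (\<forall>k. \<exists>m. \<forall>n. m \<le> n \<longrightarrow> near (ap (ap g (of_n n)) u) (ap h u) k)"
      using u(2)
      by - (assumption | rule F_all0 F_ex0 F_imp F_le0 F_near | erule extends_world | erule (1) T_mono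
        | erule (2) T_mono2 | erule (3) T_mono3 | rule T_app[where \<rho> = T1] T_app[where \<rho> = T0])+
  qed
  show "F V' e' ((\<^bold>\<forall>n\<^bold>:T0. unit_function (x \<cdot> n) \<^bold>\<and> (\<^bold>\<forall>\<^sub>I y. continuous_at (x \<cdot> n) y)) \<^bold>\<and>
        (\<^bold>\<forall>\<^sub>I y. \<^bold>\<forall>k\<^bold>:T0. \<^bold>\<exists>m\<^bold>:T0. \<^bold>\<forall>n\<^bold>:T0. m \<^bold>\<le> n \<^bold>\<longrightarrow> rdist (x \<cdot> n \<cdot> y) (f \<cdot> y) <\<^sub>R rconst (qeps k)))
      ((\<forall>n. unitfun (ap g (of_n n)) \<and> (\<forall>u\<in>D T1. isunit u \<longrightarrow> contat (ap g (of_n n)) u)) \<and>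
       (\<forall>u\<in>D T1. isunit u \<longrightarrow> (\<forall>k. \<exists>m. \<forall>n. m \<le> n \<longrightarrow> near (ap (ap g (of_n n)) u) (ap h u) k)))"
    by (rule F_conj[OF 1 2])
qed

lemma F_dense:
  assumes "world V e" "T V e f (T1 \<rightarrow> T1) h"
  shows "F V e (dense_in_unit_interval (\<lambda>x. continuous_at f x)) (isdense (contat h))"
  unfolding dense_in_unit_interval_def isdense_def using assms
  by - (assumption | rule F_all_unit F_all0 F_ex_unit F_conj F_continuous_at F_near
    | erule extends_world | erule (1) T_mono | erule (2) T_mono2 | erule (3) T_mono3)+

text \<open>Transfers the task from formulas to objects of the model: what remains is a statement of
  the metalogic about \<open>D (T1 \<rightarrow> T1)\<close>.\<close>

lemma sat_goal:
  assumes "\<And>h. h \<in> D (T1 \<rightarrow> T1) \<Longrightarrow> unitfun h \<Longrightarrow> isbaire1 h \<Longrightarrow> isdense (contat h)" "valid e"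
  shows "sat e (at_depth_0 baire1_bv_continuity_dense)"
proof -
  have w: "world {} e" "fresh {} 0" using assms(2) by (simp_all add: world_def fresh_def)
  have "sat (e((0, T1 \<rightarrow> T1) := h)) ((unit_function x \<^bold>\<and> baire1 x \<^bold>\<and> bounded_variation x \<^bold>\<longrightarrow>
      dense_in_unit_interval (\<lambda>y. continuous_at x y)) (Suc 0))"
    if h: "h \<in> D (T1 \<rightarrow> T1)" and x: "x = cst (Var 0 (T1 \<rightarrow> T1))" for h x
  proof -
    note h' = extends_variable[OF w h, folded x]
    have "sat (e((0, T1 \<rightarrow> T1) := h)) (unit_function x (Suc 0)) = unitfun h"
      using F_unit_function[OF extends_world[OF h'(1)] h'(2)] h'(3) by (simp add: F_def)
    moreover have "sat (e((0, T1 \<rightarrow> T1) := h)) (baire1 x (Suc 0)) = isbaire1 h"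
      using F_baire1[OF extends_world[OF h'(1)] h'(2)] h'(3) by (simp add: F_def)
    moreover have "sat (e((0, T1 \<rightarrow> T1) := h)) (dense_in_unit_interval (\<lambda>y. continuous_at x y) (Suc 0)) = isdense (contat h)"
      using F_dense[OF extends_world[OF h'(1)] h'(2)] h'(3) by (simp add: F_def)
    ultimately show ?thesis
      using assms(1)[OF h] by (auto simp: imp_fm_def conj_fm_def neg_fm_def fls_fm_def simp del: fun_upd_apply)
  qed
  then show ?thesis by (simp add: at_depth_0_def baire1_bv_continuity_dense_def all_fm_def)
qed

end

context arithmetic_model
begin

section \<open>Distances between reals\<close>

text \<open>A non-strict bound on the distance by any field element, tested at every approximation.
  In contrast to \<open>near\<close>, which only knows powers of 1/2, these bounds can be added, so
  the estimates are carried out with them.\<close>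

definition dl :: "'v \<Rightarrow> 'v \<Rightarrow> 'n differences fract \<Rightarrow> bool" where
  "dl u w \<delta> \<longleftrightarrow> (\<forall>m. \<bar>approx u m - approx w m\<bar> \<le> \<delta> + (eps m + eps m))"

lemma isreal_le: "isreal u \<Longrightarrow> m \<le> n \<Longrightarrow> \<bar>approx u m - approx u n\<bar> < eps m"
  unfolding isreal_def by (metis add_monusN)

lemma eps_less: "m < n \<Longrightarrow> eps n < eps m"
  using eps_mono[of "m + 1" n] eps_succ[of m] eps_pos[of "m + 1"] by (simp add: succ_leN)

text \<open>The index \<open>n + 1\<close> that witnesses \<open>near\<close> is compared with
  \<open>m\<close> by the modulus at the smaller of the two. If that is \<open>m\<close>, the two
  errors fit the definition of \<open>dl\<close>; otherwise the reserve \<open>eps n + eps n\<close>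
  absorbs them.\<close>

lemma near_dl:
  assumes "isreal u" "isreal w" "near u w k"
  shows "dl u w (eps k)"
  unfolding dl_def
proof
  fix m
  obtain n where n: "\<bar>approx u (n + 1) - approx w (n + 1)\<bar> + (eps n + eps n) < eps k"
    using assms(3) by (auto simp: near_def)
  have pos: "0 < eps m" "0 < eps n" by (rule eps_pos)+
  show "\<bar>approx u m - approx w m\<bar> \<le> eps k + (eps m + eps m)"
  proof (cases "m \<le> n + 1")
    case True
    show ?thesis using isreal_le[OF assms(1) True] isreal_le[OF assms(2) True] n pos by linarith
  next
    case False
    then have m: "n + 1 \<le> m" by simp
    have "eps (n + 1) \<le> eps n" by (rule eps_add_mono)
    then show ?thesis using isreal_le[OF assms(1) m] isreal_le[OF assms(2) m] n pos by linarith
  qed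
qed

lemma dl_near:
  assumes "dl u w \<delta>" "\<delta> < eps k"
  shows "near u w k"
proof -
  \<comment> \<open>A quarter of the gap: two errors come from \<open>dl\<close> and two from the
    margin in \<open>near\<close>.\<close>
  obtain n where "eps n < (eps k - \<delta>) / 4" using archimedean[of "(eps k - \<delta>) / 4"] assms(2) by auto
  then have n: "4 * eps n < eps k - \<delta>" by (simp add: less_divide_eq mult.commute)
  have "\<bar>approx u (n + 1) - approx w (n + 1)\<bar> \<le> \<delta> + (eps (n + 1) + eps (n + 1))"
    using assms(1) by (simp only: dl_def)
  moreover have "eps (n + 1) \<le> eps n" by (rule eps_add_mono)
  ultimately have "\<bar>approx u (n + 1) - approx w (n + 1)\<bar> + (eps n + eps n) < eps k"
    using n by linarith
  then show ?thesis by (auto simp: near_def)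
qed

lemma dl_mono: "dl u w a \<Longrightarrow> a \<le> b \<Longrightarrow> dl u w b"
  unfolding dl_def by (meson add_right_mono order_trans)

lemma dl_sym: "dl u w a \<Longrightarrow> dl w u a"
  unfolding dl_def by (simp add: abs_minus_commute)

text \<open>Both bounds are read at one late index \<open>?M\<close>, where their four errors
  together stay below an arbitrary \<open>eps n\<close>. Moving the endpoints from \<open>m\<close>
  to \<open>?M\<close> costs \<open>eps m\<close> each, which the definition of \<open>dl\<close>
  allows.\<close>

lemma dl_trans:
  assumes "isreal u" "isreal x" "dl u w a" "dl w x b"
  shows "dl u x (a + b)"
  unfolding dl_def
proof
  fix m
  show "\<bar>approx u m - approx x m\<bar> \<le> a + b + (eps m + eps m)"
  proof (rule le_by_eps)
    fix n
    let ?M = "m + (n + 1 + 1)"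
    have "eps ?M \<le> eps (n + 1 + 1)" by (rule eps_mono) (simp add: add_increasing)
    then have e: "4 * eps ?M \<le> eps n" using eps_succ[of n] eps_succ[of "n + 1"] by linarith
    have M: "m \<le> ?M" by (simp add: add_increasing2)
    have "\<bar>approx u ?M - approx w ?M\<bar> \<le> a + (eps ?M + eps ?M)" "\<bar>approx w ?M - approx x ?M\<bar> \<le> b + (eps ?M + eps ?M)"
      using assms(3,4) unfolding dl_def by blast+
    then show "\<bar>approx u m - approx x m\<bar> \<le> a + b + (eps m + eps m) + eps n"
      using isreal_le[OF assms(1) M] isreal_le[OF assms(2) M] e by linarith
  qed
qed

lemma isunit_real: "isunit u \<Longrightarrow> isreal u"
  by (simp add: isunit_def)

definition rc :: "'n \<Rightarrow> 'v" where "rc q = ap (I (Kc T0 T0)) (of_n q)"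

lemma rc_D [simp]: "rc q \<in> D T1"
  unfolding rc_def by (rule ap_D[OF K_D of_n_D])

lemma approx_rc [simp]: "approx (rc q) n = val q"
  by (simp add: approx_def val1_def rc_def K[OF of_n_D of_n_D])

lemma isreal_rc [simp]: "isreal (rc q)"
  by (simp add: isreal_def eps_pos)

lemma isunit_rc: "0 \<le> val q \<Longrightarrow> val q \<le> 1 \<Longrightarrow> isunit (rc q)"
  unfolding isunit_def not_ex not_less
  by (simp add: less_imp_le[OF eps_pos] add_nonneg_nonneg add_increasing2)

lemma dl_rc: "dl (rc p) (rc q) \<delta> \<longleftrightarrow> \<bar>val p - val q\<bar> \<le> \<delta>"
proof
  assume dl: "dl (rc p) (rc q) \<delta>"
  show "\<bar>val p - val q\<bar> \<le> \<delta>"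
  proof (rule le_by_eps)
    fix n
    have "\<bar>approx (rc p) (n + 1) - approx (rc q) (n + 1)\<bar> \<le> \<delta> + (eps (n + 1) + eps (n + 1))"
      using dl unfolding dl_def by blast
    then show "\<bar>val p - val q\<bar> \<le> \<delta> + eps n" using eps_succ[of n] by simp
  qed
next
  assume "\<bar>val p - val q\<bar> \<le> \<delta>"
  moreover have "0 \<le> eps m + eps m" for m using eps_pos[of m] by simp
  ultimately show "dl (rc p) (rc q) \<delta>" unfolding dl_def by (simp add: add_increasing2)
qed

lemma dl_approx: "isreal u \<Longrightarrow> dl u (rc (u \<star> m)) (eps m)"
  unfolding dl_def
proof
  fix n assume u: "isreal u"
  have pos: "0 < eps n" "0 < eps m" by (rule eps_pos)+
  show "\<bar>approx u n - approx (rc (u \<star> m)) n\<bar> \<le> eps m + (eps n + eps n)"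
    using isreal_le[OF u, of n m] isreal_le[OF u, of m n] pos linear[of n m]
    by (auto simp: approx_def[symmetric] simp del: abs_le_iff abs_less_iff)
qed

lemma rational_near:
  assumes "isunit x"
  obtains q where "0 \<le> val q" "val q \<le> 1" "dl x (rc q) (eps M)"
proof -
  let ?m = "M + 1 + 1"
  let ?a = "approx x ?m"
  have a: "- (eps ?m + eps ?m) \<le> ?a" "?a \<le> 1 + (eps ?m + eps ?m)"
    using assms unfolding isunit_def not_ex not_less by (metis add.commute add_le_cancel_left add.right_inverse diff_0 diff_le_eq, metis)
  \<comment> \<open>Approximations to a point of the interval may leave it by
    \<open>2 * eps ?m\<close>, and clamping costs no more. With the error \<open>eps ?m\<close> of
    the approximation the total is 3 units, against the 4 in \<open>eps M\<close>.\<close>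
  obtain q where q: "val q = max 0 (min 1 ?a)" using val_surj by blast
  have e: "eps M = 4 * eps ?m" using eps_succ[of M] eps_succ[of "M + 1"] by linarith
  have pos: "0 < eps ?m" by (rule eps_pos)
  have qa: "\<bar>?a - val q\<bar> \<le> 2 * eps ?m" using a pos unfolding q by linarith
  have "dl x (rc q) (eps M)"
    unfolding dl_def
  proof
    fix n
    have "\<bar>approx x n - approx (rc (x \<star> ?m)) n\<bar> \<le> eps ?m + (eps n + eps n)"
      using dl_approx[OF isunit_real[OF assms], of ?m] unfolding dl_def by blast
    then have "\<bar>approx x n - ?a\<bar> \<le> eps ?m + (eps n + eps n)"
      by (simp only: approx_rc approx_def[of x ?m, symmetric])
    then show "\<bar>approx x n - approx (rc q) n\<bar> \<le> eps M + (eps n + eps n)"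
      using qa e pos unfolding approx_rc by linarith
  qed
  then show thesis using that[of q] q by simp
qed


section \<open>Nested balls\<close>

text \<open>A rational has many codes; working with field values hides the choice and lets decidable
  conditions be written with ordinary arithmetic.\<close>

definition qdf :: "('n \<Rightarrow> 'n differences fract) \<Rightarrow> bool" where
  "qdf x \<longleftrightarrow> (\<exists>f. dfn f \<and> (\<forall>p. x p = val (f p)))"

lemma qdf_val: "dfn f \<Longrightarrow> qdf (\<lambda>p. val (f p))"
  by (auto simp: qdf_def)

lemma qdf_const: "qdf (\<lambda>p. c)"
  using val_surj[of c] qdf_val[OF dfn_const] by auto

lemma qdf_eps: "dfn f \<Longrightarrow> qdf (\<lambda>p. eps (f p))"
  unfolding eps_def by (intro qdf_val dfn_comp[OF dfn_qeps])

lemma qdf_add: "qdf x \<Longrightarrow> qdf y \<Longrightarrow> qdf (\<lambda>p. x p + y p)"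
proof -
  assume "qdf x" "qdf y"
  then obtain f g where "dfn f" "dfn g" "x = (\<lambda>p. val (f p))" "y = (\<lambda>p. val (g p))"
    by (auto simp: qdf_def fun_eq_iff)
  then show ?thesis using qdf_val[OF dfn_bin[OF dfn2_qadd], of f g] by (simp add: val_qaddN)
qed

lemma qdf_diff: "qdf x \<Longrightarrow> qdf y \<Longrightarrow> qdf (\<lambda>p. x p - y p)"
proof -
  assume x: "qdf x" and "qdf y"
  then obtain g where g: "dfn g" "y = (\<lambda>p. val (g p))" by (auto simp: qdf_def fun_eq_iff)
  then have "qdf (\<lambda>p. - y p)"
    using qdf_val[OF dfn_comp[OF dfn_quminus g(1)]] by (simp add: val_quminusN)
  from qdf_add[OF x this] show ?thesis by simp
qed

lemma qdf_abs: "qdf x \<Longrightarrow> qdf (\<lambda>p. \<bar>x p\<bar>)"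
proof -
  assume "qdf x"
  then obtain g where g: "dfn g" "x = (\<lambda>p. val (g p))" by (auto simp: qdf_def fun_eq_iff)
  then show ?thesis using qdf_val[OF dfn_comp[OF dfn_qabs g(1)]] by (simp add: val_qabsN)
qed

lemma decd_qle: "qdf x \<Longrightarrow> qdf y \<Longrightarrow> decd (\<lambda>p. x p \<le> y p)"
  using decd_val_le by (auto simp: qdf_def)

lemma decd_qless: "qdf x \<Longrightarrow> qdf y \<Longrightarrow> decd (\<lambda>p. x p < y p)"
  using decd_val_less by (auto simp: qdf_def)

text \<open>Decides arithmetical conditions by following their syntax; each number quantifier is
  coded into the argument and recovered with \<open>fstN\<close> and \<open>sndN\<close>.\<close>

lemmas decd_intros = decd_ex decd_all decd_imp decd_conj decd_le decd_less decd_qle decd_qless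
  qdf_add qdf_diff qdf_abs qdf_eps qdf_val dfn_plus dfn_pair dfn_fst dfn_snd dfn_id

text \<open>The number \<open>pairN c r\<close> codes the ball with center \<open>val c\<close> and radius \<open>eps r\<close>.\<close>

definition cen :: "'n \<Rightarrow> 'n differences fract" where "cen b = val (fstN b)"
definition rad :: "'n \<Rightarrow> 'n differences fract" where "rad b = eps (sndN b)"
definition ball :: "'n \<Rightarrow> bool" where "ball b \<longleftrightarrow> 0 \<le> cen b \<and> cen b \<le> 1"

text \<open>The radius counts twice, so points of the smaller ball keep the distance
  \<open>rad b'\<close> from the boundary of the larger one. This slack later absorbs the errors of
  rational approximation.\<close>

definition inner :: "'n \<Rightarrow> 'n \<Rightarrow> bool" where
  "inner b' b \<longleftrightarrow> \<bar>cen b' - cen b\<bar> + (rad b' + rad b') \<le> rad b"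

definition inb :: "'n \<Rightarrow> 'n \<Rightarrow> bool" where
  "inb q b \<longleftrightarrow> 0 \<le> val q \<and> val q \<le> 1 \<and> \<bar>val q - cen b\<bar> \<le> rad b"

lemma cen_rad [simp]: "cen (pairN c r) = val c" "rad (pairN c r) = eps r"
  by (simp_all add: cen_def rad_def)

text \<open>The common core of both uses of nested balls, with \<open>P k\<close> as the requirement
  met at stage \<open>k\<close>. The slack \<open>eps s\<close> in the last conclusion ensures that
  rationals close enough to the limit still lie in the ball.\<close>

lemma nested_balls:
  assumes P: "decd (\<lambda>p. P (fstN p) (sndN p))" and b0: "ball b0"
    and step: "\<And>k b. ball b \<Longrightarrow> \<bar>cen b - cen b0\<bar> + rad b \<le> rad b0 \<Longrightarrow>
      \<exists>b'. ball b' \<and> inner b' b \<and> k < sndN b' \<and> P k b'"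
  obtains x where "x \<in> D T1" "isunit x" "dl x (rc (fstN b0)) (rad b0)"
    "\<And>k. \<exists>b s. P k b \<and> dl x (rc (fstN b)) (rad b - eps s)"
proof -
  define S where "S b \<longleftrightarrow> ball b \<and> \<bar>cen b - cen b0\<bar> + rad b \<le> rad b0" for b
  \<comment> \<open>Choice asks for a value at every argument, so the requirement is vacuous for
    codes other than balls inside \<open>b0\<close>.\<close>
  define Q where "Q p b' \<longleftrightarrow> (S (sndN p) \<longrightarrow>
    ball b' \<and> inner b' (sndN p) \<and> fstN p < sndN b' \<and> P (fstN p) b')" for p b'
  have P': "decd (\<lambda>p. P (fstN (fstN p)) (sndN p))"
    using decd_comp[OF P dfn_pair[OF dfn_fst[OF dfn_fst[OF dfn_id]] dfn_snd[OF dfn_id]]] by simp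
  have "decd (\<lambda>p. Q (fstN p) (sndN p))"
    unfolding Q_def S_def ball_def inner_def cen_def rad_def
    by (intro P' decd_intros qdf_const)
  then obtain h where h: "dfn h" "\<And>p. Q p (h p)"
    using choice[of Q] step by (auto simp: Q_def S_def)
  obtain s where s: "dfn s" "s 0 = b0" "\<And>n. s (n + 1) = h (pairN n (s n))"
    using sequence[OF h(1)] by blast
  have rad_pos: "0 < rad b" for b by (simp add: rad_def eps_pos)
  have next_ball: "ball (s (n + 1)) \<and> inner (s (n + 1)) (s n) \<and> n < sndN (s (n + 1)) \<and> P n (s (n + 1))"
    if "S (s n)" for n
    using h(2)[of "pairN n (s n)"] that by (simp add: Q_def s(3))
  have S: "S (s n)" for n
  proof (rule decd_induct[where P = "\<lambda>n. S (s n)"])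
    show "decd (\<lambda>n. S (s n))"
      unfolding S_def ball_def cen_def rad_def by (intro s(1) decd_intros qdf_const)
    show "S (s 0)" using b0 by (simp add: S_def s(2))
    fix n assume n: "S (s n)"
    then have "\<bar>cen (s n) - cen b0\<bar> + rad (s n) \<le> rad b0" by (simp add: S_def)
    moreover have "\<bar>cen (s (n + 1)) - cen (s n)\<bar> + (rad (s (n + 1)) + rad (s (n + 1))) \<le> rad (s n)"
      using next_ball[OF n] by (simp add: inner_def)
    ultimately have "\<bar>cen (s (n + 1)) - cen b0\<bar> + rad (s (n + 1)) \<le> rad b0"
      using rad_pos[of "s (n + 1)"] by linarith
    then show "S (s (n + 1))" using next_ball[OF n] by (simp add: S_def)
  qed
  have inner: "\<bar>cen (s (n + 1)) - cen (s n)\<bar> + (rad (s (n + 1)) + rad (s (n + 1))) \<le> rad (s n)" for n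
    using next_ball[OF S] by (simp add: inner_def)
  \<comment> \<open>Telescoping of the preceding estimate, by induction inside the model; the
    condition is decidable because \<open>s\<close> is definable.\<close>
  have tail: "\<bar>cen (s (n + i)) - cen (s n)\<bar> + rad (s (n + i)) \<le> rad (s n)" for n i
  proof (rule decd_induct[where P = "\<lambda>i. \<bar>cen (s (n + i)) - cen (s n)\<bar> + rad (s (n + i)) \<le> rad (s n)"])
    show "decd (\<lambda>i. \<bar>cen (s (n + i)) - cen (s n)\<bar> + rad (s (n + i)) \<le> rad (s n))"
      unfolding cen_def rad_def
      by (intro decd_qle qdf_add qdf_abs qdf_diff qdf_val qdf_eps dfn_fst dfn_snd dfn_comp[OF s(1)]
          dfn_plus dfn_const dfn_id qdf_const)
    fix i assume "\<bar>cen (s (n + i)) - cen (s n)\<bar> + rad (s (n + i)) \<le> rad (s n)"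
    then have "\<bar>cen (s (n + i + 1)) - cen (s n)\<bar> + rad (s (n + i + 1)) \<le> rad (s n)"
      using inner[of "n + i"] rad_pos[of "s (n + i + 1)"] by linarith
    then show "\<bar>cen (s (n + (i + 1))) - cen (s n)\<bar> + rad (s (n + (i + 1))) \<le> rad (s n)"
      by (simp only: add.assoc)
  qed simp
  have tail_le: "\<bar>cen (s m) - cen (s n)\<bar> + rad (s m) \<le> rad (s n)" if "n \<le> m" for m n
    using tail[of n "monusN m n"] that by (simp only: add_monusN)
  have rad_eps: "rad (s (n + 1)) \<le> eps n" for n
    using next_ball[OF S] by (simp add: rad_def eps_less less_imp_le)
  \<comment> \<open>The shift by one gives the rate of convergence required of a real: the radius of
    \<open>s (n + 1)\<close> is at most \<open>eps n\<close>.\<close>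
  have "dfn (\<lambda>n. fstN (s (n + 1)))" by (intro dfn_fst dfn_comp[OF s(1)] dfn_plus dfn_id dfn_const)
  then obtain x where x: "x \<in> D T1" "\<And>n. x \<star> n = fstN (s (n + 1))" by (rule dfn_obtain) blast
  have ax: "approx x n = cen (s (n + 1))" for n by (simp add: approx_def x(2) cen_def)
  have "isreal x"
    unfolding isreal_def
  proof (intro allI)
    fix n i :: 'n
    have "n + 1 \<le> n + i + 1" by (simp add: add_increasing2)
    from tail_le[OF this] show "\<bar>approx x n - approx x (n + i)\<bar> < eps n"
      unfolding ax using rad_eps[of n] rad_pos[of "s (n + i + 1)"] by linarith
  qed
  moreover have "0 \<le> approx x n \<and> approx x n \<le> 1" for n
    unfolding ax using S by (simp add: S_def ball_def)
  ultimately have unit: "isunit x"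
    unfolding isunit_def not_ex not_less
    using eps_pos by (simp add: add_nonneg_nonneg add_increasing2 less_imp_le)
  \<comment> \<open>The later centers all lie in the next ball, and the radius of that ball is the
    slack.\<close>
  have lim: "dl x (rc (fstN (s n))) (rad (s n) - rad (s (n + 1)))" for n
    unfolding dl_def approx_rc ax cen_def[symmetric]
  proof
    fix m
    have pos: "0 < eps m" "0 < rad (s (n + 1))" "0 < rad (s (m + 1))" "0 < rad (s n)"
      by (rule eps_pos rad_pos)+
    show "\<bar>cen (s (m + 1)) - cen (s n)\<bar> \<le> rad (s n) - rad (s (n + 1)) + (eps m + eps m)"
    proof (cases "n + 1 \<le> m + 1")
      case True
      show ?thesis using tail_le[OF True] inner[of n] pos by linarith
    next
      case False
      then have "m + 1 \<le> n" by (simp add: not_le succ_leN)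
      from tail_le[OF this] show ?thesis using rad_eps[of m] inner[of n] pos by linarith
    qed
  qed
  have "dl x (rc (fstN b0)) (rad b0)"
    using dl_mono[OF lim[of 0]] rad_pos[of "s (0 + 1)"] by (simp add: s(2) less_imp_le)
  moreover have "\<exists>b t. P k b \<and> dl x (rc (fstN b)) (rad b - eps t)" for k
    using lim[of "k + 1"] next_ball[OF S, of k] unfolding rad_def[of "s (k + 1 + 1)"] by blast
  ultimately show thesis using that x(1) unit by blast
qed


section \<open>Points of continuity of functions of Baire class 1\<close>

context
  fixes g h :: 'v
  assumes g: "g \<in> D (T0 \<rightarrow> T1 \<rightarrow> T1)" and h: "h \<in> D (T1 \<rightarrow> T1)"
    and h_unit: "unitfun h" and g_unit: "\<And>n. unitfun (ap g (of_n n))"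
    and g_cont: "\<And>n u. u \<in> D T1 \<Longrightarrow> isunit u \<Longrightarrow> contat (ap g (of_n n)) u"
    and lim: "\<And>u k. u \<in> D T1 \<Longrightarrow> isunit u \<Longrightarrow> \<exists>m. \<forall>n. m \<le> n \<longrightarrow> near (ap (ap g (of_n n)) u) (ap h u) k"
begin

definition G :: "'n \<Rightarrow> 'v \<Rightarrow> 'v" where "G n u = ap (ap g (of_n n)) u"
text \<open>Values at rational points enter decidable conditions through the code of their
  \<open>j\<close>-th approximation, a number instead of an object of type 1.\<close>

definition gam :: "'n \<Rightarrow> 'n \<Rightarrow> 'n \<Rightarrow> 'n" where "gam n q j = G n (rc q) \<star> j"

lemma G_D: "u \<in> D T1 \<Longrightarrow> G n u \<in> D T1"
  unfolding G_def by (rule ap_D[OF ap_D[OF g of_n_D]])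

lemma G_real: "u \<in> D T1 \<Longrightarrow> isunit u \<Longrightarrow> isreal (G n u)"
  using g_unit[of n] unfolding unitfun_def G_def by blast

lemma h_real: "u \<in> D T1 \<Longrightarrow> isunit u \<Longrightarrow> isreal (ap h u)"
  using h_unit unfolding unitfun_def by blast

text \<open>Continuity restated for \<open>dl\<close>: the strict \<open>M < r\<close> pays for
  turning a non-strict bound back into \<open>near\<close>.\<close>

lemma G_cont:
  assumes "u \<in> D T1" "isunit u"
  obtains M where "\<And>w r. w \<in> D T1 \<Longrightarrow> isunit w \<Longrightarrow> M < r \<Longrightarrow> dl u w (eps r) \<Longrightarrow> dl (G n u) (G n w) (eps k)"
proof -
  obtain M where M: "\<forall>w\<in>D T1. isunit w \<longrightarrow> near u w M \<longrightarrow> near (G n u) (G n w) k"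
    using g_cont[OF assms, of n] unfolding contat_def G_def by blast
  have "dl (G n u) (G n w) (eps k)" if "w \<in> D T1" "isunit w" "M < r" "dl u w (eps r)" for w r
  proof (rule near_dl)
    show "near (G n u) (G n w) k" using M that(1,2) dl_near[OF that(4) eps_less[OF that(3)]] by blast
  qed (rule G_real assms that)+
  then show thesis using that by blast
qed

lemma G_lim:
  assumes "u \<in> D T1" "isunit u"
  obtains m where "\<And>n. m \<le> n \<Longrightarrow> dl (G n u) (ap h u) (eps k)"
proof -
  obtain m where "\<And>n. m \<le> n \<Longrightarrow> near (G n u) (ap h u) k"
    using lim[OF assms, of k] unfolding G_def by blast
  then have "\<And>n. m \<le> n \<Longrightarrow> dl (G n u) (ap h u) (eps k)"
    using near_dl G_real h_real assms by blast
  then show thesis using that by blast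
qed

lemma dfn_gam: "dfn a \<Longrightarrow> dfn b \<Longrightarrow> dfn c \<Longrightarrow> dfn (\<lambda>p. gam (a p) (b p) (c p))"
proof -
  assume abc: "dfn a" "dfn b" "dfn c"
  have "repn T0 (\<lambda>p. ap (ap (ap g (of_n (a p))) (ap (I (Kc T0 T0)) (of_n (b p)))) (of_n (c p)))"
    using abc unfolding dfn_def by (intro repn_app[OF repn_app[OF repn_comp[OF g] repn_comp[OF K_D]]])
  moreover have "ap (ap (ap g (of_n n)) (ap (I (Kc T0 T0)) (of_n q))) (of_n j) = of_n (gam n q j)" for n q j
    using val1[OF G_D[OF rc_D]] by (simp add: gam_def G_def rc_def)
  ultimately show ?thesis by (simp add: dfn_def)
qed

text \<open>Four halvings, so \<open>eps k\<close> is 16 of the new units. In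
  \<open>good_ball\<close> 3 units are lost in moving a point for one function, 6 in moving a point
  for two functions, and 7 must remain.\<close>

definition level :: "'n \<Rightarrow> 'n" where "level k = k + 1 + 1 + 1 + 1"

lemma eps_level: "eps k = 16 * eps (level k)"
  unfolding level_def using eps_succ[of k] eps_succ[of "k + 1"] eps_succ[of "k + 1 + 1"] eps_succ[of "k + 1 + 1 + 1"]
  by linarith

text \<open>
  On a good ball of level \<open>k\<close> all but finitely many \<open>G n\<close> have oscillation of order \<open>eps k\<close>.  Values
  are taken at rational points, and only approximately, to keep the condition arithmetical.
\<close>

definition good :: "'n \<Rightarrow> 'n \<Rightarrow> bool" where
  "good k b \<longleftrightarrow> (\<exists>m v. \<forall>n q. m \<le> n \<longrightarrow> inb q b \<longrightarrow> \<bar>val (gam n q (level k)) - val v\<bar> \<le> eps k)"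

lemma decd_good: "decd (\<lambda>p. good (fstN p) (sndN p))"
  unfolding good_def inb_def cen_def rad_def level_def
  by (intro decd_intros dfn_gam dfn_const qdf_const)

lemma gam_diff: "dl (G n u) (G n' w) \<delta> \<Longrightarrow> u = rc p \<Longrightarrow> w = rc q \<Longrightarrow>
    \<bar>val (gam n p j) - val (gam n' q j)\<bar> \<le> \<delta> + (eps j + eps j)"
  unfolding dl_def gam_def approx_def by blast

lemma inb_dl: "inb q b \<Longrightarrow> dl (rc (fstN b)) (rc q) (rad b)"
  by (simp add: dl_rc inb_def cen_def abs_minus_commute)

lemma inbI:
  assumes "0 \<le> val q" "val q \<le> 1" "isunit u" "dl u (rc q) a" "dl u (rc (fstN b)) c" "a + c \<le> rad b"
  shows "inb q b"
proof -
  have "dl (rc q) (rc (fstN b)) (a + c)" by (rule dl_trans[OF _ _ dl_sym[OF assms(4)] assms(5)]) simp_all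
  then show ?thesis using assms by (simp add: inb_def cen_def dl_rc)
qed

lemma good_ball:
  assumes b0: "ball b0"
  shows "\<exists>b. ball b \<and> inner b b0 \<and> k < sndN b \<and> good k b"
proof (rule ccontr)
  assume "\<not> ?thesis"
  then have bad: "\<not> good k b" if "ball b" "inner b b0" "k < sndN b" for b using that by blast
  let ?K = "level k"
  let ?e = "eps ?K"
  \<comment> \<open>The bound 7 is the least whole number of units above the 6 that convergence and
    approximation can account for at the limit point.\<close>
  define P where "P m b \<longleftrightarrow> (\<exists>n. m \<le> n \<and> (\<forall>q. inb q b \<longrightarrow> 7 * ?e < \<bar>val (gam n q ?K) - val (gam m q ?K)\<bar>))" for m b
  have "decd (\<lambda>p. P (fstN p) (sndN p))"
    unfolding P_def inb_def cen_def rad_def by (intro decd_intros dfn_gam dfn_const qdf_const)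
  then obtain x where x: "x \<in> D T1" "isunit x" "\<And>m. \<exists>b s. P m b \<and> dl x (rc (fstN b)) (rad b - eps s)"
  proof (rule nested_balls[OF _ b0])
    fix m b assume b: "ball b" "\<bar>cen b - cen b0\<bar> + rad b \<le> rad b0"
    let ?c = "fstN b"
    have c: "0 \<le> val ?c" "val ?c \<le> 1" using b(1) by (simp_all add: ball_def cen_def)
    obtain M1 where M1: "\<And>w r. w \<in> D T1 \<Longrightarrow> isunit w \<Longrightarrow> M1 < r \<Longrightarrow> dl (rc ?c) w (eps r) \<Longrightarrow>
        dl (G m (rc ?c)) (G m w) ?e"
      using G_cont[OF rc_D isunit_rc[OF c]] by blast
    \<comment> \<open>A sum of three lower bounds dominates each: they yield half the radius of
      \<open>b\<close>, the bound \<open>k\<close>, and the continuity of \<open>G m\<close> at the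
      center.\<close>
    define r1 where "r1 = (sndN b + 1) + (k + 1) + (M1 + 1)"
    have r1: "sndN b + 1 \<le> r1" "k + 1 \<le> r1" "M1 + 1 \<le> r1"
      by (simp_all add: r1_def add_increasing add_increasing2)
    have e1: "eps r1 + eps r1 \<le> rad b" using eps_mono[OF r1(1)] eps_succ[of "sndN b"] by (simp add: rad_def)
    let ?b1 = "pairN ?c r1"
    have "\<not> good k ?b1"
    proof (rule bad)
      show "ball ?b1" using c by (simp add: ball_def)
      show "inner ?b1 b0" using b(2) e1 by (simp add: inner_def cen_def[of b])
      show "k < sndN ?b1" using r1(2) by (simp add: succ_leN)
    qed
    \<comment> \<open>The failure of \<open>good\<close> is applied with \<open>m\<close> as
      threshold and with the approximation to \<open>G m\<close> at the center as constant.\<close>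
    then obtain n q where n: "m \<le> n" and q: "inb q ?b1"
      and far: "eps k < \<bar>val (gam n q ?K) - val (gam m ?c ?K)\<bar>"
      unfolding good_def by (meson not_le)
    have q01: "0 \<le> val q" "val q \<le> 1" and qc: "\<bar>val q - cen b\<bar> \<le> eps r1"
      using q by (simp_all add: inb_def cen_def[of b])
    have "dl (G m (rc ?c)) (G m (rc q)) ?e"
      using M1[OF rc_D isunit_rc[OF q01], of r1] inb_dl[OF q] r1(3) by (simp add: succ_leN)
    from gam_diff[OF this refl refl, of ?K]
    \<comment> \<open>Of 16 units, one is lost to the variation of \<open>G m\<close> between the
      center and \<open>q\<close>, and two to the approximations.\<close>
    have far': "13 * ?e < \<bar>val (gam n q ?K) - val (gam m q ?K)\<bar>"
      using far eps_level[of k] by linarith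
    obtain M2 where M2: "\<And>w r. w \<in> D T1 \<Longrightarrow> isunit w \<Longrightarrow> M2 < r \<Longrightarrow> dl (rc q) w (eps r) \<Longrightarrow>
        dl (G n (rc q)) (G n w) ?e"
      using G_cont[OF rc_D isunit_rc[OF q01]] by blast
    obtain M3 where M3: "\<And>w r. w \<in> D T1 \<Longrightarrow> isunit w \<Longrightarrow> M3 < r \<Longrightarrow> dl (rc q) w (eps r) \<Longrightarrow>
        dl (G m (rc q)) (G m w) ?e"
      using G_cont[OF rc_D isunit_rc[OF q01]] by blast
    \<comment> \<open>The first summand gives \<open>4 * eps r2 \<le> rad b\<close>: since
      \<open>q\<close> is at most half the radius away from the center, the doubled radius in
      \<open>inner\<close> fits into the other half.\<close>
    define r2 where "r2 = (sndN b + 1 + 1) + (m + 1) + (M2 + 1) + (M3 + 1)"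
    have r2: "sndN b + 1 + 1 \<le> r2" "m + 1 \<le> r2" "M2 + 1 \<le> r2" "M3 + 1 \<le> r2"
      by (simp_all add: r2_def add_increasing add_increasing2)
    let ?b2 = "pairN q r2"
    have "eps (sndN b) = 4 * eps (sndN b + 1 + 1)" using eps_succ[of "sndN b"] eps_succ[of "sndN b + 1"] by linarith
    then have e2: "4 * eps r2 \<le> rad b" using eps_mono[OF r2(1)] by (simp add: rad_def)
    have "P m ?b2"
      unfolding P_def
    proof (intro exI[of _ n] conjI n allI impI)
      fix q' assume q': "inb q' ?b2"
      then have q'01: "0 \<le> val q'" "val q' \<le> 1" by (simp_all add: inb_def)
      have "dl (G n (rc q)) (G n (rc q')) ?e" "dl (G m (rc q)) (G m (rc q')) ?e"
        using M2[OF rc_D isunit_rc[OF q'01], of r2] M3[OF rc_D isunit_rc[OF q'01], of r2] inb_dl[OF q'] r2(3,4)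
        by (simp_all add: succ_leN)
      from gam_diff[OF this(1) refl refl, of ?K] gam_diff[OF this(2) refl refl, of ?K]
      \<comment> \<open>Moving from \<open>q\<close> to \<open>q'\<close> costs 3 units for
        \<open>G n\<close> and 3 for \<open>G m\<close>.\<close>
      show "7 * ?e < \<bar>val (gam n q' ?K) - val (gam m q' ?K)\<bar>" using far' by linarith
    qed
    moreover have "ball ?b2" using q01 by (simp add: ball_def)
    moreover have "inner ?b2 b" unfolding inner_def cen_rad using qc e1 e2 by linarith
    moreover have "m < sndN ?b2" using r2(2) by (simp add: succ_leN)
    ultimately show "\<exists>b'. ball b' \<and> inner b' b \<and> m < sndN b' \<and> P m b'" by blast
  qed blast
  obtain m where m: "\<And>n. m \<le> n \<Longrightarrow> dl (G n x) (ap h x) ?e" using G_lim[OF x(1,2)] by blast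
  obtain b s where Pm: "P m b" and xb: "dl x (rc (fstN b)) (rad b - eps s)" using x(3) by blast
  obtain n where n: "m \<le> n" "\<And>q. inb q b \<Longrightarrow> 7 * ?e < \<bar>val (gam n q ?K) - val (gam m q ?K)\<bar>"
    using Pm unfolding P_def by blast
  obtain M2 where M2: "\<And>w r. w \<in> D T1 \<Longrightarrow> isunit w \<Longrightarrow> M2 < r \<Longrightarrow> dl x w (eps r) \<Longrightarrow> dl (G n x) (G n w) ?e"
    using G_cont[OF x(1,2)] by blast
  obtain M3 where M3: "\<And>w r. w \<in> D T1 \<Longrightarrow> isunit w \<Longrightarrow> M3 < r \<Longrightarrow> dl x w (eps r) \<Longrightarrow> dl (G m x) (G m w) ?e"
    using G_cont[OF x(1,2)] by blast
  define r where "r = s + (M2 + 1) + (M3 + 1)"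
  have r: "s \<le> r" "M2 + 1 \<le> r" "M3 + 1 \<le> r" by (simp_all add: r_def add_increasing add_increasing2)
  obtain q where q: "0 \<le> val q" "val q \<le> 1" "dl x (rc q) (eps r)" using rational_near[OF x(2)] by blast
  have qu: "isunit (rc q)" by (rule isunit_rc[OF q(1,2)])
  \<comment> \<open>The rational \<open>q\<close> is within \<open>eps r\<close> of
    \<open>x\<close>, which is at most the slack \<open>eps s\<close> of \<open>x\<close> in
    \<open>b\<close>.\<close>
  have "inb q b" by (rule inbI[OF q(1,2) x(2) q(3) xb]) (use eps_mono[OF r(1)] in simp)
  then have far: "7 * ?e < \<bar>val (gam n q ?K) - val (gam m q ?K)\<bar>" by (rule n(2))
  have 1: "dl (G n x) (G n (rc q)) ?e" "dl (G m x) (G m (rc q)) ?e"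
    using M2[OF rc_D qu _ q(3)] M3[OF rc_D qu _ q(3)] r(2,3) by (simp_all add: succ_leN)
  note real = G_real[OF x(1,2)] G_real[OF rc_D qu] h_real[OF x(1,2)]
  have "dl (G n (rc q)) (ap h x) (?e + ?e)"
    by (rule dl_trans[OF real(2,3) dl_sym[OF 1(1)] m[OF n(1)]])
  moreover have "dl (ap h x) (G m (rc q)) (?e + ?e)"
    by (rule dl_trans[OF real(3,2) dl_sym[OF m[OF order_refl]] 1(2)])
  ultimately have "dl (G n (rc q)) (G m (rc q)) (?e + ?e + (?e + ?e))"
    by (rule dl_trans[OF real(2,2)])
  \<comment> \<open>Four units on the way through \<open>ap h x\<close> and two for the
    approximations make 6, against the lower bound 7.\<close>
  from gam_diff[OF this refl refl, of ?K] show False using far eps_pos[of ?K] by linarith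
qed

text \<open>Passes from rational points and single \<open>G n\<close> to the limit function at a
  point with slack. The bound collects the steps from \<open>ap h y\<close> to \<open>G n y\<close>,
  to \<open>G n\<close> at a nearby rational, to its approximation, and to \<open>v\<close>.\<close>

lemma good_ball_value:
  assumes good: "\<And>n q. m \<le> n \<Longrightarrow> inb q b \<Longrightarrow> \<bar>val (gam n q (level k)) - val v\<bar> \<le> eps k"
    and y: "y \<in> D T1" "isunit y" "dl y (rc (fstN b)) (rad b - eps s)"
  shows "dl (ap h y) (rc v) (4 * eps k)"
proof -
  obtain m' where m': "\<And>n. m' \<le> n \<Longrightarrow> dl (G n y) (ap h y) (eps k)" using G_lim[OF y(1,2)] by blast
  define n where "n = m + m'"
  have n: "m \<le> n" "m' \<le> n" by (simp_all add: n_def add_increasing add_increasing2)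
  obtain M where M: "\<And>w r. w \<in> D T1 \<Longrightarrow> isunit w \<Longrightarrow> M < r \<Longrightarrow> dl y w (eps r) \<Longrightarrow> dl (G n y) (G n w) (eps k)"
    using G_cont[OF y(1,2)] by blast
  define r where "r = s + (M + 1)"
  have r: "s \<le> r" "M + 1 \<le> r" by (simp_all add: r_def add_increasing add_increasing2)
  obtain q where q: "0 \<le> val q" "val q \<le> 1" "dl y (rc q) (eps r)" using rational_near[OF y(2)] by blast
  have qu: "isunit (rc q)" by (rule isunit_rc[OF q(1,2)])
  have "inb q b" by (rule inbI[OF q(1,2) y(2) q(3) y(3)]) (use eps_mono[OF r(1)] in simp)
  then have v: "dl (rc (gam n q (level k))) (rc v) (eps k)" using good[OF n(1)] by (simp add: dl_rc)
  have 1: "dl (G n y) (G n (rc q)) (eps k)"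
    using M[OF rc_D qu _ q(3)] r(2) by (simp add: succ_leN)
  note real = G_real[OF y(1,2)] G_real[OF rc_D qu] h_real[OF y(1,2)]
  have 2: "dl (ap h y) (G n (rc q)) (eps k + eps k)"
    by (rule dl_trans[OF real(3,2) dl_sym[OF m'[OF n(2)]] 1])
  have "dl (G n (rc q)) (rc (gam n q (level k))) (eps (level k))"
    unfolding gam_def by (rule dl_approx[OF real(2)])
  from dl_trans[OF real(2) isreal_rc this v]
  have "dl (G n (rc q)) (rc v) (eps (level k) + eps k)" .
  from dl_trans[OF real(3) isreal_rc 2 this]
  have "dl (ap h y) (rc v) (eps k + eps k + (eps (level k) + eps k))" .
  then show ?thesis by (rule dl_mono) (use eps_level[of k] eps_pos[of "level k"] in linarith)
qed

lemma dense_continuity: "isdense (contat h)"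
  unfolding isdense_def
proof (intro ballI impI allI)
  fix y and k :: 'n assume y: "y \<in> D T1" "isunit y"
  \<comment> \<open>Two halvings: \<open>y\<close> and the point to be found are both within
    \<open>eps ?r\<close> of \<open>q0\<close>, hence within half of \<open>eps k\<close> of each
    other.\<close>
  let ?r = "k + 1 + 1"
  obtain q0 where q0: "0 \<le> val q0" "val q0 \<le> 1" "dl y (rc q0) (eps ?r)" using rational_near[OF y(2)] by blast
  let ?b0 = "pairN q0 ?r"
  have b0: "ball ?b0" using q0 by (simp add: ball_def)
  obtain x where x: "x \<in> D T1" "isunit x" "dl x (rc (fstN ?b0)) (rad ?b0)"
    "\<And>k. \<exists>b s. good k b \<and> dl x (rc (fstN b)) (rad b - eps s)"
    using nested_balls[OF decd_good b0] good_ball by blast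
  have "dl (rc q0) x (eps ?r)" using dl_sym[OF x(3)] by simp
  from dl_trans[OF isunit_real[OF y(2)] isunit_real[OF x(2)] q0(3) this]
  have "dl y x (eps ?r + eps ?r)" .
  moreover have "eps ?r + eps ?r < eps k" using eps_succ[of k] eps_succ[of "k + 1"] eps_pos[of ?r] by linarith
  ultimately have "near y x k" by (rule dl_near)
  moreover have "contat h x"
    unfolding contat_def
  proof
    fix j
    obtain b s where "good (level j) b" and xb: "dl x (rc (fstN b)) (rad b - eps s)" using x(4) by blast
    then obtain m v where good: "\<And>n q. m \<le> n \<Longrightarrow> inb q b \<Longrightarrow>
        \<bar>val (gam n q (level (level j))) - val v\<bar> \<le> eps (level j)"
      unfolding good_def by blast
    show "\<exists>m. \<forall>w\<in>D T1. isunit w \<longrightarrow> near x w m \<longrightarrow> near (ap h x) (ap h w) j"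
    \<comment> \<open>A neighbor \<open>w\<close> this close consumes half of the slack
      \<open>eps s\<close> of \<open>x\<close>; the other half, \<open>eps (s + 1)\<close>, lets the
      same constant \<open>v\<close> serve for \<open>w\<close>.\<close>
    proof (intro exI[of _ "s + 1"] ballI impI)
      fix w assume w: "w \<in> D T1" "isunit w" "near x w (s + 1)"
      have "dl w x (eps (s + 1))"
        by (rule dl_sym[OF near_dl[OF isunit_real[OF x(2)] isunit_real[OF w(2)] w(3)]])
      from dl_trans[OF isunit_real[OF w(2)] isreal_rc this xb]
      have "dl w (rc (fstN b)) (rad b - eps (s + 1))" using eps_succ[of s] by (simp add: algebra_simps)
      then have "dl (rc v) (ap h w) (4 * eps (level j))"
        using good_ball_value[OF good w(1,2)] dl_sym by blast
      from dl_trans[OF h_real[OF x(1,2)] h_real[OF w(1,2)] good_ball_value[OF good x(1,2) xb] this]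
      have "dl (ap h x) (ap h w) (4 * eps (level j) + 4 * eps (level j))" .
      \<comment> \<open>The sum is 8 units of level \<open>j\<close>, that is half of
        \<open>eps j\<close>.\<close>
      moreover have "4 * eps (level j) + 4 * eps (level j) < eps j"
        using eps_level[of j] eps_pos[of "level j"] by linarith
      ultimately show "near (ap h x) (ap h w) j" by (rule dl_near)
    qed
  qed
  ultimately show "\<exists>u\<in>D T1. isunit u \<and> contat h u \<and> near y u k" using x(1,2) by blast
qed

end

theorem baire1_continuity_dense:
  assumes "valid e"
  shows "sat e (at_depth_0 baire1_bv_continuity_dense)"
proof (rule sat_goal[OF _ assms])
  fix h assume h: "h \<in> D (T1 \<rightarrow> T1)" "unitfun h" "isbaire1 h"
  then obtain g where "g \<in> D (T0 \<rightarrow> T1 \<rightarrow> T1)" "\<And>n. unitfun (ap g (of_n n))"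
    "\<And>n u. u \<in> D T1 \<Longrightarrow> isunit u \<Longrightarrow> contat (ap g (of_n n)) u"
    "\<And>u k. u \<in> D T1 \<Longrightarrow> isunit u \<Longrightarrow> \<exists>m. \<forall>n. m \<le> n \<longrightarrow> near (ap (ap g (of_n n)) u) (ap h u) k"
    unfolding isbaire1_def by blast
  then show "isdense (contat h)" using dense_continuity h(1,2) by blast
qed

end

section \<open>The theorem is a sentence\<close>

text \<open>Completeness asks for a sentence before any structure is at hand, so well-formedness is
  checked by purely syntactic rules, parallel to those for \<open>T\<close> and
  \<open>F\<close>.\<close>

definition okt :: "(nat \<times> ty) set \<Rightarrow> tm \<Rightarrow> ty \<Rightarrow> bool" where
  "okt V s \<tau> \<longleftrightarrow> (\<forall>d. tyof (s d) = Some \<tau> \<and> vars (s d) \<subseteq> V)"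

definition okf :: "(nat \<times> ty) set \<Rightarrow> form \<Rightarrow> bool" where
  "okf V \<phi> \<longleftrightarrow> (\<forall>d. wff (\<phi> d) \<and> fv (\<phi> d) \<subseteq> V)"

lemma okt_mono: "okt V s \<tau> \<Longrightarrow> V \<subseteq> W \<Longrightarrow> okt W s \<tau>"
  unfolding okt_def by (meson order_trans)

lemma okt_var: "(y, \<rho>) \<in> V \<Longrightarrow> okt V (cst (Var y \<rho>)) \<rho>"
  by (simp add: okt_def cst_def)

lemma okt_const:
  "okt V (cst Zero) T0" "okt V (cst One) T0" "okt V (cst Plus) (T0 \<rightarrow> T0 \<rightarrow> T0)"
  "okt V (cst Times) (T0 \<rightarrow> T0 \<rightarrow> T0)" "okt V (cst Rc) ((T0 \<rightarrow> T0 \<rightarrow> T0) \<rightarrow> T0 \<rightarrow> T0 \<rightarrow> T0)"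
  by (simp_all add: okt_def cst_def)

lemma okt_app: "okt V s (\<rho> \<rightarrow> \<tau>) \<Longrightarrow> okt V t \<rho> \<Longrightarrow> okt V (s \<cdot> t) \<tau>"
  by (simp add: okt_def app_def)

lemma okt_lam: "(\<And>y. okt (insert (y, \<rho>) V) (t (cst (Var y \<rho>))) \<tau>) \<Longrightarrow> okt V (lam \<rho> t) (\<rho> \<rightarrow> \<tau>)"
  unfolding okt_def lam_def using bracket_syntax by (metis Diff_subset_conv insert_is_Un)

lemma okt_closed: "okt {} s \<tau> \<Longrightarrow> okt V (cst (s 0)) \<tau>"
  by (simp add: okt_def cst_def)

lemma okf_atom: "okt V s T0 \<Longrightarrow> okt V t T0 \<Longrightarrow> okf V (s \<^bold>= t)" "okt V s T0 \<Longrightarrow> okt V t T0 \<Longrightarrow> okf V (s \<^bold>< t)"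
  by (simp_all add: okf_def okt_def eq_fm_def less_fm_def)

lemma okf_imp: "okf V \<phi> \<Longrightarrow> okf V \<psi> \<Longrightarrow> okf V (\<phi> \<^bold>\<longrightarrow> \<psi>)"
  by (simp add: okf_def imp_fm_def)

lemma okf_neg: "okf V \<phi> \<Longrightarrow> okf V (\<^bold>\<not> \<phi>)"
  by (simp add: okf_def neg_fm_def imp_fm_def fls_fm_def)

lemma okf_all: "(\<And>y. okf (insert (y, \<rho>) V) (\<phi> (cst (Var y \<rho>)))) \<Longrightarrow> okf V (all_fm \<rho> \<phi>)"
  unfolding okf_def all_fm_def by auto

lemma okf_ex: "(\<And>y. okf (insert (y, \<rho>) V) (\<phi> (cst (Var y \<rho>)))) \<Longrightarrow> okf V (ex_fm \<rho> \<phi>)"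
  unfolding ex_fm_def by (intro okf_neg okf_all)

lemma okf_conj: "okf V \<phi> \<Longrightarrow> okf V \<psi> \<Longrightarrow> okf V (\<phi> \<^bold>\<and> \<psi>)"
  unfolding conj_fm_def by (intro okf_neg okf_imp)

lemma okf_disj: "okf V \<phi> \<Longrightarrow> okf V \<psi> \<Longrightarrow> okf V (\<phi> \<^bold>\<or> \<psi>)"
  unfolding disj_fm_def by (intro okf_neg okf_imp)

lemma okf_le: "okt V s T0 \<Longrightarrow> okt V t T0 \<Longrightarrow> okf V (s \<^bold>\<le> t)"
  unfolding le_fm_def by (intro okf_disj okf_atom)

lemma okt_arith: "okt V s T0 \<Longrightarrow> okt V t T0 \<Longrightarrow> okt V (s \<^bold>+ t) T0" "okt V s T0 \<Longrightarrow> okt V t T0 \<Longrightarrow> okt V (s \<^bold>* t) T0"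
  unfolding plus_tm_def times_tm_def
  by (rule okt_app[OF okt_app[OF okt_const(3)]] okt_app[OF okt_app[OF okt_const(4)]]; assumption)+

lemma okt_primrec:
  assumes "\<And>x y. okt (insert (y, T0) (insert (x, T0) V)) (f (cst (Var x T0)) (cst (Var y T0))) T0"
    and "okt V m T0" "okt V n T0"
  shows "okt V (primrec_tm f m n) T0"
  unfolding primrec_tm_def
  by (rule okt_app[OF okt_app[OF okt_app[OF okt_const(5)]]]) (rule okt_lam assms)+

lemmas ok_logic = okf_atom okf_imp okf_neg okf_all okf_ex okf_conj okf_disj okf_le
lemmas ok_arith = okt_const(1,2) okt_arith

lemma okt_pred: "okt V n T0 \<Longrightarrow> okt V (pred_tm n) T0"
  unfolding pred_tm_def by (rule okt_primrec) (rule okt_var ok_arith | assumption | simp)+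

lemma okt_monus: "okt V m T0 \<Longrightarrow> okt V n T0 \<Longrightarrow> okt V (m \<^bold>- n) T0"
  unfolding monus_tm_def by (rule okt_primrec) (rule okt_pred okt_var | assumption | simp)+

lemma okt_pow2: "okt V n T0 \<Longrightarrow> okt V (pow2 n) T0"
  unfolding pow2_def by (rule okt_primrec) (rule ok_arith okt_var | assumption | simp)+

lemma okt_tri: "okt V n T0 \<Longrightarrow> okt V (tri n) T0"
  unfolding tri_def by (rule okt_primrec) (rule ok_arith okt_var | assumption | simp)+

lemma okt_closed2:
  "(\<And>x y. okt {(y, T0), (x, T0)} (t (cst (Var x T0)) (cst (Var y T0))) T0) \<Longrightarrow>
   okt V s T0 \<Longrightarrow> okt V r T0 \<Longrightarrow> okt V (cst (lam T0 (\<lambda>x. lam T0 (t x)) 0) \<cdot> s \<cdot> r) T0"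
  by (rule okt_app[OF okt_app[OF okt_closed]]; (rule okt_lam)?) (rule okt_lam)

lemma okt_closed1:
  "(\<And>x. okt {(x, T0)} (t (cst (Var x T0))) T0) \<Longrightarrow> okt V s T0 \<Longrightarrow> okt V (cst (lam T0 t 0) \<cdot> s) T0"
  by (rule okt_app[OF okt_closed]) (rule okt_lam)

lemma okt_pair: "okt V s T0 \<Longrightarrow> okt V t T0 \<Longrightarrow> okt V (pair s t) T0"
  unfolding pair_def by (rule okt_closed2) (rule okt_tri ok_arith okt_var | assumption | simp)+

lemma okt_diag: "okt V s T0 \<Longrightarrow> okt V (diag s) T0"
  unfolding diag_def
  by (rule okt_closed1) (rule okt_primrec okt_tri okt_monus ok_arith okt_var | assumption | simp)+

lemma okt_second: "okt V s T0 \<Longrightarrow> okt V (second s) T0"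
  unfolding second_def by (rule okt_closed1) (rule okt_tri okt_monus okt_diag okt_var | assumption | simp)+

lemma okt_first: "okt V s T0 \<Longrightarrow> okt V (first s) T0"
  unfolding first_def by (rule okt_closed1) (rule okt_second okt_monus okt_diag okt_var | assumption | simp)+

lemma okt_quot: "okt V s T0 \<Longrightarrow> okt V t T0 \<Longrightarrow> okt V r T0 \<Longrightarrow> okt V (quot s t r) T0"
  unfolding quot_def by (intro okt_pair)

lemma okt_qparts:
  "okt V s T0 \<Longrightarrow> okt V (qpos s) T0" "okt V s T0 \<Longrightarrow> okt V (qneg s) T0" "okt V s T0 \<Longrightarrow> okt V (qden s) T0"
  unfolding qpos_def qneg_def qden_def by (intro okt_first okt_second ok_arith; assumption)+

lemma okt_qadd: "okt V s T0 \<Longrightarrow> okt V t T0 \<Longrightarrow> okt V (s +\<^sub>Q t) T0"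
  unfolding qadd_def
  by (rule okt_closed2) (rule okt_quot okt_qparts ok_arith okt_pred okt_var | assumption | simp)+

lemma okt_quminus: "okt V s T0 \<Longrightarrow> okt V (-\<^sub>Q s) T0"
  unfolding quminus_def
  by (rule okt_closed1) (rule okt_quot okt_qparts okt_second okt_var | assumption | simp)+

lemma okt_qabs: "okt V s T0 \<Longrightarrow> okt V (qabs s) T0"
  unfolding qabs_def
  by (rule okt_closed1) (rule okt_quot okt_qparts okt_second ok_arith okt_monus okt_var | assumption | simp)+

lemma okt_qeps: "okt V s T0 \<Longrightarrow> okt V (qeps s) T0" and okt_qnat: "okt V s T0 \<Longrightarrow> okt V (qnat s) T0"
  unfolding qeps_def qnat_def by (rule okt_quot ok_arith okt_pred okt_pow2 | assumption)+

lemma okf_qless: "okt V s T0 \<Longrightarrow> okt V t T0 \<Longrightarrow> okf V (s <\<^sub>Q t)"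
  unfolding qless_def by (rule okf_atom ok_arith okt_qparts | assumption)+

lemma okf_qle: "okt V s T0 \<Longrightarrow> okt V t T0 \<Longrightarrow> okf V (s \<le>\<^sub>Q t)"
  unfolding qle_def by (intro okf_neg okf_qless)

lemmas ok_rational = okf_qless okf_qle okt_qadd okt_quminus okt_qabs okt_qeps okt_qnat

lemma okf_is_real: "okt V x T1 \<Longrightarrow> okf V (is_real x)"
  unfolding is_real_def
  by (rule ok_logic ok_rational ok_arith okt_app[where \<rho> = T0] | rule okt_var, simp | erule okt_mono, blast)+

lemma okf_req: "okt V x T1 \<Longrightarrow> okt V y T1 \<Longrightarrow> okf V (x =\<^sub>R y)"
  unfolding req_def
  by (rule ok_logic ok_rational ok_arith okt_app[where \<rho> = T0] | rule okt_var, simp | erule okt_mono, blast)+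

lemma okf_rless: "okt V x T1 \<Longrightarrow> okt V y T1 \<Longrightarrow> okf V (x <\<^sub>R y)"
  unfolding rless_def
  by (rule ok_logic ok_rational ok_arith okt_app[where \<rho> = T0] | rule okt_var, simp | erule okt_mono, blast)+

lemma okf_rle: "okt V x T1 \<Longrightarrow> okt V y T1 \<Longrightarrow> okf V (x \<le>\<^sub>R y)"
  unfolding rle_def by (intro okf_neg okf_rless)

lemma okt_rconst: "okt V q T0 \<Longrightarrow> okt V (rconst q) T1"
  unfolding rconst_def by (rule okt_lam) (erule okt_mono, blast)

lemma okt_rdist: "okt V x T1 \<Longrightarrow> okt V y T1 \<Longrightarrow> okt V (rdist x y) T1"
  unfolding rdist_def
  by (rule okt_lam ok_rational ok_arith okt_app[where \<rho> = T0] | rule okt_var, simp | erule okt_mono, blast)+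

lemma okt_rsum: "okt V f (T0 \<rightarrow> T1) \<Longrightarrow> okt V m T0 \<Longrightarrow> okt V (rsum f m) T1"
  unfolding rsum_def
  by (rule okt_lam okt_primrec ok_rational ok_arith okt_app[where \<rho> = T0] | rule okt_var, simp | erule okt_mono, blast)+

lemmas ok_real = okf_is_real okf_req okf_rless okf_rle okt_rconst okt_rdist okt_rsum

lemma okf_unit_interval: "okt V x T1 \<Longrightarrow> okf V (unit_interval x)"
  unfolding unit_interval_def by (rule ok_logic ok_real ok_rational ok_arith | assumption)+

lemma okf_units:
  "(\<And>y. okf (insert (y, T1) V) (\<phi> (cst (Var y T1)))) \<Longrightarrow> okf V (all_unit \<phi>)"
  "(\<And>y. okf (insert (y, T1) V) (\<phi> (cst (Var y T1)))) \<Longrightarrow> okf V (ex_unit \<phi>)"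
  unfolding all_unit_def ex_unit_def by (rule ok_logic okf_unit_interval okt_var | assumption | simp)+

lemma okf_unit_function: "okt V f (T1 \<rightarrow> T1) \<Longrightarrow> okf V (unit_function f)"
  unfolding unit_function_def
  by (rule okf_units ok_logic ok_real okt_app[where \<rho> = T1] | rule okt_var, simp | erule okt_mono, blast)+

lemma okf_continuous_at: "okt V f (T1 \<rightarrow> T1) \<Longrightarrow> okt V x T1 \<Longrightarrow> okf V (continuous_at f x)"
  unfolding continuous_at_def
  by (rule okf_units ok_logic ok_real ok_rational okt_app[where \<rho> = T1] | rule okt_var, simp | erule okt_mono, blast)+

lemma okf_baire1: "okt V f (T1 \<rightarrow> T1) \<Longrightarrow> okf V (baire1 f)"
  unfolding baire1_def
  by (rule okf_units ok_logic ok_real ok_rational okf_unit_function okf_continuous_at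
      | (rule okt_var, simp; fail) | (erule okt_mono, blast; fail) | rule okt_app[where \<rho> = T0] okt_app[where \<rho> = T1])+

lemma okf_bounded_variation: "okt V f (T1 \<rightarrow> T1) \<Longrightarrow> okf V (bounded_variation f)"
  unfolding bounded_variation_def
  by (rule okf_units ok_logic ok_real ok_rational ok_arith
      | (rule okt_var, simp; fail) | (erule okt_mono, blast; fail)
      | rule okt_lam | rule okt_app[where \<rho> = T0 and \<tau> = T1] okt_app[where \<rho> = T1 and \<tau> = T1])+

lemma okf_dense: "okt V f (T1 \<rightarrow> T1) \<Longrightarrow> okf V (dense_in_unit_interval (\<lambda>x. continuous_at f x))"
  unfolding dense_in_unit_interval_def
  by (rule okf_units ok_logic okf_continuous_at ok_real ok_rational | rule okt_var, simp | erule okt_mono, blast)+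

lemma sentence_goal: "sentence (at_depth_0 baire1_bv_continuity_dense)"
proof -
  have "okf {} baire1_bv_continuity_dense"
    unfolding baire1_bv_continuity_dense_def
    by (intro okf_all okf_imp okf_conj okf_unit_function okf_baire1 okf_bounded_variation okf_dense okt_var insertI1)
  then show ?thesis by (auto simp: okf_def sentence_def at_depth_0_def)
qed

section \<open>Parameters in the axioms\<close>

lemma tpars_eqT:
  "\<forall>d. tpars (s d) = {} \<and> tpars (t d) = {} \<Longrightarrow> pars (eqT \<rho> s t d) = {}"
proof (induction \<rho> arbitrary: s t d)
  case T0
  then show ?case by (simp add: eq_fm_def)
next
  case (Fun \<rho> \<tau>)
  have "pars (eqT \<tau> (s \<cdot> cst (Var d \<rho>)) (t \<cdot> cst (Var d \<rho>)) (Suc d)) = {}"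
    using Fun.prems by (intro Fun.IH(2)) (simp add: app_def cst_def)
  then show ?case by (simp add: all_fm_def)
qed

lemma pars_generalize: "pars (generalize vs \<phi>) = pars \<phi>"
  by (induction vs) (simp_all add: generalize_def case_prod_beta)

lemma pars_subst: "pars (subst x \<rho> u \<phi>) \<subseteq> pars \<phi> \<union> tpars u"
proof -
  have t: "tpars (tsubst x \<rho> u t) \<subseteq> tpars t \<union> tpars u" for t
  proof (induction t)
    case (App s t)
    then show ?case unfolding tsubst.simps tpars.simps by blast
  qed auto
  show ?thesis
  proof (induction \<phi>)
    case (Eq s t)
    then show ?case using t[of s] t[of t] by auto
  next
    case (Less s t)
    then show ?case using t[of s] t[of t] by auto
  next
    case (Imp \<phi> \<psi>)
    then show ?case unfolding subst.simps pars.simps by blast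
  next
    case (Forall y \<sigma> \<phi>)
    then show ?case by (cases "(y, \<sigma>) = (x, \<rho>)") auto
  qed simp
qed

lemmas form_defs = all_fm_def ex_fm_def imp_fm_def neg_fm_def conj_fm_def disj_fm_def iff_fm_def le_fm_def
  eq_fm_def less_fm_def fls_fm_def plus_tm_def times_tm_def app_def cst_def

lemma pars_ACA: "\<phi> \<in> ACA0\<omega> \<Longrightarrow> pars \<phi> = {}"
proof -
  have eq: "\<phi> \<in> equality_axioms \<Longrightarrow> pars (\<phi> 0) = {}" for \<phi>
    by (auto simp: equality_axioms_def form_defs)
  have ar: "\<phi> \<in> arithmetic_axioms \<Longrightarrow> pars (\<phi> 0) = {}" for \<phi>
    by (auto simp: arithmetic_axioms_def form_defs)
  have co: "\<phi> \<in> combinator_axioms \<Longrightarrow> pars (\<phi> 0) = {}" for \<phi>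
    unfolding combinator_axioms_def
    by (elim UnE CollectE exE conjE) (simp_all add: all_fm_def tpars_eqT app_def cst_def)
  have re: "\<phi> \<in> recursor_axioms \<Longrightarrow> pars (\<phi> 0) = {}" for \<phi>
    by (auto simp: recursor_axioms_def form_defs)
  have ex: "\<phi> \<in> extensionality_axioms \<Longrightarrow> pars (\<phi> 0) = {}" for \<phi>
    unfolding extensionality_axioms_def
    by (elim CollectE exE conjE) (simp add: all_fm_def imp_fm_def tpars_eqT app_def cst_def)
  have sub: "pars (subst x \<rho> u A) = {}" if "pars A = {}" "tpars u = {}" for x \<rho> u A
    using pars_subst[of x \<rho> u A] that by simp
  have ind: "\<phi> \<in> induction_axioms \<Longrightarrow> pars \<phi> = {}" for \<phi>
    unfolding induction_axioms_def by (elim CollectE exE conjE) (simp add: pars_generalize sub)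
  have qf: "\<phi> \<in> QF_AC_10_axioms \<Longrightarrow> pars \<phi> = {}" for \<phi>
    unfolding QF_AC_10_axioms_def by (elim CollectE exE conjE) (simp add: pars_generalize sub)
  have e2: "pars (exists2 0) = {}" by (simp add: exists2_def form_defs)
  assume "\<phi> \<in> ACA0\<omega>"
  then show ?thesis
    unfolding ACA0\<omega>_def RCA0\<omega>_def at_depth_0_def using eq ar co re ex ind qf e2 by auto
qed

lemma many_fresh_ACA: "many_fresh ACA0\<omega>"
  unfolding many_fresh_def by (simp add: pars_ACA)

text \<open>\<open>FIN\<close> adds three formulas, and a single formula uses up only finitely many
  parameters.\<close>

lemma many_fresh_ACA_FIN: "many_fresh (ACA0\<omega> \<union> FIN)"
  unfolding FIN_def by (simp add: many_fresh_ACA many_fresh_insert)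


section \<open>The numbers of a countermodel\<close>

text \<open>
  The type class of the numbers in \<open>arithmetic_model\<close> calls for a type.  As a type cannot depend on the
  assumption that the theorem is underivable, the semiring is chosen to be the one of a
  countermodel if there is any, and the standard one otherwise.
\<close>

definition refutes_goal ::
    "(ty \<Rightarrow> trm set set) \<Rightarrow> (trm set \<Rightarrow> trm set \<Rightarrow> trm set) \<Rightarrow> (trm \<Rightarrow> trm set) \<Rightarrow> (trm set \<Rightarrow> trm set \<Rightarrow> bool) \<Rightarrow> bool" where
  "refutes_goal D ap I lt \<longleftrightarrow> aca_model D ap I lt \<and> \<not> models D ap I lt (at_depth_0 baire1_bv_continuity_dense)"

type_synonym semiring_data =
  "trm set set \<times> trm set \<times> trm set \<times> (trm set \<Rightarrow> trm set \<Rightarrow> trm set) \<times> (trm set \<Rightarrow> trm set \<Rightarrow> trm set)"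

definition is_semiring :: "semiring_data \<Rightarrow> bool" where
  "is_semiring = (\<lambda>(C, z, u, p, t). ordered_semiring_on C z u p t)"

definition counter_numbers :: "semiring_data \<Rightarrow> bool" where
  "counter_numbers S \<longleftrightarrow> (\<exists>D ap I lt. refutes_goal D ap I lt \<and>
     S = (D T0, I Zero, I One, \<lambda>a b. ap (ap (I Plus) a) b, \<lambda>a b. ap (ap (I Times) a) b))"

definition numbers :: semiring_data where
  "numbers = (SOME S. is_semiring S \<and> ((\<exists>S. counter_numbers S) \<longrightarrow> counter_numbers S))"

lemma counter_numbers_semiring: "counter_numbers S \<Longrightarrow> is_semiring S"
proof -
  assume "counter_numbers S"
  then obtain D ap I lt where r: "refutes_goal D ap I lt"
    and data: "S = (D T0, I Zero, I One, \<lambda>a b. ap (ap (I Plus) a) b, \<lambda>a b. ap (ap (I Times) a) b)"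
    unfolding counter_numbers_def by blast
  interpret aca_model D ap I lt using r by (simp add: refutes_goal_def)
  show ?thesis using ordered_semiring unfolding is_semiring_def data pl_def tm_def by simp
qed

text \<open>The natural numbers are copied into \<open>trm set\<close>, the element type of the
  countermodels, as singletons of variables.\<close>

lemma standard_semiring: "\<exists>S. is_semiring S"
proof -
  define f :: "nat \<Rightarrow> trm set" where "f n = {Var n T0}" for n
  have inj: "inj f" by (auto simp: f_def inj_on_def)
  define p where "p a b = f (inv f a + inv f b)" for a b
  define t where "t a b = f (inv f a * inv f b)" for a b
  have p: "p (f m) (f n) = f (m + n)" and t: "t (f m) (f n) = f (m * n)" for m n
    by (simp_all add: p_def t_def inv_f_f[OF inj])
  have eq: "f m = f n \<longleftrightarrow> m = n" for m n by (rule inj_eq[OF inj])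
  have "ordered_semiring_on (range f) (f 0) (f 1) p t"
    unfolding ordered_semiring_on_def
  proof (intro conjI ballI)
    fix a b assume "a \<in> range f" "b \<in> range f"
    then obtain m n where a: "a = f m" and b: "b = f n" by blast
    show "p a b \<in> range f" "t a b \<in> range f" "p a b = p b a" "t a b = t b a"
      "p a b = f 0 \<longrightarrow> a = f 0" "t a b = f 0 \<longrightarrow> a = f 0 \<or> b = f 0"
      by (simp_all add: a b p t eq ac_simps)
    have "p a (f (n - m)) = b \<or> p b (f (m - n)) = a" by (auto simp: a b p eq)
    then show "\<exists>c\<in>range f. p a c = b \<or> p b c = a" by blast
  next
    fix a b c assume "a \<in> range f" "b \<in> range f" "c \<in> range f"
    then obtain m n k where a: "a = f m" and b: "b = f n" and c: "c = f k" by blast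
    show "p (p a b) c = p a (p b c)" "t (t a b) c = t a (t b c)" "t a (p b c) = p (t a b) (t a c)"
      "p c a = p c b \<longrightarrow> a = b"
      by (simp_all add: a b c p t eq algebra_simps)
  next
    fix a assume "a \<in> range f"
    then obtain m where a: "a = f m" by blast
    show "p (f 0) a = a" "t (f 0) a = f 0" "t (f 1) a = a" by (simp_all add: a p t)
  qed (simp_all add: eq)
  then have "is_semiring (range f, f 0, f 1, p, t)" by (simp add: is_semiring_def)
  then show ?thesis by blast
qed

lemma numbers: "is_semiring numbers" "(\<exists>S. counter_numbers S) \<Longrightarrow> counter_numbers numbers"
proof -
  have "\<exists>S. is_semiring S \<and> ((\<exists>S. counter_numbers S) \<longrightarrow> counter_numbers S)"
    using counter_numbers_semiring standard_semiring by blast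
  then have "is_semiring numbers \<and> ((\<exists>S. counter_numbers S) \<longrightarrow> counter_numbers numbers)"
    unfolding numbers_def by (rule someI_ex)
  then show "is_semiring numbers" "(\<exists>S. counter_numbers S) \<Longrightarrow> counter_numbers numbers"
    by simp_all
qed

section \<open>The type of the chosen numbers\<close>

definition "num_carrier = fst numbers"
definition "num_zero = fst (snd numbers)"
definition "num_one = fst (snd (snd numbers))"
definition "num_plus = fst (snd (snd (snd numbers)))"
definition "num_times = snd (snd (snd (snd numbers)))"

lemma num_semiring: "ordered_semiring_on num_carrier num_zero num_one num_plus num_times"
  using numbers(1)
  by (simp add: is_semiring_def num_carrier_def num_zero_def num_one_def num_plus_def num_times_def case_prod_beta)

lemma carrier_constants: "num_zero \<in> num_carrier" "num_one \<in> num_carrier" "num_zero \<noteq> num_one"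
  using num_semiring unfolding ordered_semiring_on_def by simp_all

lemma carrier_laws:
  assumes "a \<in> num_carrier" "b \<in> num_carrier" "c \<in> num_carrier"
  shows "num_plus num_zero a = a" "num_times num_zero a = num_zero" "num_times num_one a = a"
    "num_plus a b = num_plus b a" "num_times a b = num_times b a"
    "num_plus (num_plus a b) c = num_plus a (num_plus b c)"
    "num_times (num_times a b) c = num_times a (num_times b c)"
    "num_times a (num_plus b c) = num_plus (num_times a b) (num_times a c)"
    "num_plus a b = num_zero \<Longrightarrow> a = num_zero"
    "num_times a b = num_zero \<Longrightarrow> a = num_zero \<or> b = num_zero"
    "num_plus c a = num_plus c b \<Longrightarrow> a = b"
    "\<exists>c\<in>num_carrier. num_plus a c = b \<or> num_plus b c = a"
    "num_plus a b \<in> num_carrier" "num_times a b \<in> num_carrier"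
proof -
  note laws = num_semiring[unfolded ordered_semiring_on_def]
  from laws have "\<forall>a\<in>num_carrier. num_plus num_zero a = a \<and> num_times num_zero a = num_zero \<and> num_times num_one a = a"
    by (elim conjE)
  from bspec[OF this assms(1)]
  show "num_plus num_zero a = a" "num_times num_zero a = num_zero" "num_times num_one a = a" by simp_all
  from laws have "\<forall>a\<in>num_carrier. \<forall>b\<in>num_carrier. num_plus a b \<in> num_carrier \<and> num_times a b \<in> num_carrier \<and>
      num_plus a b = num_plus b a \<and> num_times a b = num_times b a \<and>
      (num_plus a b = num_zero \<longrightarrow> a = num_zero) \<and>
      (num_times a b = num_zero \<longrightarrow> a = num_zero \<or> b = num_zero) \<and>
      (\<exists>c\<in>num_carrier. num_plus a c = b \<or> num_plus b c = a)"
    by (elim conjE)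
  note 2 = bspec[OF bspec[OF this assms(1)] assms(2)]
  show "num_plus a b \<in> num_carrier" using 2 by (elim conjE)
  show "num_times a b \<in> num_carrier" using 2 by (elim conjE)
  show "num_plus a b = num_plus b a" using 2 by (elim conjE)
  show "num_times a b = num_times b a" using 2 by (elim conjE)
  show "num_plus a b = num_zero \<Longrightarrow> a = num_zero" using 2 by (elim conjE) (erule (1) mp)
  show "num_times a b = num_zero \<Longrightarrow> a = num_zero \<or> b = num_zero" using 2 by (elim conjE) (erule (1) mp)
  show "\<exists>c\<in>num_carrier. num_plus a c = b \<or> num_plus b c = a" using 2 by (elim conjE)
  from laws have "\<forall>a\<in>num_carrier. \<forall>b\<in>num_carrier. \<forall>c\<in>num_carrier.
      num_plus (num_plus a b) c = num_plus a (num_plus b c) \<and> num_times (num_times a b) c = num_times a (num_times b c) \<and>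
      num_times a (num_plus b c) = num_plus (num_times a b) (num_times a c) \<and> (num_plus c a = num_plus c b \<longrightarrow> a = b)"
    by (elim conjE)
  note 3 = bspec[OF bspec[OF bspec[OF this assms(1)] assms(2)] assms(3)]
  show "num_plus (num_plus a b) c = num_plus a (num_plus b c)" using 3 by (elim conjE)
  show "num_times (num_times a b) c = num_times a (num_times b c)" using 3 by (elim conjE)
  show "num_times a (num_plus b c) = num_plus (num_times a b) (num_times a c)" using 3 by (elim conjE)
  show "num_plus c a = num_plus c b \<Longrightarrow> a = b" using 3 by (elim conjE) (erule (1) mp)
qed

typedef number = num_carrier
  using carrier_constants(1) by (rule exI)

instantiation number :: comm_semiring_1
begin

definition zero_number :: number where "zero_number = Abs_number num_zero"
definition one_number :: number where "one_number = Abs_number num_one"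

definition plus_number :: "number \<Rightarrow> number \<Rightarrow> number" where
  "plus_number a b = Abs_number (num_plus (Rep_number a) (Rep_number b))"

definition times_number :: "number \<Rightarrow> number \<Rightarrow> number" where
  "times_number a b = Abs_number (num_times (Rep_number a) (Rep_number b))"

lemma Rep_number_simps:
  "Rep_number 0 = num_zero" "Rep_number 1 = num_one"
  "Rep_number (a + b) = num_plus (Rep_number a) (Rep_number b)"
  "Rep_number (a * b) = num_times (Rep_number a) (Rep_number b)"
  unfolding zero_number_def one_number_def plus_number_def times_number_def
  using carrier_constants carrier_laws(13,14)[OF Rep_number[of a] Rep_number[of b] Rep_number[of a]]
  by (simp_all add: Abs_number_inverse)

lemmas Rep_simps = Rep_number_inject[symmetric] Rep_number_simps

lemma number_laws:
  "0 + a = a" "0 * a = 0" "1 * a = a" "a + b = b + a" "a * b = b * a"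
  "a + b + c = a + (b + c)" "a * b * c = a * (b * c)" "a * (b + c) = a * b + a * c"
  "a + b = 0 \<Longrightarrow> a = 0" "a * b = 0 \<Longrightarrow> a = 0 \<or> b = 0" "c + a = c + b \<Longrightarrow> a = b" for a b c :: number
  unfolding Rep_simps
  by (fact carrier_laws[OF Rep_number[of a] Rep_number[of b] Rep_number[of c]])+

lemmas number_zero_laws = number_laws(9-11)

instance
proof
  fix a b c :: number
  show "a + b + c = a + (b + c)" "a + b = b + a" "0 + a = a" "a * b * c = a * (b * c)" "a * b = b * a"
    "1 * a = a" "0 * a = 0"
    by (rule number_laws)+
  show "a * 0 = 0" using number_laws(2)[of a] number_laws(5)[of a 0] by simp
  show "(a + b) * c = a * c + b * c"
    using number_laws(8)[of c a b] number_laws(5)[of c] by simp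
  show "(0 :: number) \<noteq> 1" unfolding Rep_simps by (rule carrier_constants)
qed

end

instantiation number :: linordered_semidom
begin

definition less_eq_number :: "number \<Rightarrow> number \<Rightarrow> bool" where
  "less_eq_number a b \<longleftrightarrow> (\<exists>c. b = a + c)"

definition less_number :: "number \<Rightarrow> number \<Rightarrow> bool" where
  "less_number a b \<longleftrightarrow> a \<le> b \<and> a \<noteq> b"

text \<open>Cancellation makes the difference unique. The default 0 truncates subtraction, which
  validates \<open>a - b - c = a - (b + c)\<close> also when too much is subtracted.\<close>

definition minus_number :: "number \<Rightarrow> number \<Rightarrow> number" where
  "minus_number a b = (if b \<le> a then THE c. a = b + c else 0)"

lemma number_cases: "(\<exists>c. b = a + c) \<or> (\<exists>c. a = b + c)" for a b :: number
proof -
  obtain c where "c \<in> num_carrier" "num_plus (Rep_number a) c = Rep_number b \<or> num_plus (Rep_number b) c = Rep_number a"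
    using carrier_laws(12)[OF Rep_number[of a] Rep_number[of b] Rep_number[of a]] by blast
  then have "b = a + Abs_number c \<or> a = b + Abs_number c"
    unfolding Rep_simps by (auto simp: Abs_number_inverse)
  then show ?thesis by blast
qed

lemma number_minus: "b + c - b = c" for b c :: number
proof -
  have "(THE d. b + c = b + d) = c" by (rule the_equality) (auto dest: number_zero_laws(3))
  moreover have "b \<le> b + c" by (auto simp: less_eq_number_def)
  ultimately show ?thesis by (simp add: minus_number_def)
qed

lemma number_minus_zero: "a - (a + c) = 0" for a c :: number
proof (cases "a + c \<le> a")
  case True
  then obtain d where d: "a = a + c + d" by (auto simp: less_eq_number_def)
  then have "a + (c + d) = a + 0" by (simp add: add.assoc)
  then have "c + d = 0" by (rule number_zero_laws(3))
  then have "c = 0" by (rule number_zero_laws(1))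
  then show ?thesis using number_minus[of a 0] by simp
qed (simp add: minus_number_def)

instance
proof
  fix a b c :: number
  show "a + b - a = b" by (rule number_minus)
  show "a - b - c = a - (b + c)"
  proof (cases "\<exists>d. a = b + d")
    case True
    then obtain d where a: "a = b + d" by blast
    consider e where "d = c + e" | e where "c = d + e" using number_cases by blast
    then show ?thesis
    proof cases
      case 1
      then show ?thesis using number_minus[of "b + c" e] by (simp add: a number_minus add.assoc)
    next
      case 2
      then show ?thesis using number_minus_zero[of "b + d" e] number_minus_zero[of d e]
        by (simp add: a number_minus add.assoc)
    qed
  next
    case False
    then obtain d where "b = a + d" using number_cases by blast
    then show ?thesis
      using number_minus_zero[of a d] number_minus_zero[of a "d + c"] number_minus_zero[of 0 c]
      by (simp add: add.assoc)
  qed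
  show "a * (b - c) = a * b - a * c"
  proof -
    consider d where "b = c + d" | d where "c = b + d" using number_cases by blast
    then show ?thesis
      by cases (simp_all add: distrib_left number_minus number_minus_zero)
  qed
  show "a \<noteq> 0 \<Longrightarrow> b \<noteq> 0 \<Longrightarrow> a * b \<noteq> 0" using number_zero_laws(2) by blast
  show "a \<le> a" unfolding less_eq_number_def by (rule exI[of _ 0]) simp
  show trans: "a \<le> b \<Longrightarrow> b \<le> c \<Longrightarrow> a \<le> c" for a b c :: number
    unfolding less_eq_number_def by (elim exE) (auto simp: add.assoc)
  show antisym: "a \<le> b \<Longrightarrow> b \<le> a \<Longrightarrow> a = b" for a b :: number
  proof -
    assume "a \<le> b" "b \<le> a"
    then obtain c d where c: "b = a + c" and d: "a = b + d" by (auto simp: less_eq_number_def)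
    have "a + (c + d) = a + 0" using d unfolding c by (simp add: add.assoc)
    then have "c + d = 0" by (rule number_zero_laws(3))
    then have "c = 0" by (rule number_zero_laws(1))
    then show "a = b" by (simp add: c)
  qed
  show "a < b \<longleftrightarrow> a \<le> b \<and> \<not> b \<le> a"
  proof
    assume "a < b"
    then show "a \<le> b \<and> \<not> b \<le> a" using antisym unfolding less_number_def by blast
  next
    assume "a \<le> b \<and> \<not> b \<le> a"
    moreover have "a \<le> a" unfolding less_eq_number_def by (rule exI[of _ 0]) simp
    ultimately show "a < b" unfolding less_number_def by blast
  qed
  show "a \<le> b \<or> b \<le> a" using number_cases[of a b] unfolding less_eq_number_def by blast
  show "a \<le> b \<Longrightarrow> c + a \<le> c + b" unfolding less_eq_number_def by (elim exE) (auto simp: add.assoc)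
  show "c * a < c * b" if "a < b" "0 < c"
  proof -
    from \<open>a < b\<close> obtain d where b: "b = a + d" and "a \<noteq> b"
      unfolding less_number_def less_eq_number_def by blast
    have "c * d \<noteq> 0"
    proof
      assume "c * d = 0"
      then have "c = 0 \<or> d = 0" by (rule number_zero_laws(2))
      then show False using that(2) \<open>a \<noteq> b\<close> b by (auto simp: less_number_def)
    qed
    then have "c * a \<noteq> c * b" using number_zero_laws(3)[of "c * a" 0 "c * d"] by (auto simp: b distrib_left)
    then show ?thesis by (auto simp: less_number_def less_eq_number_def b distrib_left)
  qed
  show "(0 :: number) < 1" unfolding less_number_def less_eq_number_def by auto
  show "b \<le> a \<Longrightarrow> a - b + b = a"
  proof -
    assume "b \<le> a"
    then obtain d where a: "a = b + d" unfolding less_eq_number_def by blast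
    show "a - b + b = a" unfolding a number_minus by (rule add.commute)
  qed
qed

end

theorem theorem3p25:
  shows "ACA0\<omega> \<union> FIN \<turnstile> at_depth_0 baire1_bv_continuity_dense"
proof (rule ccontr)
  let ?goal = "at_depth_0 baire1_bv_continuity_dense"
  assume "\<not> ?thesis"
  then have "\<not> ACA0\<omega> \<turnstile> ?goal" using derives_weaken[OF _ Un_upper1 many_fresh_ACA_FIN] by blast
  moreover have "at_depth_0 ` (equality_axioms \<union> extensionality_axioms) \<subseteq> ACA0\<omega>"
    unfolding ACA0\<omega>_def RCA0\<omega>_def by blast
  ultimately obtain D :: "ty \<Rightarrow> trm set set" and ap I lt where M: "type_structure D ap I"
      "\<And>\<psi>. \<psi> \<in> ACA0\<omega> \<Longrightarrow> sentence \<psi> \<Longrightarrow> models D ap I lt \<psi>" "\<not> models D ap I lt ?goal"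
    using countermodel[OF many_fresh_ACA _ sentence_goal] by blast
  have "aca_model D ap I lt"
    using M(1,2) unfolding aca_model_def aca_model_axioms_def models_def by blast
  then have "refutes_goal D ap I lt" using M(3) by (simp add: refutes_goal_def)
  then have "counter_numbers numbers" using numbers(2) unfolding counter_numbers_def by blast
  \<comment> \<open>The type \<open>number\<close> belongs to some countermodel, not necessarily to
    the one just found; the argument continues in the former.\<close>
  then obtain D ap I lt where r: "refutes_goal D ap I lt"
    and data: "numbers = (D T0, I Zero, I One, \<lambda>a b. ap (ap (I Plus) a) b, \<lambda>a b. ap (ap (I Times) a) b)"
    unfolding counter_numbers_def by blast
  interpret aca_model D ap I lt using r by (simp add: refutes_goal_def)
  have C: "num_carrier = D T0" "num_zero = z" "num_one = one" "num_plus = pl" "num_times = tm"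
    by (simp_all add: num_carrier_def num_zero_def num_one_def num_plus_def num_times_def data pl_def tm_def fun_eq_iff)
  \<comment> \<open>Matches the order of the type, where the summand is an element of
    \<open>number\<close>, with \<open>less_iff\<close>, where it ranges over
    \<open>D T0\<close>.\<close>
  have ex: "(\<exists>c. b = a + c) \<longleftrightarrow> (\<exists>c\<in>D T0. pl (Rep_number a) c = Rep_number b)" for a b
    unfolding Rep_simps C(4) using Rep_number Rep_number_cases[unfolded C(1)] unfolding C(1) by metis
  interpret arithmetic_model D ap I lt Rep_number
  proof
    show "bij_betw Rep_number UNIV (D T0)"
      using type_definition.Rep_range[OF type_definition_number] Rep_number_inject
      by (auto simp: bij_betw_def inj_on_def C(1))
    show "lt (Rep_number a) (Rep_number b) \<longleftrightarrow> a < b" for a b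
      using less_iff[of "Rep_number a" "Rep_number b"] Rep_number[unfolded C(1)] ex[of b a]
      by (simp add: less_number_def less_eq_number_def Rep_number_inject conj_commute)
  qed (simp_all add: Rep_number_simps C)
  have "models D ap I lt ?goal" using baire1_continuity_dense by (simp add: models_def)
  then show False using r by (simp add: refutes_goal_def)
qed

end
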